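(* Let $m$ be the order of the ordinary differential equation $$F(z,u,\delta u,\ldots,\delta^m u)=0,\qquad \delta=z\frac{d}{dz},$$ where $F(z,u_0,u_1,\ldots,u_m)\not\equiv 0$ is a polynomial with complex coefficients in $m+2$ variables. Let $$\varphi=\sum_{n=0}^{\infty}c_nz^{s_n},\qquad c_n\in\mathbb{C},\ s_n\in\mathbb{C},$$ be a generalized power series (with pairwise distinct exponents) such that $0\leqslant \mathrm{Re}\,s_0\leqslant \mathrm{Re}\,s_1\leqslant\ldots$ and $\lim_{n\to\infty}\mathrm{Re}\,s_n=+\infty$, which formally satisfies the equation, i.e. $F(z,\Phi)=0$ with $\Phi=(\varphi,\delta\varphi,\ldots,\delta^m\varphi)$. Assume that $\frac{\partial F}{\partial u_m}(z,\Phi)\neq 0$ (as a generalized power series), and that there are $\lambda\in\mathbb{C}$ and $A_0,\ldots,A_m\in\mathbb{C}$, not all equal to zero, such that for each $i=0,1,\ldots,m$ $$\frac{\partial F}{\partial u_i}(z,\Phi)=A_iz^{\lambda}+B_iz^{\lambda_i}+\ldots,\qquad \mathrm{Re}\,\lambda_i>\mathrm{Re}\,\lambda,$$ that is, $\frac{\partial F}{\partial u_i}(z,\Phi)-A_iz^{\lambda}$ contains only powers of $z$ whose exponents have real part strictly greater than $\mathrm{Re}\,\lambda$. Let $k$ be the least of all the positive slopes of the Newton polygon $\mathcal{N}(L_\varphi)$ of the linear operator $L_{\varphi}=\sum_{i=0}^m\frac{\partial F}{\partial u_i}(z,\Phi)\,\delta^i$ (or $k=+\infty$, if $\mathcal{N}(L_\varphi)$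 has no positive slopes). Then for any sector $S$ of sufficiently small radius with vertex at the origin and of opening less than $2\pi$, the series $$\sum_{n=0}^{\infty}\frac{c_n}{\Gamma(1+s_n/k)}\,z^{s_n}$$ converges uniformly in $S$. Precisely: for all real $\alpha<\beta$ with $\beta-\alpha<2\pi$ there is $R>0$ such that the series converges uniformly on $S=\{z: 0<|z|<R,\ \alpha<\arg z<\beta\}$.
   Context: Formal calculus with generalized power series: $\delta^j\varphi=\sum_{n=0}^\infty c_n s_n^j z^{s_n}$, and products are computed by $z^{s}z^{s'}=z^{s+s'}$. Since $0\leqslant\mathrm{Re}\,s_n\to+\infty$, for every polynomial $P(z,u_0,\ldots,u_m)$ only finitely many products of terms contribute to any given power $z^s$ in the expansion of $P(z,\Phi)$, and only finitely many exponents of the expansion have real part at most any given $N$; so $P(z,\Phi)$ is a well-defined generalized power series whose terms can be ordered by non-decreasing real part of the exponent. "Formally satisfies" means that all the coefficients of $F(z,\Phi)$ vanish. The valuation $\mathrm{val}$ of a nonzero generalized power series is the exponent of its first term with nonzero coefficient (the terms being ordered by non-decreasing real part of exponents); $\mathrm{Re}\,\mathrm{val}$ is thus the minimal real part of an exponent occurring with nonzero coefficient, and $\mathrm{Re}\,\mathrm{val}\,0=+\infty$. The Newton polygon $\mathcal{N}(L_\varphi)$ is the boundary curve of the convex hull of $$\bigcup_{i=0}^m\Bigl\{(x,y)\in\mathbb{R}^2\mid x\leqslant i,\ y\geqslant \mathrm{Re}\,\mathrm{val}\,\frac{\partial F}{\partial u_i}(z,\Phi)\Bigr\}$$ (the set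 with index $i$ is empty if $\frac{\partial F}{\partial u_i}(z,\Phi)=0$). Its positive slopes are the slopes of its non-vertical edges having positive (finite) slope. $\Gamma$ is the Euler gamma-function; for $k=+\infty$ one puts $s_n/k=0$, so that $\Gamma(1+s_n/k)=1$. In the sector $S$ the powers are $z^{s}=e^{s\log z}$ with the branch $\log z=\ln|z|+i\arg z$, $\arg z\in(\alpha,\beta)$. *)

theory Defs
  imports "HOL-Analysis.Analysis" "HOL-Library.Poly_Mapping"
begin

section \<open>Generalized power series with complex exponents\<close>

text \<open>
  A series is given by its coefficient function. Only finitely many exponents may have real
  part below any given bound; thus the terms of nonzero coefficient can be enumerated with
  real parts non-decreasing and, if there are infinitely many, tending to infinity.
  Exponents of negative real part are allowed, so that these series form a ring
  that contains all monomials.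
\<close>

typedef gen_series = "{f :: complex \<Rightarrow> complex. \<forall>N. finite {s. f s \<noteq> 0 \<and> Re s \<le> N}}"
  morphisms gs_coeff Abs_gs
  by (rule exI[of _ "\<lambda>_. 0"]) simp

setup_lifting type_definition_gen_series

lemma finite_gs_coeff: "finite {s. gs_coeff f s \<noteq> 0 \<and> Re s \<le> N}"
  using gs_coeff[of f] by simp

lemma gs_eqI: "(\<And>s. gs_coeff f s = gs_coeff g s) \<Longrightarrow> f = g"
  by (metis gs_coeff_inject ext)

lemma locally_finite_bounded_below:
  assumes "finite {s. f s \<noteq> (0::complex) \<and> Re s \<le> 0}"
  shows "\<exists>B. \<forall>s. f s \<noteq> 0 \<longrightarrow> B \<le> Re s"
proof -
  let ?S = "insert 0 (Re ` {s. f s \<noteq> 0 \<and> Re s \<le> 0})"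
  have fin: "finite ?S" using assms by simp
  have "Min ?S \<le> Re s" if "f s \<noteq> 0" for s
  proof (cases "Re s \<le> 0")
    case True
    then show ?thesis using fin that by (intro Min_le) auto
  next
    case False
    have "Min ?S \<le> 0" using fin by (intro Min_le) auto
    then show ?thesis using False by linarith
  qed
  then show ?thesis by blast
qed

lemma convolution_boxes:
  assumes "\<And>N. finite {s. f s \<noteq> (0::complex) \<and> Re s \<le> N}"
    and "\<And>N. finite {s. g s \<noteq> (0::complex) \<and> Re s \<le> N}"
  shows "\<exists>A B. finite A \<and> finite B \<and>
    (\<forall>a b. f a \<noteq> 0 \<longrightarrow> g b \<noteq> 0 \<longrightarrow> Re (a + b) \<le> N \<longrightarrow> a \<in> A \<and> b \<in> B)"
proof -
  obtain B1 where B1: "\<forall>s. f s \<noteq> 0 \<longrightarrow> B1 \<le> Re s"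
    using locally_finite_bounded_below[OF assms(1)] by blast
  obtain B2 where B2: "\<forall>s. g s \<noteq> 0 \<longrightarrow> B2 \<le> Re s"
    using locally_finite_bounded_below[OF assms(2)] by blast
  show ?thesis
  proof (intro exI conjI allI impI)
    show "finite {s. f s \<noteq> 0 \<and> Re s \<le> N - B2}" by (rule assms)
    show "finite {s. g s \<noteq> 0 \<and> Re s \<le> N - B1}" by (rule assms)
  next
    fix a b assume *: "f a \<noteq> 0" "g b \<noteq> 0" "Re (a + b) \<le> N"
    show "a \<in> {s. f s \<noteq> 0 \<and> Re s \<le> N - B2}" "b \<in> {s. g s \<noteq> 0 \<and> Re s \<le> N - B1}"
      using * B1[rule_format, of a] B2[rule_format, of b] by auto
  qed
qed

lemma sum_Collect_nonzero: "sum f {x. P x} \<noteq> 0 \<Longrightarrow> \<exists>x. P x"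
  by (metis Collect_empty_eq sum.empty)

instantiation gen_series :: ab_group_add
begin

lift_definition zero_gen_series :: gen_series is "\<lambda>_. 0" by simp

lift_definition plus_gen_series :: "gen_series \<Rightarrow> gen_series \<Rightarrow> gen_series"
  is "\<lambda>f g s. f s + g s"
proof -
  fix f g :: "complex \<Rightarrow> complex" and N :: real
  assume *: "\<And>N. finite {s. f s \<noteq> 0 \<and> Re s \<le> N}" "\<And>N. finite {s. g s \<noteq> 0 \<and> Re s \<le> N}"
  have "{s. f s + g s \<noteq> 0 \<and> Re s \<le> N}
      \<subseteq> {s. f s \<noteq> 0 \<and> Re s \<le> N} \<union> {s. g s \<noteq> 0 \<and> Re s \<le> N}" by auto
  then show "finite {s. f s + g s \<noteq> 0 \<and> Re s \<le> N}"
    using *[of N] by (meson finite_UnI finite_subset)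
qed

lift_definition uminus_gen_series :: "gen_series \<Rightarrow> gen_series" is "\<lambda>f s. - f s"
  by simp

definition minus_gen_series :: "gen_series \<Rightarrow> gen_series \<Rightarrow> gen_series"
  where "minus_gen_series f g = f + - g"

instance
proof
  fix f g h :: gen_series
  show "f + g + h = f + (g + h)" by transfer (simp add: algebra_simps)
  show "f + g = g + f" by transfer (simp add: algebra_simps)
  show "0 + f = f" by transfer simp
  show "- f + f = 0" by transfer simp
  show "f - g = f + - g" by (rule minus_gen_series_def)
qed

end

lift_definition gs_monom :: "complex \<Rightarrow> complex \<Rightarrow> gen_series"
  is "\<lambda>c e s. if s = e then c else 0"
proof -
  fix c e :: complex and N :: real
  have "{s. (if s = e then c else 0) \<noteq> 0 \<and> Re s \<le> N} \<subseteq> {e}" by auto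
  then show "finite {s. (if s = e then c else 0) \<noteq> 0 \<and> Re s \<le> N}"
    by (rule finite_subset) simp
qed

instantiation gen_series :: comm_ring_1
begin

definition one_gen_series :: gen_series where "one_gen_series = gs_monom 1 0"

text \<open>The sum is finite, since the exponents of \<open>g\<close> are bounded below in real part.\<close>

lift_definition times_gen_series :: "gen_series \<Rightarrow> gen_series \<Rightarrow> gen_series"
  is "\<lambda>f g s. \<Sum>a | f a \<noteq> 0 \<and> g (s - a) \<noteq> 0. f a * g (s - a)"
proof -
  fix f g :: "complex \<Rightarrow> complex" and N :: real
  assume *: "\<And>N. finite {s. f s \<noteq> 0 \<and> Re s \<le> N}" "\<And>N. finite {s. g s \<noteq> 0 \<and> Re s \<le> N}"
  obtain A B where AB: "finite A" "finite B"
    "\<forall>a b. f a \<noteq> 0 \<longrightarrow> g b \<noteq> 0 \<longrightarrow> Re (a + b) \<le> N \<longrightarrow> a \<in> A \<and> b \<in> B"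
    using convolution_boxes[OF *] by meson
  have "{s. (\<Sum>a | f a \<noteq> 0 \<and> g (s - a) \<noteq> 0. f a * g (s - a)) \<noteq> 0 \<and> Re s \<le> N}
      \<subseteq> (\<lambda>(a, b). a + b) ` (A \<times> B)"
  proof
    fix s assume s: "s \<in> {s. (\<Sum>a | f a \<noteq> 0 \<and> g (s - a) \<noteq> 0. f a * g (s - a)) \<noteq> 0 \<and> Re s \<le> N}"
    then obtain a where a: "f a \<noteq> 0" "g (s - a) \<noteq> 0"
      by (auto dest!: sum_Collect_nonzero)
    then have "a \<in> A \<and> s - a \<in> B" using AB(3)[rule_format, of a "s - a"] s by simp
    then show "s \<in> (\<lambda>(a, b). a + b) ` (A \<times> B)"
      by (intro image_eqI[of _ _ "(a, s - a)"]) auto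
  qed
  then show "finite {s. (\<Sum>a | f a \<noteq> 0 \<and> g (s - a) \<noteq> 0. f a * g (s - a)) \<noteq> 0 \<and> Re s \<le> N}"
    using AB(1,2) by (meson finite_SigmaI finite_imageI finite_subset)
qed

lemma gs_coeff_times_box:
  assumes "finite A" "finite B"
    and "\<And>a b. gs_coeff f a \<noteq> 0 \<Longrightarrow> gs_coeff g b \<noteq> 0 \<Longrightarrow> a + b = s \<Longrightarrow> a \<in> A \<and> b \<in> B"
  shows "gs_coeff (f * g) s
    = (\<Sum>a\<in>A. \<Sum>b\<in>B. if a + b = s then gs_coeff f a * gs_coeff g b else 0)"
proof -
  have inner: "(\<Sum>b\<in>B. if a + b = s then gs_coeff f a * gs_coeff g b else 0)
      = (if s - a \<in> B then gs_coeff f a * gs_coeff g (s - a) else 0)" for a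
  proof -
    have "(\<Sum>b\<in>B. if a + b = s then gs_coeff f a * gs_coeff g b else 0)
        = (\<Sum>b\<in>B. if b = s - a then gs_coeff f a * gs_coeff g b else 0)"
      by (rule sum.cong) (auto simp: algebra_simps)
    then show ?thesis using assms(2) by simp
  qed
  have "gs_coeff (f * g) s
      = (\<Sum>a | gs_coeff f a \<noteq> 0 \<and> gs_coeff g (s - a) \<noteq> 0. gs_coeff f a * gs_coeff g (s - a))"
    by (simp add: times_gen_series.rep_eq)
  also have "\<dots> = (\<Sum>a\<in>A. if s - a \<in> B then gs_coeff f a * gs_coeff g (s - a) else 0)"
    using assms(3)[of _ "s - _"] by (intro sum.mono_neutral_cong_left assms(1)) auto
  finally show ?thesis by (simp add: inner)
qed

lemma gs_times_commute: "f * g = g * (f :: gen_series)"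
proof (rule gs_eqI)
  fix s
  obtain A B where AB: "finite A" "finite B"
    "\<forall>a b. gs_coeff f a \<noteq> 0 \<longrightarrow> gs_coeff g b \<noteq> 0 \<longrightarrow> Re (a + b) \<le> Re s \<longrightarrow> a \<in> A \<and> b \<in> B"
    using convolution_boxes[OF finite_gs_coeff finite_gs_coeff] by meson
  have "gs_coeff (f * g) s
      = (\<Sum>a\<in>A. \<Sum>b\<in>B. if a + b = s then gs_coeff f a * gs_coeff g b else 0)"
    using AB by (intro gs_coeff_times_box) auto
  also have "\<dots> = (\<Sum>b\<in>B. \<Sum>a\<in>A. if b + a = s then gs_coeff g b * gs_coeff f a else 0)"
    by (subst sum.swap) (intro sum.cong, auto simp: algebra_simps)
  also have "\<dots> = gs_coeff (g * f) s"
    using AB by (intro gs_coeff_times_box[symmetric]) (auto simp: add.commute)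
  finally show "gs_coeff (f * g) s = gs_coeff (g * f) s" .
qed

lemma gs_coeff_times_triple:
  assumes fin: "finite A" "finite B" "finite C"
    and box: "\<And>a b c. gs_coeff f a \<noteq> 0 \<Longrightarrow> gs_coeff g b \<noteq> 0 \<Longrightarrow> gs_coeff h c \<noteq> 0
      \<Longrightarrow> Re (a + b + c) \<le> Re s \<Longrightarrow> a \<in> A \<and> b \<in> B \<and> c \<in> C"
  shows "gs_coeff (f * g * h) s = (\<Sum>a\<in>A. \<Sum>b\<in>B. \<Sum>c\<in>C.
    if a + b + c = s then gs_coeff f a * gs_coeff g b * gs_coeff h c else 0)"
proof -
  let ?X = "(\<lambda>(a, b). a + b) ` (A \<times> B)"
  have finX: "finite ?X" using fin by simp
  let ?C = "{c \<in> C. gs_coeff h c \<noteq> 0}"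
  have nz: "\<exists>a. gs_coeff f a \<noteq> 0 \<and> gs_coeff g (x - a) \<noteq> 0" if "gs_coeff (f * g) x \<noteq> 0" for x
    using that unfolding times_gen_series.rep_eq by (rule sum_Collect_nonzero)
  have "gs_coeff (f * g * h) s
      = (\<Sum>x\<in>?X. \<Sum>c\<in>?C. if x + c = s then gs_coeff (f * g) x * gs_coeff h c else 0)"
  proof (rule gs_coeff_times_box[OF finX])
    fix x c assume *: "gs_coeff (f * g) x \<noteq> 0" "gs_coeff h c \<noteq> 0" "x + c = s"
    from nz[OF *(1)] obtain a where a: "gs_coeff f a \<noteq> 0" "gs_coeff g (x - a) \<noteq> 0" by blast
    have "a \<in> A \<and> x - a \<in> B \<and> c \<in> C" using box[OF a *(2)] *(3) by simp
    then show "x \<in> ?X \<and> c \<in> ?C"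
      using *(2) by (auto intro!: image_eqI[of _ _ "(a, x - a)"])
  qed (use fin in simp)
  also have "\<dots> = (\<Sum>x\<in>?X. \<Sum>c\<in>?C. \<Sum>a\<in>A. \<Sum>b\<in>B.
      if a + b = x then (if x + c = s then gs_coeff f a * gs_coeff g b * gs_coeff h c else 0) else 0)"
  proof (intro sum.cong refl)
    fix x c assume c: "c \<in> ?C"
    show "(if x + c = s then gs_coeff (f * g) x * gs_coeff h c else 0) = (\<Sum>a\<in>A. \<Sum>b\<in>B.
      if a + b = x then (if x + c = s then gs_coeff f a * gs_coeff g b * gs_coeff h c else 0) else 0)"
    proof (cases "x + c = s")
      case True
      have "gs_coeff (f * g) x
          = (\<Sum>a\<in>A. \<Sum>b\<in>B. if a + b = x then gs_coeff f a * gs_coeff g b else 0)"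
        using box[of _ _ c] c True by (intro gs_coeff_times_box fin) auto
      then have "gs_coeff (f * g) x * gs_coeff h c
          = (\<Sum>a\<in>A. \<Sum>b\<in>B. (if a + b = x then gs_coeff f a * gs_coeff g b else 0) * gs_coeff h c)"
        by (simp add: sum_distrib_right)
      also have "\<dots> = (\<Sum>a\<in>A. \<Sum>b\<in>B.
          if a + b = x then gs_coeff f a * gs_coeff g b * gs_coeff h c else 0)"
        by (intro sum.cong refl) simp
      finally show ?thesis using True by (simp cong: if_cong)
    qed (simp add: if_distrib cong: if_cong)
  qed
  also have "\<dots> = (\<Sum>c\<in>?C. \<Sum>x\<in>?X. \<Sum>a\<in>A. \<Sum>b\<in>B.
      if a + b = x then (if x + c = s then gs_coeff f a * gs_coeff g b * gs_coeff h c else 0) else 0)"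
    by (rule sum.swap)
  also have "\<dots> = (\<Sum>c\<in>?C. \<Sum>a\<in>A. \<Sum>x\<in>?X. \<Sum>b\<in>B.
      if a + b = x then (if x + c = s then gs_coeff f a * gs_coeff g b * gs_coeff h c else 0) else 0)"
    by (rule sum.cong[OF refl], rule sum.swap)
  also have "\<dots> = (\<Sum>c\<in>?C. \<Sum>a\<in>A. \<Sum>b\<in>B. \<Sum>x\<in>?X.
      if a + b = x then (if x + c = s then gs_coeff f a * gs_coeff g b * gs_coeff h c else 0) else 0)"
    by (rule sum.cong[OF refl], rule sum.cong[OF refl], rule sum.swap)
  also have "\<dots> = (\<Sum>c\<in>?C. \<Sum>a\<in>A. \<Sum>b\<in>B.
      if a + b + c = s then gs_coeff f a * gs_coeff g b * gs_coeff h c else 0)"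
  proof (intro sum.cong refl)
    fix c a b assume "a \<in> A" "b \<in> B"
    then have "a + b \<in> ?X" by (auto intro!: image_eqI[of _ _ "(a, b)"])
    then show "(\<Sum>x\<in>?X. if a + b = x
        then (if x + c = s then gs_coeff f a * gs_coeff g b * gs_coeff h c else 0) else 0)
      = (if a + b + c = s then gs_coeff f a * gs_coeff g b * gs_coeff h c else 0)"
      using sum.delta'[OF finX, of "a + b"
          "\<lambda>x. if x + c = s then gs_coeff f a * gs_coeff g b * gs_coeff h c else 0"] by simp
  qed
  also have "\<dots> = (\<Sum>c\<in>C. \<Sum>a\<in>A. \<Sum>b\<in>B.
      if a + b + c = s then gs_coeff f a * gs_coeff g b * gs_coeff h c else 0)"
    using fin(3) by (intro sum.mono_neutral_left) (auto intro!: sum.neutral split: if_splits)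
  also have "\<dots> = (\<Sum>a\<in>A. \<Sum>c\<in>C. \<Sum>b\<in>B.
      if a + b + c = s then gs_coeff f a * gs_coeff g b * gs_coeff h c else 0)"
    by (rule sum.swap)
  also have "\<dots> = (\<Sum>a\<in>A. \<Sum>b\<in>B. \<Sum>c\<in>C.
      if a + b + c = s then gs_coeff f a * gs_coeff g b * gs_coeff h c else 0)"
    by (rule sum.cong[OF refl], rule sum.swap)
  finally show ?thesis .
qed

lemma gs_times_assoc: "f * g * h = f * (g * (h :: gen_series))"
proof (rule gs_eqI)
  fix s
  obtain B1 where B1: "\<And>s. gs_coeff f s \<noteq> 0 \<Longrightarrow> B1 \<le> Re s"
    using locally_finite_bounded_below[OF finite_gs_coeff] by metis
  obtain B2 where B2: "\<And>s. gs_coeff g s \<noteq> 0 \<Longrightarrow> B2 \<le> Re s"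
    using locally_finite_bounded_below[OF finite_gs_coeff] by metis
  obtain B3 where B3: "\<And>s. gs_coeff h s \<noteq> 0 \<Longrightarrow> B3 \<le> Re s"
    using locally_finite_bounded_below[OF finite_gs_coeff] by metis
  define A where "A = {a. gs_coeff f a \<noteq> 0 \<and> Re a \<le> Re s - B2 - B3}"
  define B where "B = {a. gs_coeff g a \<noteq> 0 \<and> Re a \<le> Re s - B1 - B3}"
  define C where "C = {a. gs_coeff h a \<noteq> 0 \<and> Re a \<le> Re s - B1 - B2}"
  have fin: "finite A" "finite B" "finite C"
    unfolding A_def B_def C_def by (rule finite_gs_coeff)+
  have box: "a \<in> A \<and> b \<in> B \<and> c \<in> C"
    if "gs_coeff f a \<noteq> 0" "gs_coeff g b \<noteq> 0" "gs_coeff h c \<noteq> 0" "Re (a + b + c) \<le> Re s" for a b c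
    using that B1[of a] B2[of b] B3[of c] by (auto simp: A_def B_def C_def)
  have "gs_coeff (f * g * h) s = (\<Sum>a\<in>A. \<Sum>b\<in>B. \<Sum>c\<in>C.
      if a + b + c = s then gs_coeff f a * gs_coeff g b * gs_coeff h c else 0)"
    by (rule gs_coeff_times_triple[OF fin]) (rule box)
  also have "\<dots> = (\<Sum>b\<in>B. \<Sum>a\<in>A. \<Sum>c\<in>C.
      if a + b + c = s then gs_coeff f a * gs_coeff g b * gs_coeff h c else 0)"
    by (rule sum.swap)
  also have "\<dots> = (\<Sum>b\<in>B. \<Sum>c\<in>C. \<Sum>a\<in>A.
      if a + b + c = s then gs_coeff f a * gs_coeff g b * gs_coeff h c else 0)"
    by (rule sum.cong[OF refl], rule sum.swap)
  also have "\<dots> = (\<Sum>b\<in>B. \<Sum>c\<in>C. \<Sum>a\<in>A.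
      if b + c + a = s then gs_coeff g b * gs_coeff h c * gs_coeff f a else 0)"
    by (intro sum.cong refl) (simp add: algebra_simps)
  also have "\<dots> = gs_coeff (g * h * f) s"
    by (rule gs_coeff_times_triple[symmetric, OF fin(2,3,1)])
      (use box in \<open>auto simp: algebra_simps\<close>)
  finally show "gs_coeff (f * g * h) s = gs_coeff (f * (g * h)) s"
    by (simp add: gs_times_commute[of f "g * h"])
qed

instance
proof
  fix f g h :: gen_series
  show "f * g * h = f * (g * h)" by (rule gs_times_assoc)
  show "f * g = g * f" by (rule gs_times_commute)
  show "1 * f = f"
  proof (rule gs_eqI)
    fix s
    have "gs_coeff (1 * f) s
        = (\<Sum>a\<in>{0}. \<Sum>b\<in>{s}. if a + b = s then gs_coeff 1 a * gs_coeff f b else 0)"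
      by (rule gs_coeff_times_box)
        (auto simp: one_gen_series_def gs_monom.rep_eq split: if_splits)
    then show "gs_coeff (1 * f) s = gs_coeff f s"
      by (simp add: one_gen_series_def gs_monom.rep_eq)
  qed
  show "(f + g) * h = f * h + g * h"
  proof (rule gs_eqI)
    fix s
    obtain A C where AC: "finite A" "finite C"
      "\<forall>a b. gs_coeff f a \<noteq> 0 \<longrightarrow> gs_coeff h b \<noteq> 0 \<longrightarrow> Re (a + b) \<le> Re s \<longrightarrow> a \<in> A \<and> b \<in> C"
      using convolution_boxes[OF finite_gs_coeff finite_gs_coeff] by meson
    obtain A' C' where AC': "finite A'" "finite C'"
      "\<forall>a b. gs_coeff g a \<noteq> 0 \<longrightarrow> gs_coeff h b \<noteq> 0 \<longrightarrow> Re (a + b) \<le> Re s \<longrightarrow> a \<in> A' \<and> b \<in> C'"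
      using convolution_boxes[OF finite_gs_coeff finite_gs_coeff] by meson
    let ?A = "A \<union> A'" and ?C = "C \<union> C'"
    let ?S = "\<lambda>f. \<Sum>a\<in>?A. \<Sum>b\<in>?C. if a + b = s then gs_coeff f a * gs_coeff h b else 0"
    have fin: "finite ?A" "finite ?C" using AC(1,2) AC'(1,2) by auto
    have f: "gs_coeff (f * h) s = ?S f"
      using AC(3) by (intro gs_coeff_times_box fin) auto
    have g: "gs_coeff (g * h) s = ?S g"
      using AC'(3) by (intro gs_coeff_times_box fin) auto
    have "gs_coeff ((f + g) * h) s = ?S (f + g)"
    proof (intro gs_coeff_times_box fin)
      fix a b assume *: "gs_coeff (f + g) a \<noteq> 0" "gs_coeff h b \<noteq> 0" "a + b = s"
      then have "gs_coeff f a \<noteq> 0 \<or> gs_coeff g a \<noteq> 0" by (auto simp: plus_gen_series.rep_eq)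
      then show "a \<in> ?A \<and> b \<in> ?C" using AC(3)[rule_format, of a b] AC'(3)[rule_format, of a b] * by auto
    qed
    also have "\<dots> = ?S f + ?S g"
      unfolding sum.distrib[symmetric]
      by (intro sum.cong refl) (simp add: plus_gen_series.rep_eq algebra_simps)
    finally show "gs_coeff ((f + g) * h) s = gs_coeff (f * h + g * h) s"
      by (simp add: f g plus_gen_series.rep_eq)
  qed
  show "(0 :: gen_series) \<noteq> 1"
  proof
    assume "(0 :: gen_series) = 1"
    then have "gs_coeff 0 0 = gs_coeff 1 0" by simp
    then show False by (simp add: one_gen_series_def gs_monom.rep_eq zero_gen_series.rep_eq)
  qed
qed

end

lemma gs_monom_times: "gs_monom c s * gs_monom d t = gs_monom (c * d) (s + t)"
proof (rule gs_eqI)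
  fix x
  have "gs_coeff (gs_monom c s * gs_monom d t) x = (\<Sum>a\<in>{s}. \<Sum>b\<in>{t}.
      if a + b = x then gs_coeff (gs_monom c s) a * gs_coeff (gs_monom d t) b else 0)"
    by (rule gs_coeff_times_box) (auto simp: gs_monom.rep_eq split: if_splits)
  then show "gs_coeff (gs_monom c s * gs_monom d t) x = gs_coeff (gs_monom (c * d) (s + t)) x"
    by (auto simp: gs_monom.rep_eq)
qed

text \<open>The derivation \<open>\<delta> = z d/dz\<close>.\<close>

lift_definition gs_delta :: "gen_series \<Rightarrow> gen_series" is "\<lambda>f s. s * f s"
proof -
  fix f :: "complex \<Rightarrow> complex" and N :: real
  assume *: "\<And>N. finite {s. f s \<noteq> 0 \<and> Re s \<le> N}"
  show "finite {s. s * f s \<noteq> 0 \<and> Re s \<le> N}"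
    by (rule finite_subset[OF _ *[of N]]) auto
qed

text \<open>The series with terms \<open>c n\<close> at exponent \<open>s n\<close>; a meaningful definition when the real parts
  of the exponents tend to infinity.\<close>

definition gs_of_terms :: "(nat \<Rightarrow> complex) \<Rightarrow> (nat \<Rightarrow> complex) \<Rightarrow> gen_series"
  where "gs_of_terms c s = Abs_gs (\<lambda>x. \<Sum>n | s n = x. c n)"

lemma gs_coeff_of_terms:
  assumes "filterlim (\<lambda>n. Re (s n)) at_top sequentially"
  shows "gs_coeff (gs_of_terms c s) x = (\<Sum>n | s n = x. c n)"
proof -
  have fin: "finite {n. Re (s n) \<le> N}" for N
  proof -
    have "eventually (\<lambda>n. N < Re (s n)) sequentially"
      using assms by (simp add: filterlim_at_top_dense)
    then obtain n0 where "\<forall>n\<ge>n0. N < Re (s n)"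
      by (auto simp: eventually_sequentially)
    then have "{n. Re (s n) \<le> N} \<subseteq> {..<n0}"
      by (auto simp: not_less[symmetric])
    then show ?thesis
      by (rule finite_subset) simp
  qed
  have "finite {x. (\<Sum>n | s n = x. c n) \<noteq> 0 \<and> Re x \<le> N}" for N
  proof (rule finite_subset)
    show "{x. (\<Sum>n | s n = x. c n) \<noteq> 0 \<and> Re x \<le> N} \<subseteq> s ` {n. Re (s n) \<le> N}"
    proof
      fix x assume x: "x \<in> {x. (\<Sum>n | s n = x. c n) \<noteq> 0 \<and> Re x \<le> N}"
      then obtain n where "s n = x"
        using sum_Collect_nonzero[of c] by blast
      then show "x \<in> s ` {n. Re (s n) \<le> N}" using x by auto
    qed
  qed (use fin in simp)
  then show ?thesis
    unfolding gs_of_terms_def by (subst Abs_gs_inverse) auto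
qed

text \<open>The real part of the valuation: an infimum of a locally finite set bounded below, hence
  attained if \<open>f \<noteq> 0\<close>, and \<open>\<infinity>\<close> if \<open>f = 0\<close>.\<close>

definition re_val :: "gen_series \<Rightarrow> ereal"
  where "re_val f = (INF s \<in> {s. gs_coeff f s \<noteq> 0}. ereal (Re s))"


section \<open>Polynomials in \<open>z, u\<^sub>0, u\<^sub>1, \<dots>\<close>\<close>

datatype var = Z | U nat

type_synonym diff_poly = "(var \<Rightarrow>\<^sub>0 nat) \<Rightarrow>\<^sub>0 complex"

definition dp_vars :: "diff_poly \<Rightarrow> var set"
  where "dp_vars F = (\<Union>\<mu>\<in>Poly_Mapping.keys F. Poly_Mapping.keys \<mu>)"

text \<open>The formal partial derivative. Subtraction of exponents is truncated, but if \<open>v\<close> does not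
  occur in a monomial, then the corresponding term has coefficient 0.\<close>

definition dp_deriv :: "var \<Rightarrow> diff_poly \<Rightarrow> diff_poly"
  where "dp_deriv v F = (\<Sum>\<mu>\<in>Poly_Mapping.keys F.
    Poly_Mapping.single (\<mu> - Poly_Mapping.single v 1)
      (of_nat (Poly_Mapping.lookup \<mu> v) * Poly_Mapping.lookup F \<mu>))"

text \<open>The series \<open>F(z, \<Phi>)\<close> for \<open>\<Phi> = (\<phi>, \<delta>\<phi>, \<delta>\<^sup>2\<phi>, \<dots>)\<close>.\<close>

primrec var_value :: "gen_series \<Rightarrow> var \<Rightarrow> gen_series" where
  "var_value \<phi> Z = gs_monom 1 1"
| "var_value \<phi> (U i) = (gs_delta ^^ i) \<phi>"

definition dp_subst :: "diff_poly \<Rightarrow> gen_series \<Rightarrow> gen_series"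
  where "dp_subst F \<phi> = (\<Sum>\<mu>\<in>Poly_Mapping.keys F.
    gs_monom (Poly_Mapping.lookup F \<mu>) 0
      * (\<Prod>v\<in>Poly_Mapping.keys \<mu>. var_value \<phi> v ^ Poly_Mapping.lookup \<mu> v))"


section \<open>The Newton polygon of a linear operator\<close>

text \<open>The operator \<open>a 0 + a 1 \<delta> + \<dots> + a m \<delta>\<^sup>m\<close> is given by \<open>m\<close> and its coefficients.\<close>

definition newton_hull :: "nat \<Rightarrow> (nat \<Rightarrow> gen_series) \<Rightarrow> (real \<times> real) set"
  where "newton_hull m a =
    convex hull (\<Union>i\<le>m. {(x, y). x \<le> real i \<and> ereal y \<ge> re_val (a i)})"

definition newton_polygon :: "nat \<Rightarrow> (nat \<Rightarrow> gen_series) \<Rightarrow> (real \<times> real) set"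
  where "newton_polygon m a = frontier (newton_hull m a)"

text \<open>The edges of the boundary curve are the one-dimensional faces of the hull;
  unbounded edges are included.\<close>

definition newton_edges :: "nat \<Rightarrow> (nat \<Rightarrow> gen_series) \<Rightarrow> (real \<times> real) set set"
  where "newton_edges m a = {e. e edge_of newton_hull m a \<and> e \<subseteq> newton_polygon m a}"

definition newton_slopes :: "nat \<Rightarrow> (nat \<Rightarrow> gen_series) \<Rightarrow> real set"
  where "newton_slopes m a = {r. \<exists>e\<in>newton_edges m a. \<exists>p\<in>e. \<exists>q\<in>e.
    fst p \<noteq> fst q \<and> r = (snd q - snd p) / (fst q - fst p)}"

definition least_positive_slope :: "nat \<Rightarrow> (nat \<Rightarrow> gen_series) \<Rightarrow> ereal"
  where "least_positive_slope m a =
    (if \<exists>r\<in>newton_slopes m a. r > 0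
     then ereal (LEAST r. r \<in> newton_slopes m a \<and> r > 0) else \<infinity>)"


section \<open>Powers in a sector\<close>

definition sector :: "real \<Rightarrow> real \<Rightarrow> real \<Rightarrow> complex set"
  where "sector \<alpha> \<beta> R =
    {z. 0 < norm z \<and> norm z < R \<and> (\<exists>\<theta>. \<alpha> < \<theta> \<and> \<theta> < \<beta> \<and> is_Arg z \<theta>)}"

text \<open>The branch of the logarithm with imaginary part in \<open>(\<alpha>, \<beta>)\<close>; for \<open>\<beta> - \<alpha> < 2 * pi\<close> the
  argument is unique.\<close>

definition sector_ln :: "real \<Rightarrow> real \<Rightarrow> complex \<Rightarrow> complex"
  where "sector_ln \<alpha> \<beta> z = Complex (ln (norm z)) (THE \<theta>. \<alpha> < \<theta> \<and> \<theta> < \<beta> \<and> is_Arg z \<theta>)"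

definition sector_power :: "real \<Rightarrow> real \<Rightarrow> complex \<Rightarrow> complex \<Rightarrow> complex"
  where "sector_power \<alpha> \<beta> z s = exp (s * sector_ln \<alpha> \<beta> z)"

definition div_slope :: "complex \<Rightarrow> ereal \<Rightarrow> complex"
  where "div_slope s k = (if k = \<infinity> then 0 else s / of_real (real_of_ereal k))"

end

theory Submission
  imports Defs
begin

text \<open>
  Split \<open>\<phi> = P + \<psi>\<close>, where \<open>P\<close> consists of the finitely many terms whose exponents have real part at
  most a large number \<open>N\<close>. Expanding \<open>F\<close> around \<open>P\<close> (\<open>dp_subst_taylor\<close>) and extracting the coefficient of
  \<open>z\<close> to the power \<open>s + \<lambda>\<close> turns the equation into a recurrence for the coefficients \<open>c\<close> of \<open>\<psi>\<close>:
  the polynomial \<open>L(s) = \<Sum>i\<le>m. A\<^sub>i s\<^sup>i\<close>, of degree \<open>p\<close> say, times \<open>c(s)\<close> is a sum of three sources. The first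
  comes from \<open>F(P)\<close> and has finitely many terms. The second is linear in \<open>\<psi>\<close>: it comes from
  \<open>B\<^sub>i \<delta>\<^sup>i \<psi>\<close>, where \<open>B\<^sub>i\<close> is the partial derivative by \<open>u\<^sub>i\<close> at \<open>P\<close> without its leading
  term \<open>A\<^sub>i z\<^sup>\<lambda>\<close>. The third is a remainder \<open>T\<close> of order at least two in \<open>\<psi>, \<delta> \<psi>, \<dots>\<close>.

  The only loss is the factor \<open>s\<^sup>i\<close> with \<open>i > p\<close>, which \<open>L(s)\<close> does not balance. The Newton polygon
  has a corner at \<open>(p, Re \<lambda>)\<close>, and its least positive slope \<open>k\<close> says that such a loss of \<open>i - p\<close>
  powers comes with a shift of the exponent by at least \<open>k (i - p)\<close>
  (\<open>least_positive_slope_bound\<close>). Growth of \<open>c(s)\<close> like the Gamma function at \<open>Re s / k\<close> absorbs exactly this. Put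
  \<open>\<kappa> = 1 / k\<close> and \<open>y = Re s - N\<close>. Instead of the Gamma function the majorant uses \<open>(1 + y)\<close> to the power \<open>\<kappa> y\<close>, which
  differs from it by a factor that is at most exponential in the cone \<open>\<bar>Im s\<bar> \<le> K Re s\<close> (\<open>rGamma_cone_bound\<close>), is
  obviously supermultiplicative in \<open>y\<close>, and gains \<open>\<kappa> \<tau>\<close> powers of \<open>1 + y\<close> when \<open>y\<close> is
  increased by \<open>\<tau>\<close> (\<open>maj_wt_add_gain\<close>).

  Measuring exponents from \<open>N\<close> makes the remainder harmless: a product of two factors \<open>\<delta>\<^sup>i \<psi>\<close> is naturally
  measured from \<open>2 N\<close>, so it enters the recurrence shifted by \<open>N - Re \<lambda>\<close>, and this outweighs all
  losses when \<open>N\<close> is large. With weights \<open>r\<close> to the power \<open>y\<close> every source therefore carries a positive power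
  of \<open>r\<close>, and involves only coefficients with strictly smaller \<open>Re s\<close>. If the weighted absolute sum of the terms
  of \<open>\<delta>\<^sup>m \<psi>\<close> up to some \<open>y\<close> is at most 1, it is then at most a constant times a positive power of \<open>r\<close> a
  fixed step further on. For small \<open>r\<close> it stays at most 1 forever (\<open>tail_norm_bounded\<close>). The same
  induction shows that the exponents lie in a cone (\<open>cone_exists\<close>), which makes the powers in a sector
  at most exponential in \<open>Re s\<close>. The weighted sum is thus a convergent majorant of the series on a small sector.
  Summing absolute values, rather than bounding single coefficients, covers all exponents at once, however many of
  them there are.
\<close>

section \<open>A lower bound for the Gamma function in a cone\<close>

lemma sum_inverse_squares_le:
  fixes x :: real
  assumes "0 < x"
  shows "(\<Sum>j=0..n. 1 / (1 + x + real j)\<^sup>2) \<le> 1 / x"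
proof -
  have "(\<Sum>j=0..n. 1 / (1 + x + real j)\<^sup>2) \<le> 1 / x - 1 / (1 + x + real n)"
  proof (induction n)
    case 0
    have "1 / (1 + x)\<^sup>2 \<le> 1 / (x * (1 + x))"
      using assms by (intro divide_left_mono) (auto simp: power2_eq_square)
    also have "\<dots> = 1 / x - 1 / (1 + x)"
      using assms by (simp add: field_simps)
    finally show ?case by simp
  next
    case (Suc n)
    define t where "t = 1 + x + real n"
    have t: "0 < t" using assms by (simp add: t_def)
    have "1 / (t + 1)\<^sup>2 \<le> 1 / (t * (t + 1))"
      using t by (intro divide_left_mono) (auto simp: power2_eq_square)
    also have "\<dots> = 1 / t - 1 / (t + 1)"
      using t by (simp add: field_simps)
    finally show ?case
      using Suc by (simp add: t_def algebra_simps)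
  qed
  also have "\<dots> \<le> 1 / x" using assms by simp
  finally show ?thesis .
qed

lemma norm_shift_le:
  fixes a y :: real
  assumes "0 < a"
  shows "cmod (Complex a y) \<le> a * exp (y\<^sup>2 / 2 * (1 / a\<^sup>2))"
proof (rule power2_le_imp_le)
  have "(cmod (Complex a y))\<^sup>2 = a\<^sup>2 * (1 + y\<^sup>2 / a\<^sup>2)"
    using assms by (simp add: cmod_power2 field_simps)
  also have "\<dots> \<le> a\<^sup>2 * exp (y\<^sup>2 / a\<^sup>2)"
    by (intro mult_left_mono exp_ge_add_one_self) auto
  also have "\<dots> = (a * exp (y\<^sup>2 / 2 * (1 / a\<^sup>2)))\<^sup>2"
    by (simp add: power_mult_distrib flip: exp_double)
  finally show "(cmod (Complex a y))\<^sup>2 \<le> (a * exp (y\<^sup>2 / 2 * (1 / a\<^sup>2)))\<^sup>2" .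
qed (use assms in simp)

text \<open>
  The Euler product compares the two values factor by factor: \<open>\<bar>1 + x + j + i y\<bar>\<close> exceeds
  \<open>1 + x + j\<close> by at most the factor \<open>exp (y\<^sup>2 / (2 (1 + x + j)\<^sup>2))\<close>, and these exponents have a sum of at most
  \<open>y\<^sup>2 / (2 x)\<close>. In a cone \<open>\<bar>y\<bar> \<le> K x\<close> this is linear in \<open>x\<close>.
\<close>

lemma norm_rGamma_le:
  fixes x y :: real
  assumes "0 < x"
  shows "cmod (rGamma (1 + Complex x y)) \<le> rGamma (1 + x) * exp (y\<^sup>2 / (2 * x))"
proof (rule LIMSEQ_le)
  show "(\<lambda>n. cmod (rGamma_series (1 + Complex x y) n)) \<longlonglongrightarrow> cmod (rGamma (1 + Complex x y))"
    by (intro tendsto_intros)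
  show "(\<lambda>n. rGamma_series (1 + x) n * exp (y\<^sup>2 / (2 * x))) \<longlonglongrightarrow> rGamma (1 + x) * exp (y\<^sup>2 / (2 * x))"
    by (intro tendsto_intros)
  have "cmod (rGamma_series (1 + Complex x y) n) \<le> rGamma_series (1 + x) n * exp (y\<^sup>2 / (2 * x))"
    for n
  proof -
    have "cmod (pochhammer (1 + Complex x y) (n + 1))
        = (\<Prod>j=0..n. cmod (Complex (1 + x + real j) y))"
      by (simp add: pochhammer_Suc_prod flip: prod_norm)
        (intro prod.cong refl arg_cong[where f = cmod], simp add: complex_eq_iff)
    also have "\<dots> \<le> (\<Prod>j=0..n. (1 + x + real j) * exp (y\<^sup>2 / 2 * (1 / (1 + x + real j)\<^sup>2)))"
      using assms by (intro prod_mono conjI norm_shift_le) auto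
    also have "\<dots> = pochhammer (1 + x) (n + 1) * exp (y\<^sup>2 / 2 * (\<Sum>j=0..n. 1 / (1 + x + real j)\<^sup>2))"
      by (simp add: pochhammer_Suc_prod prod.distrib exp_sum sum_distrib_left)
    also have "\<dots> \<le> pochhammer (1 + x) (n + 1) * exp (y\<^sup>2 / 2 * (1 / x))"
      using assms mult_left_mono[OF sum_inverse_squares_le[OF assms, of n], of "y\<^sup>2 / 2"]
      by (intro mult_left_mono) (auto intro!: pochhammer_nonneg)
    finally have *: "cmod (pochhammer (1 + Complex x y) (n + 1))
        \<le> pochhammer (1 + x) (n + 1) * exp (y\<^sup>2 / (2 * x))" by simp
    have "cmod (rGamma_series (1 + Complex x y) n)
        = cmod (pochhammer (1 + Complex x y) (n + 1)) / (fact n * exp ((1 + x) * ln (real n)))"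
      by (simp add: rGamma_series_def norm_divide norm_mult)
    also have "\<dots> \<le> pochhammer (1 + x) (n + 1) * exp (y\<^sup>2 / (2 * x)) / (fact n * exp ((1 + x) * ln (real n)))"
      using * by (intro divide_right_mono) auto
    finally show ?thesis by (simp add: rGamma_series_def)
  qed
  then show "\<exists>N. \<forall>n\<ge>N. cmod (rGamma_series (1 + Complex x y) n)
      \<le> rGamma_series (1 + x) n * exp (y\<^sup>2 / (2 * x))" by blast
qed

text \<open>
  In the Gamma integral keep only the range \<open>t \<ge> x\<close>, where \<open>t powr x\<close> is at least \<open>x powr x\<close>.
\<close>

lemma Gamma_ge_powr:
  fixes x :: real
  assumes "0 < x"
  shows "x powr x * exp (- x) \<le> Gamma (1 + x)"
proof (rule has_integral_le)
  show "((\<lambda>t. if t \<in> {x..} then x powr x * exp (- t) else 0) has_integral x powr x * exp (- x)) {0..}"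
    using has_integral_mult_right[OF has_integral_exp_minus_to_infinity[of 1 x], of "x powr x"] assms
    by (subst has_integral_restrict) auto
  show "((\<lambda>t. t powr (1 + x - 1) / exp t) has_integral Gamma (1 + x)) {0..}"
    using assms by (intro Gamma_integral_real) auto
  show "(if t \<in> {x..} then x powr x * exp (- t) else 0) \<le> t powr (1 + x - 1) / exp t" for t
    using assms by (auto simp: exp_minus field_simps intro!: powr_mono2)
qed

text \<open>
  The two preceding bounds together; replacing \<open>\<kappa> * Re s\<close> by \<open>Re s\<close> in the base of the power costs only an
  exponential factor. The case \<open>\<kappa> = 0\<close> is that of an infinite slope.
\<close>

lemma rGamma_cone_bound:
  fixes \<kappa> K :: real
  assumes "0 \<le> \<kappa>"
  shows "\<exists>C\<ge>0. \<forall>s. 1 \<le> Re s \<longrightarrow> \<bar>Im s\<bar> \<le> K * Re s \<longrightarrow>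
    cmod (rGamma (1 + of_real \<kappa> * s)) * Re s powr (\<kappa> * Re s) \<le> exp (C * Re s)"
proof (cases "\<kappa> = 0")
  case True
  then show ?thesis by (intro exI[of _ 0]) auto
next
  case False
  with assms have k: "0 < \<kappa>" by simp
  let ?C = "\<kappa> * (1 + K\<^sup>2 / 2 + \<bar>ln \<kappa>\<bar>)"
  show ?thesis
  proof (intro exI[of _ ?C] conjI allI impI)
    show "0 \<le> ?C" using k by auto
    fix s assume s: "1 \<le> Re s" "\<bar>Im s\<bar> \<le> K * Re s"
    define x where "x = \<kappa> * Re s"
    have x: "0 < x" using k s by (simp add: x_def)
    have "\<bar>\<kappa> * Im s\<bar> \<le> \<bar>K * x\<bar>"
    proof -
      have "\<bar>\<kappa> * Im s\<bar> = \<kappa> * \<bar>Im s\<bar>" using k by (simp add: abs_mult)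
      also have "\<dots> \<le> \<kappa> * (K * Re s)" using k s by (intro mult_left_mono) auto
      finally show ?thesis by (simp add: x_def algebra_simps)
    qed
    then have "(\<kappa> * Im s)\<^sup>2 \<le> (K * x)\<^sup>2" by (simp add: abs_le_square_iff)
    then have im: "(\<kappa> * Im s)\<^sup>2 / (2 * x) \<le> K\<^sup>2 / 2 * x"
      using x by (simp add: field_simps power2_eq_square)
    have arg: "1 + of_real \<kappa> * s = 1 + Complex x (\<kappa> * Im s)"
      by (simp add: x_def complex_eq_iff)
    have g: "x powr x * exp (- x) * rGamma (1 + x) \<le> 1"
      using Gamma_ge_powr[OF x] x Gamma_real_pos[of "1 + x"]
      by (simp add: rGamma_inverse_Gamma field_simps)
    have powr: "Re s powr x \<le> x powr x * exp (\<bar>ln \<kappa>\<bar> * x)"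
    proof -
      have "Re s powr x = x powr x * exp (- ln \<kappa> * x)"
        using k s unfolding x_def
        by (simp add: powr_def ln_mult algebra_simps flip: exp_add)
      also have "\<dots> \<le> x powr x * exp (\<bar>ln \<kappa>\<bar> * x)"
        using x mult_right_mono[of "- ln \<kappa>" "\<bar>ln \<kappa>\<bar>" x] by (intro mult_left_mono) auto
      finally show ?thesis .
    qed
    have rpos: "0 \<le> rGamma (1 + x)"
      using x Gamma_real_pos[of "1 + x"] by (simp add: rGamma_inverse_Gamma)
    have "cmod (rGamma (1 + of_real \<kappa> * s)) * Re s powr x
        \<le> (rGamma (1 + x) * exp (K\<^sup>2 / 2 * x)) * (x powr x * exp (\<bar>ln \<kappa>\<bar> * x))"
    proof (intro mult_mono powr)
      have "cmod (rGamma (1 + of_real \<kappa> * s)) \<le> rGamma (1 + x) * exp ((\<kappa> * Im s)\<^sup>2 / (2 * x))"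
        unfolding arg by (rule norm_rGamma_le[OF x])
      also have "\<dots> \<le> rGamma (1 + x) * exp (K\<^sup>2 / 2 * x)"
        using im rpos by (intro mult_left_mono) auto
      finally show "cmod (rGamma (1 + of_real \<kappa> * s)) \<le> rGamma (1 + x) * exp (K\<^sup>2 / 2 * x)" .
    qed (use rpos in auto)
    also have "\<dots> = (x powr x * exp (- x) * rGamma (1 + x)) * exp (x + K\<^sup>2 / 2 * x + \<bar>ln \<kappa>\<bar> * x)"
    proof -
      have "exp (- x) * exp (x + a + b) = exp a * exp b" for a b :: real
        by (simp flip: exp_add)
      from this[of "K\<^sup>2 / 2 * x" "\<bar>ln \<kappa>\<bar> * x"] show ?thesis by algebra
    qed
    also have "\<dots> \<le> 1 * exp (x + K\<^sup>2 / 2 * x + \<bar>ln \<kappa>\<bar> * x)"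
      using g by (intro mult_right_mono) auto
    finally show "cmod (rGamma (1 + of_real \<kappa> * s)) * Re s powr (\<kappa> * Re s) \<le> exp (?C * Re s)"
      by (simp add: x_def algebra_simps)
  qed
qed

section \<open>Coefficients of generalized power series\<close>

lemma gs_monom_0: "gs_monom 0 e = 0"
  by (rule gs_eqI) (simp add: gs_monom.rep_eq zero_gen_series.rep_eq)

lemma gs_monom_add: "gs_monom (a + b) e = gs_monom a e + gs_monom b e"
  by (rule gs_eqI) (simp add: gs_monom.rep_eq plus_gen_series.rep_eq)

lemma gs_monom_of_nat_mult: "gs_monom (of_nat n * a) e = of_nat n * gs_monom a e"
  by (induction n) (simp_all add: gs_monom_0 gs_monom_add algebra_simps)

lemma gs_coeff_delta_funpow: "gs_coeff ((gs_delta ^^ i) f) x = x ^ i * gs_coeff f x"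
  by (induction i) (simp_all add: gs_delta.rep_eq)

lemma gs_delta_funpow_add: "(gs_delta ^^ i) (f + g) = (gs_delta ^^ i) f + (gs_delta ^^ i) g"
  by (rule gs_eqI) (simp add: gs_coeff_delta_funpow plus_gen_series.rep_eq algebra_simps)

lift_definition gs_trunc :: "real \<Rightarrow> gen_series \<Rightarrow> gen_series"
  is "\<lambda>N f x. if Re x \<le> N then f x else 0"
proof -
  fix N M :: real and f :: "complex \<Rightarrow> complex"
  assume *: "\<And>N. finite {s. f s \<noteq> 0 \<and> Re s \<le> N}"
  show "finite {s. (if Re s \<le> N then f s else 0) \<noteq> 0 \<and> Re s \<le> M}"
    by (rule finite_subset[OF _ *[of M]]) (auto split: if_splits)
qed

lemma gs_coeff_minus: "gs_coeff (f - g) x = gs_coeff f x - gs_coeff g x"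
  unfolding minus_gen_series_def plus_gen_series.rep_eq uminus_gen_series.rep_eq by simp

lemma gs_coeff_sum: "gs_coeff (sum f S) x = (\<Sum>i\<in>S. gs_coeff (f i) x)"
  by (induction S rule: infinite_finite_induct)
    (simp_all add: zero_gen_series.rep_eq plus_gen_series.rep_eq)

lemma gs_coeff_monom_times: "gs_coeff (gs_monom a e * f) (x + e) = a * gs_coeff f x"
proof -
  have "gs_coeff (gs_monom a e * f) (x + e) = (\<Sum>u\<in>{e}. \<Sum>v\<in>{x}.
      if u + v = x + e then gs_coeff (gs_monom a e) u * gs_coeff f v else 0)"
    by (rule gs_coeff_times_box) (auto simp: gs_monom.rep_eq split: if_splits)
  then show ?thesis by (simp add: gs_monom.rep_eq)
qed

text \<open>
  The one estimate from which all bounds for products are derived. The boxes \<open>A\<close> and \<open>B\<close> only have to capture the terms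
  that contribute to exponents in \<open>X\<close>, so the bound can be restricted to the initial parts of both factors.
\<close>

lemma sum_norm_coeff_times_le:
  assumes fin: "finite X" "finite A" "finite B" and u: "\<And>x. 0 \<le> u x"
    and box: "\<And>a b. gs_coeff f a \<noteq> 0 \<Longrightarrow> gs_coeff g b \<noteq> 0 \<Longrightarrow> a + b \<in> X \<Longrightarrow> a \<in> A \<and> b \<in> B"
  shows "(\<Sum>x\<in>X. cmod (gs_coeff (f * g) x) * u x)
    \<le> (\<Sum>a\<in>A. \<Sum>b\<in>B. cmod (gs_coeff f a) * cmod (gs_coeff g b) * u (a + b))"
proof -
  let ?w = "\<lambda>a b x. if a + b = x then cmod (gs_coeff f a) * cmod (gs_coeff g b) * u x else 0"
  have "(\<Sum>x\<in>X. cmod (gs_coeff (f * g) x) * u x) \<le> (\<Sum>x\<in>X. \<Sum>a\<in>A. \<Sum>b\<in>B. ?w a b x)"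
  proof (rule sum_mono)
    fix x assume x: "x \<in> X"
    have "gs_coeff (f * g) x = (\<Sum>a\<in>A. \<Sum>b\<in>B. if a + b = x then gs_coeff f a * gs_coeff g b else 0)"
      using box x by (intro gs_coeff_times_box fin) auto
    then have "cmod (gs_coeff (f * g) x)
        \<le> (\<Sum>a\<in>A. \<Sum>b\<in>B. cmod (if a + b = x then gs_coeff f a * gs_coeff g b else 0))"
      by (simp only:) (intro order.trans[OF norm_sum] sum_mono norm_sum)
    then have "cmod (gs_coeff (f * g) x) * u x
        \<le> (\<Sum>a\<in>A. \<Sum>b\<in>B. cmod (if a + b = x then gs_coeff f a * gs_coeff g b else 0)) * u x"
      using u by (intro mult_right_mono)
    also have "\<dots> = (\<Sum>a\<in>A. \<Sum>b\<in>B. ?w a b x)"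
      unfolding sum_distrib_right by (intro sum.cong refl) (simp add: norm_mult)
    finally show "cmod (gs_coeff (f * g) x) * u x \<le> (\<Sum>a\<in>A. \<Sum>b\<in>B. ?w a b x)" .
  qed
  also have "\<dots> = (\<Sum>a\<in>A. \<Sum>x\<in>X. \<Sum>b\<in>B. ?w a b x)" by (rule sum.swap)
  also have "\<dots> = (\<Sum>a\<in>A. \<Sum>b\<in>B. \<Sum>x\<in>X. ?w a b x)"
    by (rule sum.cong[OF refl], rule sum.swap)
  also have "\<dots> \<le> (\<Sum>a\<in>A. \<Sum>b\<in>B. cmod (gs_coeff f a) * cmod (gs_coeff g b) * u (a + b))"
  proof (intro sum_mono)
    fix a b
    have "(\<Sum>x\<in>X. ?w a b x)
        = (if a + b \<in> X then cmod (gs_coeff f a) * cmod (gs_coeff g b) * u (a + b) else 0)"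
      using fin(1) by (simp add: sum.delta')
    then show "(\<Sum>x\<in>X. ?w a b x) \<le> cmod (gs_coeff f a) * cmod (gs_coeff g b) * u (a + b)"
      using u[of "a + b"] by simp
  qed
  finally show ?thesis .
qed

lemma gs_coeff_times_nonzeroE:
  assumes "gs_coeff (f * g) x \<noteq> 0"
  obtains a b where "gs_coeff f a \<noteq> 0" "gs_coeff g b \<noteq> 0" "x = a + b"
proof -
  from assms have "\<exists>a. gs_coeff f a \<noteq> 0 \<and> gs_coeff g (x - a) \<noteq> 0"
    unfolding times_gen_series.rep_eq by (rule sum_Collect_nonzero)
  then obtain a where a: "gs_coeff f a \<noteq> 0" "gs_coeff g (x - a) \<noteq> 0" by blast
  then show ?thesis by (intro that[of a "x - a"]) auto
qed

section \<open>Substitution into polynomials\<close>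

abbreviation dp_monom :: "gen_series \<Rightarrow> (var \<Rightarrow>\<^sub>0 nat) \<Rightarrow> gen_series"
  where "dp_monom \<phi> \<mu> \<equiv>
    (\<Prod>v\<in>Poly_Mapping.keys \<mu>. var_value \<phi> v ^ Poly_Mapping.lookup \<mu> v)"

lemma dp_monom_superset:
  assumes "finite V" "Poly_Mapping.keys \<mu> \<subseteq> V"
  shows "dp_monom \<phi> \<mu> = (\<Prod>v\<in>V. var_value \<phi> v ^ Poly_Mapping.lookup \<mu> v)"
  using assms by (intro prod.mono_neutral_left) (auto simp: in_keys_iff)

lemma dp_subst_superset:
  assumes "finite S" "Poly_Mapping.keys F \<subseteq> S"
  shows "dp_subst F \<phi> = (\<Sum>\<mu>\<in>S. gs_monom (Poly_Mapping.lookup F \<mu>) 0 * dp_monom \<phi> \<mu>)"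
  unfolding dp_subst_def using assms
  by (intro sum.mono_neutral_left) (auto simp: in_keys_iff gs_monom_0)

lemma dp_subst_0: "dp_subst 0 \<phi> = 0"
  by (simp add: dp_subst_def)

lemma dp_subst_add: "dp_subst (F + H) \<phi> = dp_subst F \<phi> + dp_subst H \<phi>"
proof -
  let ?S = "Poly_Mapping.keys F \<union> Poly_Mapping.keys H"
  have "dp_subst (F + H) \<phi> = (\<Sum>\<mu>\<in>?S. gs_monom (Poly_Mapping.lookup (F + H) \<mu>) 0 * dp_monom \<phi> \<mu>)"
    by (rule dp_subst_superset) (simp_all add: Poly_Mapping.keys_add)
  also have "\<dots> = (\<Sum>\<mu>\<in>?S. gs_monom (Poly_Mapping.lookup F \<mu>) 0 * dp_monom \<phi> \<mu>)
      + (\<Sum>\<mu>\<in>?S. gs_monom (Poly_Mapping.lookup H \<mu>) 0 * dp_monom \<phi> \<mu>)"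
    by (simp add: Poly_Mapping.lookup_add gs_monom_add algebra_simps sum.distrib)
  also have "\<dots> = dp_subst F \<phi> + dp_subst H \<phi>"
    by (simp add: dp_subst_superset[of ?S])
  finally show ?thesis .
qed

lemma dp_subst_sum: "dp_subst (sum f S) \<phi> = (\<Sum>i\<in>S. dp_subst (f i) \<phi>)"
  by (induction S rule: infinite_finite_induct) (simp_all add: dp_subst_0 dp_subst_add)

lemma dp_subst_single: "dp_subst (Poly_Mapping.single \<nu> a) \<phi> = gs_monom a 0 * dp_monom \<phi> \<nu>"
  by (subst dp_subst_superset[of "{\<nu>}"]) auto

text \<open>
  A common set \<open>V\<close> of variables for all monomials: the summands in which \<open>v\<close> does not occur vanish through the
  factor \<open>of_nat 0\<close>, whatever the truncated exponent.
\<close>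

lemma dp_subst_deriv:
  assumes "finite V" "dp_vars F \<subseteq> V" "v \<in> V"
  shows "dp_subst (dp_deriv v F) \<phi> = (\<Sum>\<mu>\<in>Poly_Mapping.keys F. gs_monom (Poly_Mapping.lookup F \<mu>) 0 *
    (of_nat (Poly_Mapping.lookup \<mu> v) * var_value \<phi> v ^ (Poly_Mapping.lookup \<mu> v - 1)
      * (\<Prod>w\<in>V - {v}. var_value \<phi> w ^ Poly_Mapping.lookup \<mu> w)))"
  unfolding dp_deriv_def dp_subst_sum dp_subst_single
proof (rule sum.cong[OF refl])
  fix \<mu> assume mu: "\<mu> \<in> Poly_Mapping.keys F"
  let ?\<nu> = "\<mu> - Poly_Mapping.single v 1"
  have keys: "Poly_Mapping.keys \<mu> \<subseteq> V"
    using assms(2) mu by (auto simp: dp_vars_def)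
  have "Poly_Mapping.keys ?\<nu> \<subseteq> V"
    using keys by (auto simp: in_keys_iff lookup_minus)
  then have "dp_monom \<phi> ?\<nu> = (\<Prod>w\<in>V. var_value \<phi> w ^ Poly_Mapping.lookup ?\<nu> w)"
    by (rule dp_monom_superset[OF assms(1)])
  also have "\<dots> = var_value \<phi> v ^ Poly_Mapping.lookup ?\<nu> v
      * (\<Prod>w\<in>V - {v}. var_value \<phi> w ^ Poly_Mapping.lookup ?\<nu> w)"
    by (rule prod.remove[OF assms(1,3)])
  also have "\<dots> = var_value \<phi> v ^ (Poly_Mapping.lookup \<mu> v - 1)
      * (\<Prod>w\<in>V - {v}. var_value \<phi> w ^ Poly_Mapping.lookup \<mu> w)"
    by (intro arg_cong2[where f = "(*)"] prod.cong) (auto simp: lookup_minus lookup_single when_def)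
  finally show "gs_monom (of_nat (Poly_Mapping.lookup \<mu> v) * Poly_Mapping.lookup F \<mu>) 0 * dp_monom \<phi> ?\<nu>
      = gs_monom (Poly_Mapping.lookup F \<mu>) 0 *
    (of_nat (Poly_Mapping.lookup \<mu> v) * var_value \<phi> v ^ (Poly_Mapping.lookup \<mu> v - 1)
      * (\<Prod>w\<in>V - {v}. var_value \<phi> w ^ Poly_Mapping.lookup \<mu> w))"
    unfolding gs_monom_of_nat_mult by (simp only: mult_ac)
qed

lemma dp_subst_closed:
  assumes add: "\<And>f g. f \<in> R \<Longrightarrow> g \<in> R \<Longrightarrow> f + g \<in> R"
    and mult: "\<And>f g. f \<in> R \<Longrightarrow> g \<in> R \<Longrightarrow> f * g \<in> R"
    and monom: "\<And>a. gs_monom a 0 \<in> R"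
    and vars: "\<And>v. var_value \<phi> v \<in> R"
  shows "dp_subst F \<phi> \<in> R"
proof -
  have zero: "0 \<in> R" using monom[of 0] by (simp add: gs_monom_0)
  have one: "1 \<in> R" using monom[of 1] by (simp add: one_gen_series_def)
  have pow: "f ^ n \<in> R" if "f \<in> R" for f n
    by (induction n) (use one mult that in auto)
  have prod: "(\<Prod>v\<in>V. f v) \<in> R" if "\<And>v. f v \<in> R" for f and V :: "var set"
    by (induction V rule: infinite_finite_induct) (use one mult that in auto)
  have sum: "(\<Sum>\<mu>\<in>M. f \<mu>) \<in> R" if "\<And>\<mu>. f \<mu> \<in> R" for f and M :: "(var \<Rightarrow>\<^sub>0 nat) set"
    by (induction M rule: infinite_finite_induct) (use zero add that in auto)
  show ?thesis
    unfolding dp_subst_def by (intro sum mult monom prod pow vars)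
qed

lemma dp_vars_deriv: "dp_vars (dp_deriv v F) \<subseteq> dp_vars F"
proof
  fix w assume "w \<in> dp_vars (dp_deriv v F)"
  then obtain \<nu> where \<nu>: "\<nu> \<in> Poly_Mapping.keys (dp_deriv v F)" "w \<in> Poly_Mapping.keys \<nu>"
    by (auto simp: dp_vars_def)
  have "\<exists>\<mu>\<in>Poly_Mapping.keys F. \<nu> = \<mu> - Poly_Mapping.single v 1"
  proof (rule ccontr)
    assume none: "\<not> ?thesis"
    have "Poly_Mapping.lookup (dp_deriv v F) \<nu> = 0"
      unfolding dp_deriv_def lookup_sum using none
      by (intro sum.neutral) (auto simp: lookup_single when_def)
    then show False using \<nu>(1) by (simp add: in_keys_iff)
  qed
  then obtain \<mu> where \<mu>: "\<mu> \<in> Poly_Mapping.keys F" "\<nu> = \<mu> - Poly_Mapping.single v 1" by blast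
  then have "w \<in> Poly_Mapping.keys \<mu>"
    using \<nu>(2) by (auto simp: in_keys_iff lookup_minus)
  then show "w \<in> dp_vars F" using \<mu>(1) by (auto simp: dp_vars_def)
qed

lemma finite_support_dp_subst:
  assumes "finite {x. gs_coeff P x \<noteq> 0}"
  shows "finite {x. gs_coeff (dp_subst F P) x \<noteq> 0}"
proof -
  let ?R = "{f. finite {x. gs_coeff f x \<noteq> 0}}"
  have "dp_subst F P \<in> ?R"
  proof (rule dp_subst_closed)
    fix f g assume fg: "f \<in> ?R" "g \<in> ?R"
    have "{x. gs_coeff (f + g) x \<noteq> 0} \<subseteq> {x. gs_coeff f x \<noteq> 0} \<union> {x. gs_coeff g x \<noteq> 0}"
      by (auto simp: plus_gen_series.rep_eq)
    then show "f + g \<in> ?R" using fg finite_subset by auto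
    have "{x. gs_coeff (f * g) x \<noteq> 0}
        \<subseteq> (\<lambda>(a, b). a + b) ` ({x. gs_coeff f x \<noteq> 0} \<times> {x. gs_coeff g x \<noteq> 0})"
      by (auto elim!: gs_coeff_times_nonzeroE)
    then show "f * g \<in> ?R" using fg by (auto intro: finite_subset)
  next
    show "gs_monom a 0 \<in> ?R" for a
      by (auto simp: gs_monom.rep_eq intro: finite_subset[of _ "{0}"])
    show "var_value P v \<in> ?R" for v
    proof (cases v)
      case Z
      then show ?thesis by (auto simp: gs_monom.rep_eq intro: finite_subset[of _ "{1}"])
    next
      case (U i)
      then show ?thesis
        using assms by (auto simp: gs_coeff_delta_funpow elim: rev_finite_subset)
    qed
  qed
  then show ?thesis by simp
qed

section \<open>Taylor expansion modulo a filtration\<close>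

text \<open>
  Three steps of a filtration suffice to speak of a first-order expansion: \<open>I0\<close> plays the role of a ring, \<open>I1\<close> of an ideal
  that contains the increments, and \<open>I2\<close> of an ideal that contains the products of two increments.
\<close>

locale ring_filtration =
  fixes I0 I1 I2 :: "'a :: comm_ring_1 set"
  assumes one: "1 \<in> I0" and zero: "0 \<in> I2"
    and sub1: "I1 \<subseteq> I0" and sub2: "I2 \<subseteq> I1"
    and add0: "\<And>x y. x \<in> I0 \<Longrightarrow> y \<in> I0 \<Longrightarrow> x + y \<in> I0"
    and add1: "\<And>x y. x \<in> I1 \<Longrightarrow> y \<in> I1 \<Longrightarrow> x + y \<in> I1"
    and add2: "\<And>x y. x \<in> I2 \<Longrightarrow> y \<in> I2 \<Longrightarrow> x + y \<in> I2"
    and mult0: "\<And>x y. x \<in> I0 \<Longrightarrow> y \<in> I0 \<Longrightarrow> x * y \<in> I0"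
    and mult01: "\<And>x y. x \<in> I0 \<Longrightarrow> y \<in> I1 \<Longrightarrow> x * y \<in> I1"
    and mult02: "\<And>x y. x \<in> I0 \<Longrightarrow> y \<in> I2 \<Longrightarrow> x * y \<in> I2"
    and mult11: "\<And>x y. x \<in> I1 \<Longrightarrow> y \<in> I1 \<Longrightarrow> x * y \<in> I2"
begin

lemma zero0: "0 \<in> I0" and zero1: "0 \<in> I1"
  using zero sub1 sub2 by auto

lemma of_nat_mem: "of_nat n \<in> I0"
  by (induction n) (use zero0 one add0 in auto)

lemma power_mem: "x \<in> I0 \<Longrightarrow> x ^ n \<in> I0"
  by (induction n) (use one mult0 in auto)

lemma prod_mem: "(\<And>v. v \<in> V \<Longrightarrow> f v \<in> I0) \<Longrightarrow> prod f V \<in> I0"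
  by (induction V rule: infinite_finite_induct) (use one mult0 in auto)

lemma sum_mem1: "(\<And>v. v \<in> V \<Longrightarrow> f v \<in> I1) \<Longrightarrow> sum f V \<in> I1"
  by (induction V rule: infinite_finite_induct) (use zero1 add1 in auto)

lemma sum_mem2: "(\<And>v. v \<in> V \<Longrightarrow> f v \<in> I2) \<Longrightarrow> sum f V \<in> I2"
  by (induction V rule: infinite_finite_induct) (use zero add2 in auto)

lemma power_expansion:
  assumes a: "a \<in> I0" and h: "h \<in> I1"
  shows "\<exists>r\<in>I2. (a + h) ^ n = a ^ n + h * (of_nat n * a ^ (n - 1)) + r"
proof (induction n)
  case 0
  then show ?case using zero by auto
next
  case (Suc n)
  then obtain r where r: "r \<in> I2" "(a + h) ^ n = a ^ n + h * (of_nat n * a ^ (n - 1)) + r" by blast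
  let ?r = "(of_nat n * a ^ (n - 1)) * (h * h) + (a + h) * r"
  have "?r \<in> I2"
    using a h r(1) sub1 by (intro add2 mult02 mult0 mult11 of_nat_mem power_mem add0) auto
  moreover have "(a + h) ^ Suc n = a ^ Suc n + h * (of_nat (Suc n) * a ^ (Suc n - 1)) + ?r"
  proof -
    have "of_nat (Suc n) * a ^ (Suc n - 1) = a ^ n + a * (of_nat n * a ^ (n - 1))"
      by (cases n) (simp_all add: algebra_simps)
    moreover have "(a + h) * (X + h * k + r) = a * X + h * (X + a * k) + (k * (h * h) + (a + h) * r)"
      for X k by (simp add: algebra_simps)
    ultimately show ?thesis by (simp only: power_Suc r(2))
  qed
  ultimately show ?case by blast
qed

lemma prod_expansion:
  assumes "finite V" and a: "\<And>v. v \<in> V \<Longrightarrow> a v \<in> I0" and h: "\<And>v. v \<in> V \<Longrightarrow> h v \<in> I1"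
  shows "\<exists>r\<in>I2. (\<Prod>v\<in>V. (a v + h v) ^ e v) = (\<Prod>v\<in>V. a v ^ e v)
    + (\<Sum>v\<in>V. h v * (of_nat (e v) * a v ^ (e v - 1) * (\<Prod>w\<in>V - {v}. a w ^ e w))) + r"
  using assms
proof (induction V rule: finite_induct)
  case empty
  then show ?case using zero by auto
next
  case (insert u V)
  let ?Q = "\<lambda>V v. of_nat (e v) * a v ^ (e v - 1) * (\<Prod>w\<in>V - {v}. a w ^ e w)"
  let ?\<Pi> = "\<Prod>v\<in>V. a v ^ e v" and ?\<Sigma> = "\<Sum>v\<in>V. h v * ?Q V v"
  have "\<exists>r\<in>I2. (\<Prod>v\<in>V. (a v + h v) ^ e v) = ?\<Pi> + ?\<Sigma> + r"
    by (rule insert.IH) (use insert.prems in auto)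
  then obtain r where r: "r \<in> I2" "(\<Prod>v\<in>V. (a v + h v) ^ e v) = ?\<Pi> + ?\<Sigma> + r" ..
  define d where "d = of_nat (e u) * a u ^ (e u - 1)"
  obtain q where q: "q \<in> I2" "(a u + h u) ^ e u = a u ^ e u + h u * d + q"
    using power_expansion[of "a u" "h u" "e u"] insert.prems by (auto simp: d_def)
  have mem: "a u \<in> I0" "h u \<in> I1" "d \<in> I0" "?\<Pi> \<in> I0" "?\<Sigma> \<in> I1" "a u ^ e u \<in> I0"
    using insert.prems
    by (auto simp: d_def mult.commute[of "h _"]
        intro!: mult0 of_nat_mem power_mem prod_mem sum_mem1 mult01)
  have mem': "h u \<in> I0" "?\<Sigma> \<in> I0" "r \<in> I0"
    using mem r(1) sub1 sub2 by auto
  let ?r = "d * (h u * ?\<Sigma>) + (?\<Pi> + ?\<Sigma> + r) * q + (a u ^ e u + h u * d) * r"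
  have "?r \<in> I2"
    using mem mem' r(1) q(1) by (intro add2 mult02 add0 mult0 mult11) auto
  moreover have "(\<Prod>v\<in>insert u V. (a v + h v) ^ e v) = (\<Prod>v\<in>insert u V. a v ^ e v)
      + (\<Sum>v\<in>insert u V. h v * ?Q (insert u V) v) + ?r"
  proof -
    have "(\<Sum>v\<in>V. h v * ?Q (insert u V) v) = a u ^ e u * ?\<Sigma>"
      unfolding sum_distrib_left
    proof (rule sum.cong[OF refl])
      fix v assume v: "v \<in> V"
      then have "insert u V - {v} = insert u (V - {v})" using insert.hyps by auto
      then have "(\<Prod>w\<in>insert u V - {v}. a w ^ e w) = a u ^ e u * (\<Prod>w\<in>V - {v}. a w ^ e w)"
        using insert.hyps by simp
      then show "h v * ?Q (insert u V) v = a u ^ e u * (h v * ?Q V v)"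
        by (simp only: mult_ac)
    qed
    moreover have "?Q (insert u V) u = d * ?\<Pi>"
      using insert.hyps by (simp add: d_def)
    ultimately have sum: "(\<Sum>v\<in>insert u V. h v * ?Q (insert u V) v)
        = h u * (d * ?\<Pi>) + a u ^ e u * ?\<Sigma>"
      unfolding sum.insert[OF insert.hyps(1,2)] by (simp only:)
    have "(\<Prod>v\<in>insert u V. (a v + h v) ^ e v) = (a u ^ e u + h u * d + q) * (?\<Pi> + ?\<Sigma> + r)"
      unfolding prod.insert[OF insert.hyps(1,2)] by (simp only: r(2) q(2))
    moreover have "(x + y * z + t) * (X + S + R)
        = x * X + (y * (z * X) + x * S) + (z * (y * S) + (X + S + R) * t + (x + y * z) * R)"
      for x y z t X S R :: 'a
      by (simp add: algebra_simps)
    ultimately show ?thesis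
      unfolding sum prod.insert[OF insert.hyps(1,2)] by (simp only:)
  qed
  ultimately show ?case by blast
qed

end

text \<open>
  The increment of the variable \<open>Z\<close> is 0, hence only the derivatives by \<open>u\<^sub>0, \<dots>, u\<^sub>m\<close> appear.
\<close>

lemma dp_subst_taylor:
  assumes "ring_filtration I0 I1 I2"
    and vars: "dp_vars F \<subseteq> insert Z (U ` {..m})"
    and monom: "\<And>a. gs_monom a 0 \<in> I0"
    and P: "\<And>v. var_value P v \<in> I0"
    and psi: "\<And>i. i \<le> m \<Longrightarrow> (gs_delta ^^ i) \<psi> \<in> I1"
  shows "\<exists>T\<in>I2. dp_subst F (P + \<psi>) = dp_subst F P
    + (\<Sum>i\<le>m. dp_subst (dp_deriv (U i) F) P * (gs_delta ^^ i) \<psi>) + T"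
proof -
  interpret ring_filtration I0 I1 I2 by fact
  let ?V = "insert Z (U ` {..m})"
  define h where "h = (\<lambda>v. case v of Z \<Rightarrow> 0 | U i \<Rightarrow> (gs_delta ^^ i) \<psi>)"
  let ?Q = "\<lambda>\<mu> v. of_nat (Poly_Mapping.lookup \<mu> v) * var_value P v ^ (Poly_Mapping.lookup \<mu> v - 1)
      * (\<Prod>w\<in>?V - {v}. var_value P w ^ Poly_Mapping.lookup \<mu> w)"
  have val: "var_value (P + \<psi>) v = var_value P v + h v" for v
    by (cases v) (simp_all add: h_def gs_delta_funpow_add)
  have h1: "h v \<in> I1" if "v \<in> ?V" for v
    using that psi zero1 by (auto simp: h_def)
  have fin: "finite ?V" by simp
  have keys: "Poly_Mapping.keys \<mu> \<subseteq> ?V" if "\<mu> \<in> Poly_Mapping.keys F" for \<mu>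
    using that vars by (auto simp: dp_vars_def)
  have "\<forall>\<mu>\<in>Poly_Mapping.keys F. \<exists>r. r \<in> I2 \<and>
      dp_monom (P + \<psi>) \<mu> = dp_monom P \<mu> + (\<Sum>v\<in>?V. h v * ?Q \<mu> v) + r"
  proof
    fix \<mu> assume mu: "\<mu> \<in> Poly_Mapping.keys F"
    show "\<exists>r. r \<in> I2 \<and>
        dp_monom (P + \<psi>) \<mu> = dp_monom P \<mu> + (\<Sum>v\<in>?V. h v * ?Q \<mu> v) + r"
      using prod_expansion[of ?V "var_value P" h "Poly_Mapping.lookup \<mu>", OF fin P h1]
      unfolding dp_monom_superset[OF fin keys[OF mu]] unfolding val Bex_def .
  qed
  from bchoice[OF this] obtain r where r: "\<And>\<mu>. \<mu> \<in> Poly_Mapping.keys F \<Longrightarrow> r \<mu> \<in> I2"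
    "\<And>\<mu>. \<mu> \<in> Poly_Mapping.keys F \<Longrightarrow>
      dp_monom (P + \<psi>) \<mu> = dp_monom P \<mu> + (\<Sum>v\<in>?V. h v * ?Q \<mu> v) + r \<mu>"
    by blast
  let ?c = "\<lambda>\<mu>. gs_monom (Poly_Mapping.lookup F \<mu>) 0"
  let ?T = "\<Sum>\<mu>\<in>Poly_Mapping.keys F. ?c \<mu> * r \<mu>"
  have T: "?T \<in> I2" using r(1) monom by (intro sum_mem2 mult02)
  have e1: "dp_subst F (P + \<psi>) = dp_subst F P
      + (\<Sum>\<mu>\<in>Poly_Mapping.keys F. ?c \<mu> * (\<Sum>v\<in>?V. h v * ?Q \<mu> v)) + ?T"
    unfolding dp_subst_def
    using r(2) by (simp only: distrib_left sum.distrib cong: sum.cong)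
  have e2: "(\<Sum>\<mu>\<in>Poly_Mapping.keys F. ?c \<mu> * (\<Sum>v\<in>?V. h v * ?Q \<mu> v))
      = (\<Sum>v\<in>?V. dp_subst (dp_deriv v F) P * h v)"
  proof -
    have "(\<Sum>\<mu>\<in>Poly_Mapping.keys F. ?c \<mu> * (\<Sum>v\<in>?V. h v * ?Q \<mu> v))
        = (\<Sum>v\<in>?V. \<Sum>\<mu>\<in>Poly_Mapping.keys F. ?c \<mu> * (h v * ?Q \<mu> v))"
      unfolding sum_distrib_left by (rule sum.swap)
    also have "\<dots> = (\<Sum>v\<in>?V. dp_subst (dp_deriv v F) P * h v)"
    proof (rule sum.cong[OF refl])
      fix v assume "v \<in> ?V"
      show "(\<Sum>\<mu>\<in>Poly_Mapping.keys F. ?c \<mu> * (h v * ?Q \<mu> v)) = dp_subst (dp_deriv v F) P * h v"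
        unfolding dp_subst_deriv[OF fin vars \<open>v \<in> ?V\<close>] sum_distrib_right
        by (intro sum.cong refl) (simp only: mult_ac)
    qed
    finally show ?thesis .
  qed
  have e3: "(\<Sum>v\<in>?V. dp_subst (dp_deriv v F) P * h v) = (\<Sum>i\<le>m. dp_subst (dp_deriv (U i) F) P * (gs_delta ^^ i) \<psi>)"
    by (subst sum.insert) (auto simp: h_def sum.reindex inj_on_def)
  show ?thesis by (rule bexI[OF _ T]) (rule e1[unfolded e2 e3])
qed

section \<open>The corner of the Newton polygon\<close>

lemma re_val_attained:
  assumes "f \<noteq> 0"
  shows "\<exists>x. gs_coeff f x \<noteq> 0 \<and> re_val f = ereal (Re x)"
proof -
  obtain x0 where x0: "gs_coeff f x0 \<noteq> 0"
    using assms gs_eqI[of f 0] by (auto simp: zero_gen_series.rep_eq)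
  let ?S = "{x. gs_coeff f x \<noteq> 0 \<and> Re x \<le> Re x0}"
  have S: "finite (Re ` ?S)" "Re ` ?S \<noteq> {}" using finite_gs_coeff x0 by auto
  obtain x where x: "x \<in> ?S" "Re x = Min (Re ` ?S)" using Min_in[OF S] by auto
  have min: "Re x \<le> Re y" if "y \<in> ?S" for y
    using Min_le[OF S(1)] that x(2) by simp
  have "Re x \<le> Re y" if "gs_coeff f y \<noteq> 0" for y
    using x(1) min[of y] that by (cases "Re y \<le> Re x0") auto
  then have "re_val f = ereal (Re x)"
    unfolding re_val_def using x(1) by (intro antisym INF_greatest INF_lower2[of x]) auto
  then show ?thesis using x(1) by blast
qed

lemma re_val_le: "gs_coeff f x \<noteq> 0 \<Longrightarrow> re_val f \<le> ereal (Re x)"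
  unfolding re_val_def by (rule INF_lower) simp

lemma newton_hull_up:
  assumes "(x, y) \<in> newton_hull m a" "0 \<le> d"
  shows "(x, y + d) \<in> newton_hull m a"
proof -
  let ?S = "\<Union>i\<le>m. {(x, y). x \<le> real i \<and> ereal y \<ge> re_val (a i)}"
  have "(+) (0, d) ` ?S \<subseteq> ?S"
  proof
    fix z assume "z \<in> (+) (0, d) ` ?S"
    then obtain u v i where *: "i \<le> m" "u \<le> real i" "re_val (a i) \<le> ereal v" "z = (u, d + v)"
      by auto
    have "ereal v \<le> ereal (d + v)" using assms(2) by simp
    then have "re_val (a i) \<le> ereal (d + v)" using *(3) by (rule order.trans[rotated])
    then show "z \<in> ?S" using * by auto
  qed
  then have "(+) (0, d) ` newton_hull m a \<subseteq> newton_hull m a"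
    unfolding newton_hull_def convex_hull_translation[symmetric] by (rule hull_mono)
  moreover have "(x, y + d) = (0, d) + (x, y)" by simp
  ultimately show ?thesis using assms(1) by blast
qed

text \<open>
  The features of the hull that matter for its rising edges: it is closed upwards, lies above the height \<open>\<Lambda>\<close>, and has
  the whole quadrant to the upper left of the corner \<open>(p, \<Lambda>)\<close>.
\<close>

locale newton_corner =
  fixes H :: "(real \<times> real) set" and p \<Lambda> :: real
  assumes convex: "convex H"
    and above: "\<And>x y. (x, y) \<in> H \<Longrightarrow> \<Lambda> \<le> y"
    and corner: "\<And>x y. x \<le> p \<Longrightarrow> \<Lambda> \<le> y \<Longrightarrow> (x, y) \<in> H"
    and up: "\<And>x y d. (x, y) \<in> H \<Longrightarrow> 0 \<le> d \<Longrightarrow> (x, y + d) \<in> H"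
begin

lemma interior_corner:
  assumes "x < p" "\<Lambda> < y"
  shows "(x, y) \<in> interior H"
proof -
  have "open {z :: real \<times> real. fst z < p \<and> \<Lambda> < snd z}"
    by (intro open_Collect_conj open_Collect_less continuous_intros)
  moreover have "{z :: real \<times> real. fst z < p \<and> \<Lambda> < snd z} \<subseteq> H"
    using corner by auto
  ultimately have "{z. fst z < p \<and> \<Lambda> < snd z} \<subseteq> interior H" by (intro interior_maximal)
  then show ?thesis using assms by auto
qed

text \<open>
  The points above \<open>\<Lambda>\<close> and above the line through the corner and \<open>(x2, y2)\<close>, to the left of \<open>x2\<close>, form an open set. They
  belong to the quadrant if \<open>x \<le> p\<close>, and otherwise arise from a point of the chord by moving upwards.
\<close>

lemma interior_above_chord:
  assumes b: "(x2, y2) \<in> H" "p < x2"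
    and "x < x2" "\<Lambda> < y" "\<Lambda> + (x - p) / (x2 - p) * (y2 - \<Lambda>) < y"
  shows "(x, y) \<in> interior H"
proof -
  let ?U = "{z :: real \<times> real. fst z < x2 \<and> \<Lambda> < snd z \<and>
    \<Lambda> + (fst z - p) / (x2 - p) * (y2 - \<Lambda>) < snd z}"
  have "open ?U"
    using b(2) by (intro open_Collect_conj open_Collect_less continuous_intros) auto
  moreover have "?U \<subseteq> H"
  proof safe
    fix u v assume *: "fst (u, v) < x2" "\<Lambda> < snd (u, v)"
      "\<Lambda> + (fst (u, v) - p) / (x2 - p) * (y2 - \<Lambda>) < snd (u, v)"
    show "(u, v) \<in> H"
    proof (cases "u \<le> p")
      case True
      then show ?thesis using * by (intro corner) auto
    next
      case False
      define t where "t = (u - p) / (x2 - p)"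
      have t: "0 \<le> t" "t \<le> 1" using False * b(2) by (auto simp: t_def field_simps)
      have tu: "t * (x2 - p) = u - p" using b(2) by (simp add: t_def)
      have "(1 - t) *\<^sub>R (p, \<Lambda>) + t *\<^sub>R (x2, y2) \<in> H"
        using t b(1) corner[of p \<Lambda>] by (intro convexD[OF convex]) auto
      also have "(1 - t) *\<^sub>R (p, \<Lambda>) + t *\<^sub>R (x2, y2) = (u, \<Lambda> + t * (y2 - \<Lambda>))"
        using tu by (simp add: algebra_simps)
      finally have "(u, \<Lambda> + t * (y2 - \<Lambda>) + (v - (\<Lambda> + t * (y2 - \<Lambda>)))) \<in> H"
        by (rule up) (use *(3) in \<open>simp add: t_def\<close>)
      then show ?thesis by simp
    qed
  qed
  ultimately have "?U \<subseteq> interior H" by (intro interior_maximal)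
  moreover have "(x, y) \<in> ?U" using assms by simp
  ultimately show ?thesis by (rule subsetD)
qed

text \<open>
  If a rising chord started to the left of the corner, it would enter the interior of the quadrant immediately.
\<close>

lemma rising_chord_right_of_corner:
  assumes "convex e" "e \<subseteq> frontier H" "e \<subseteq> H"
    and a: "(x1, y1) \<in> e" and b: "(x2, y2) \<in> e" and "x1 < x2" "y1 < y2"
  shows "p \<le> x1"
proof (rule ccontr)
  assume "\<not> p \<le> x1"
  then have x1: "x1 < p" by simp
  \<comment> \<open>a parameter so small that the point of the chord stays to the left of the corner\<close>
  define t where "t = min (1 / 2) ((p - x1) / (2 * (x2 - x1)))"
  have t: "0 < t" "t \<le> 1" using x1 assms by (auto simp: t_def)
  have "t \<le> (p - x1) / (2 * (x2 - x1))" by (simp add: t_def)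
  then have "t * (x2 - x1) \<le> (p - x1) / 2" using assms by (simp add: field_simps)
  then have x: "x1 + t * (x2 - x1) < p" using x1 by argo
  have "\<Lambda> \<le> y1" using above a assms(3) by blast
  moreover have "0 < t * (y2 - y1)" using t(1) assms(7) by simp
  ultimately have y: "\<Lambda> < y1 + t * (y2 - y1)" by linarith
  have "(1 - t) *\<^sub>R (x1, y1) + t *\<^sub>R (x2, y2) \<in> e"
    using t by (intro convexD[OF assms(1) a b]) auto
  also have "(1 - t) *\<^sub>R (x1, y1) + t *\<^sub>R (x2, y2) = (x1 + t * (x2 - x1), y1 + t * (y2 - y1))"
    by (simp add: algebra_simps)
  finally have "(x1 + t * (x2 - x1), y1 + t * (y2 - y1)) \<in> frontier H"
    using assms(2) by (rule rev_subsetD)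
  then show False
    using interior_corner[OF x y] by (simp add: frontier_def)
qed

text \<open>
  \<open>H\<close> lies above the line of slope \<open>r\<close> through the corner. A boundary chord that rises more slowly would start strictly
  above the chord from the corner to its right end point, that is, in the interior.
\<close>

lemma rising_chord_slope_ge:
  assumes low: "\<And>x y. (x, y) \<in> H \<Longrightarrow> \<Lambda> + r * (x - p) \<le> y" and "0 < r"
    and e: "convex e" "e \<subseteq> frontier H" "e \<subseteq> H"
    and a: "(x1, y1) \<in> e" and b: "(x2, y2) \<in> e" and "x1 < x2" "y1 < y2"
  shows "r \<le> (y2 - y1) / (x2 - x1)"
proof (rule ccontr)
  assume less: "\<not> r \<le> (y2 - y1) / (x2 - x1)"
  define \<rho> where "\<rho> = (y2 - y1) / (x2 - x1)"
  have rho: "\<rho> < r" using less by (simp add: \<rho>_def)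
  have y2: "y2 = y1 + \<rho> * (x2 - x1)" using \<open>x1 < x2\<close> by (simp add: \<rho>_def)
  have p: "p \<le> x1" using rising_chord_right_of_corner[OF e a b \<open>x1 < x2\<close> \<open>y1 < y2\<close>] .
  define u where "u = x1 - p"
  define w where "w = x2 - x1"
  have uw: "0 \<le> u" "0 < w" using p \<open>x1 < x2\<close> by (auto simp: u_def w_def)
  have "\<Lambda> + r * (x2 - p) \<le> y2" using low b e(3) by blast
  moreover have "r * (x2 - p) = r * u + r * w" by (simp add: u_def w_def algebra_simps)
  ultimately have "y1 - \<Lambda> \<ge> r * u + (r - \<rho>) * w"
    using y2 by (simp add: w_def[symmetric] algebra_simps)
  moreover have "0 < (r - \<rho>) * w" using rho uw by simp
  ultimately have Y: "r * u < y1 - \<Lambda>" by linarith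
  moreover have "\<rho> * u \<le> r * u" using rho uw by (intro mult_right_mono) auto
  ultimately have Y': "\<rho> * u < y1 - \<Lambda>" by linarith
  have y1: "\<Lambda> < y1" using Y uw \<open>0 < r\<close> by (smt (verit) mult_nonneg_nonneg)
  have "u * (y2 - \<Lambda>) < (u + w) * (y1 - \<Lambda>)"
  proof -
    have "u * (y2 - \<Lambda>) = u * (y1 - \<Lambda>) + w * (\<rho> * u)"
      using y2 by (simp add: w_def[symmetric] algebra_simps)
    also have "\<dots> < u * (y1 - \<Lambda>) + w * (y1 - \<Lambda>)" using Y' uw by simp
    finally show ?thesis by (simp add: algebra_simps)
  qed
  then have "u / (u + w) * (y2 - \<Lambda>) < y1 - \<Lambda>"
    using uw by (simp add: field_simps)
  then have "\<Lambda> + (x1 - p) / (x2 - p) * (y2 - \<Lambda>) < y1"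
    by (simp add: u_def w_def)
  then have "(x1, y1) \<in> interior H"
    using b e(3) p \<open>x1 < x2\<close> y1 by (intro interior_above_chord) auto
  moreover have "(x1, y1) \<in> frontier H" using a e(2) by (rule rev_subsetD)
  ultimately show False by (simp add: frontier_def)
qed

text \<open>
  The supporting line of slope \<open>r\<close> through the corner meets \<open>H\<close> in an edge as soon as it contains a second point of \<open>H\<close>.
\<close>

lemma supporting_edge:
  assumes low: "\<And>x y. (x, y) \<in> H \<Longrightarrow> \<Lambda> + r * (x - p) \<le> y"
    and q: "(q, \<Lambda> + r * (q - p)) \<in> H" "p < q"
  shows "\<exists>e. e edge_of H \<and> e \<subseteq> frontier H \<and> (p, \<Lambda>) \<in> e \<and> (q, \<Lambda> + r * (q - p)) \<in> e"
proof -
  let ?L = "{z. (- r, 1 :: real) \<bullet> z = \<Lambda> - r * p}"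
  let ?e = "H \<inter> ?L"
  have face: "?e face_of H"
  proof (rule face_of_Int_supporting_hyperplane_ge[OF convex])
    fix z assume "z \<in> H"
    then show "\<Lambda> - r * p \<le> (- r, 1 :: real) \<bullet> z"
      using low[of "fst z" "snd z"] by (cases z) (simp add: algebra_simps)
  qed
  have P: "(p, \<Lambda>) \<in> ?e" using corner by (simp add: inner_Pair)
  have Q: "(q, \<Lambda> + r * (q - p)) \<in> ?e" using q by (simp add: inner_Pair algebra_simps)
  have "aff_dim ?e \<le> aff_dim ?L" by (intro aff_dim_subset) auto
  also have "\<dots> = 1" by (subst aff_dim_hyperplane) (auto simp: zero_prod_def)
  finally have "aff_dim ?e \<le> 1" .
  moreover have "aff_dim {(p, \<Lambda>), (q, \<Lambda> + r * (q - p))} \<le> aff_dim ?e"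
    using P Q by (intro aff_dim_subset) auto
  then have "1 \<le> aff_dim ?e" using q(2) by (simp split: if_splits)
  ultimately have "?e edge_of H" using face by (simp add: edge_of_def)
  moreover have "?e \<noteq> H"
  proof
    assume "?e = H"
    moreover have "(p, \<Lambda> + 1) \<in> H" by (rule corner) auto
    ultimately have "(p, \<Lambda> + 1) \<in> ?L" by blast
    then show False by simp
  qed
  then have "?e \<inter> interior H = {}" using face face_of_disjoint_interior by blast
  then have "?e \<subseteq> frontier H" using closure_subset by (auto simp: frontier_def)
  ultimately show ?thesis using P Q by blast
qed

end

lemma newton_hull_corner:
  assumes "p \<le> m" "re_val (a p) = ereal \<Lambda>" "\<And>i. i \<le> m \<Longrightarrow> ereal \<Lambda> \<le> re_val (a i)"
  shows "newton_corner (newton_hull m a) (real p) \<Lambda>"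
proof
  show "convex (newton_hull m a)" by (simp add: newton_hull_def)
  show "(x, y) \<in> newton_hull m a" if "x \<le> real p" "\<Lambda> \<le> y" for x y
    unfolding newton_hull_def by (rule hull_inc) (use assms that in auto)
  show "(x, y + d) \<in> newton_hull m a" if "(x, y) \<in> newton_hull m a" "0 \<le> d" for x y d
    using that by (rule newton_hull_up)
  have "newton_hull m a \<subseteq> {z. (0 :: real, 1 :: real) \<bullet> z \<ge> \<Lambda>}"
    unfolding newton_hull_def
  proof (rule hull_minimal)
    show "(\<Union>i\<le>m. {(x, y). x \<le> real i \<and> ereal y \<ge> re_val (a i)}) \<subseteq> {z. (0 :: real, 1 :: real) \<bullet> z \<ge> \<Lambda>}"
      using assms(3) by (fastforce simp: inner_Pair dest: order.trans)
  qed (rule convex_halfspace_ge)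
  then show "\<Lambda> \<le> y" if "(x, y) \<in> newton_hull m a" for x y
    using that by (auto simp: inner_Pair)
qed

lemma newton_slopes_rising:
  assumes "r \<in> newton_slopes m a" "0 < r"
  obtains e x1 y1 x2 y2 where "convex e" "e \<subseteq> frontier (newton_hull m a)" "e \<subseteq> newton_hull m a"
    "(x1, y1) \<in> e" "(x2, y2) \<in> e" "x1 < x2" "y1 < y2" "r = (y2 - y1) / (x2 - x1)"
proof -
  obtain e u v where e: "e edge_of newton_hull m a" "e \<subseteq> frontier (newton_hull m a)"
    and uv: "u \<in> e" "v \<in> e" "fst u \<noteq> fst v" "r = (snd v - snd u) / (fst v - fst u)"
    using assms(1) by (auto simp: newton_slopes_def newton_edges_def newton_polygon_def)
  have e': "convex e" "e \<subseteq> newton_hull m a"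
    using e(1) unfolding edge_of_def by (blast dest: face_of_imp_convex face_of_imp_subset)+
  show ?thesis
  proof (cases "fst u < fst v")
    case True
    then have "snd u < snd v" using uv(4) assms(2) by (simp add: zero_less_divide_iff)
    then show ?thesis using that[of e "fst u" "snd u" "fst v" "snd v"] True uv e e' by auto
  next
    case False
    then have lt: "fst v < fst u" using uv(3) by simp
    then have "snd v < snd u" using uv(4) assms(2) by (simp add: zero_less_divide_iff)
    moreover have "r = (snd u - snd v) / (fst u - fst v)"
      using uv(4) by (metis minus_diff_eq minus_divide_divide)
    ultimately show ?thesis using that[of e "fst v" "snd v" "fst u" "snd u"] lt uv e e' by auto
  qed
qed

text \<open>
  If \<open>p < m\<close>, the least positive slope is the minimum of the quotients \<open>(Re val (a i) - Re lam) / (i - p)\<close> over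
  \<open>i > p\<close>: it is attained by the supporting edge at the corner, and no rising edge has a smaller slope. If \<open>p = m\<close>,
  the hull is a quadrant and no edge rises. The constant \<open>\<kappa>\<close> is the reciprocal of the slope.
\<close>

lemma least_positive_slope_bound:
  assumes "p \<le> m" and top: "a m \<noteq> 0"
    and corner: "gs_coeff (a p) lam \<noteq> 0"
    and low: "\<And>i x. i \<le> m \<Longrightarrow> gs_coeff (a i) x \<noteq> 0 \<Longrightarrow> Re lam \<le> Re x"
    and right: "\<And>i x. p < i \<Longrightarrow> i \<le> m \<Longrightarrow> gs_coeff (a i) x \<noteq> 0 \<Longrightarrow> Re lam < Re x"
  shows "\<exists>\<kappa>\<ge>0. (\<forall>s. div_slope s (least_positive_slope m a) = of_real \<kappa> * s) \<and>
    (\<forall>i x. p < i \<longrightarrow> i \<le> m \<longrightarrow> gs_coeff (a i) x \<noteq> 0 \<longrightarrow> real i - real p \<le> \<kappa> * (Re x - Re lam))"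
proof -
  let ?H = "newton_hull m a"
  have le: "ereal (Re lam) \<le> re_val (a i)" if "i \<le> m" for i
    unfolding re_val_def using low that by (auto intro!: INF_greatest)
  have eq: "re_val (a p) = ereal (Re lam)"
    using le[OF assms(1)] re_val_le[OF corner] by simp
  interpret newton_corner ?H "real p" "Re lam"
    by (rule newton_hull_corner[of p m a "Re lam", OF assms(1) eq]) (rule le)
  show ?thesis
  proof (cases "p = m")
    case True
    have "?H \<subseteq> {z. (1 :: real, 0 :: real) \<bullet> z \<le> real p}"
      unfolding newton_hull_def
    proof (rule hull_minimal)
      show "(\<Union>i\<le>m. {(x, y). x \<le> real i \<and> ereal y \<ge> re_val (a i)}) \<subseteq> {z. (1 :: real, 0 :: real) \<bullet> z \<le> real p}"
        using True by (auto simp: inner_Pair)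
    qed (rule convex_halfspace_le)
    then have left: "x \<le> real p" if "(x, y) \<in> ?H" for x y
      using that by (auto simp: inner_Pair)
    have "\<not> 0 < r" if "r \<in> newton_slopes m a" for r
    proof
      assume "0 < r"
      with that obtain e x1 y1 x2 y2 where e: "convex e" "e \<subseteq> frontier ?H" "e \<subseteq> ?H"
        "(x1, y1) \<in> e" "(x2, y2) \<in> e" "x1 < x2" "y1 < y2"
        by (rule newton_slopes_rising)
      then have "real p \<le> x1" by (rule rising_chord_right_of_corner)
      moreover have "x2 \<le> real p" using left e by blast
      ultimately show False using e by simp
    qed
    then have "least_positive_slope m a = \<infinity>" by (auto simp: least_positive_slope_def)
    then show ?thesis using True by (intro exI[of _ 0]) (auto simp: div_slope_def)
  next
    case False
    define v where "v i = real_of_ereal (re_val (a i))" for i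
    define J where "J = {i. p < i \<and> i \<le> m \<and> a i \<noteq> 0}"
    define r where "r = Min ((\<lambda>i. (v i - Re lam) / (real i - real p)) ` J)"
    have J: "finite J" "m \<in> J" using top False assms(1) by (auto simp: J_def)
    have v: "re_val (a i) = ereal (v i)" "Re lam < v i" if "i \<in> J" for i
      using re_val_attained[of "a i"] right that by (auto simp: J_def v_def)
    have rle: "r * (real i - real p) \<le> v i - Re lam" if "i \<in> J" for i
    proof -
      have "r \<le> (v i - Re lam) / (real i - real p)"
        unfolding r_def using J that by (intro Min_le) auto
      then show ?thesis using that by (simp add: J_def pos_le_divide_eq)
    qed
    have "r \<in> (\<lambda>i. (v i - Re lam) / (real i - real p)) ` J"
      unfolding r_def using J by (intro Min_in) auto
    then obtain q where q: "q \<in> J" "r = (v q - Re lam) / (real q - real p)" by auto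
    have r0: "0 < r" using q v[OF q(1)] by (simp add: J_def)
    have vq: "v q = Re lam + r * (real q - real p)" using q by (simp add: J_def)
    have half: "?H \<subseteq> {z. (- r, 1 :: real) \<bullet> z \<ge> Re lam - r * real p}"
      unfolding newton_hull_def
    proof (rule hull_minimal)
      show "(\<Union>i\<le>m. {(x, y). x \<le> real i \<and> ereal y \<ge> re_val (a i)})
          \<subseteq> {z. (- r, 1 :: real) \<bullet> z \<ge> Re lam - r * real p}"
      proof clarify
        fix i x y assume i: "i \<le> m" "x \<le> real i" "re_val (a i) \<le> ereal y"
        have y: "Re lam \<le> y" using le[OF i(1)] i(3) order.trans by fastforce
        have "Re lam + r * (x - real p) \<le> y"
        proof (cases "i \<in> J")
          case True
          have "r * (x - real p) \<le> r * (real i - real p)" using i r0 by simp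
          also have "\<dots> \<le> v i - Re lam" by (rule rle[OF True])
          also have "\<dots> \<le> y - Re lam" using v[OF True] i(3) by simp
          finally show ?thesis by simp
        next
          case False
          have "a i \<noteq> 0"
          proof
            assume "a i = 0"
            then have "re_val (a i) = \<infinity>" by (simp add: re_val_def zero_gen_series.rep_eq top_ereal_def)
            then show False using i(3) by simp
          qed
          then have "x \<le> real p" using False i by (auto simp: J_def)
          then have "r * (x - real p) \<le> 0" using r0 by (simp add: mult_le_0_iff)
          then show ?thesis using y by simp
        qed
        then show "(- r, 1 :: real) \<bullet> (x, y) \<ge> Re lam - r * real p" by (simp add: inner_Pair algebra_simps)
      qed
    qed (rule convex_halfspace_ge)
    have low_line: "Re lam + r * (x - real p) \<le> y" if "(x, y) \<in> ?H" for x y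
      using subsetD[OF half that] by (simp add: algebra_simps)
    have "(real q, v q) \<in> ?H"
      unfolding newton_hull_def using q(1) v(1) by (intro hull_inc) (auto simp: J_def)
    then obtain e where e: "e edge_of ?H" "e \<subseteq> frontier ?H" "(real p, Re lam) \<in> e" "(real q, v q) \<in> e"
      using supporting_edge[of r "real q"] low_line q(1) vq by (auto simp: J_def)
    have "e \<in> newton_edges m a"
      using e by (auto simp: newton_edges_def newton_polygon_def)
    then have r_slope: "r \<in> newton_slopes m a"
      unfolding newton_slopes_def mem_Collect_eq using e(3,4) q
      by (intro bexI[of _ e] bexI[of _ "(real p, Re lam)"] bexI[of _ "(real q, v q)"]) (auto simp: J_def)
    have least: "r \<le> r'" if r': "r' \<in> newton_slopes m a" "0 < r'" for r'
    proof -
      obtain e x1 y1 x2 y2 where "convex e" "e \<subseteq> frontier ?H" "e \<subseteq> ?H"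
        "(x1, y1) \<in> e" "(x2, y2) \<in> e" "x1 < x2" "y1 < y2" "r' = (y2 - y1) / (x2 - x1)"
        by (rule newton_slopes_rising[OF r'])
      then show ?thesis using rising_chord_slope_ge[OF low_line r0] by blast
    qed
    have "least_positive_slope m a = ereal r"
      unfolding least_positive_slope_def using r_slope r0 least
      by (auto intro!: Least_equality)
    then have "div_slope s (least_positive_slope m a) = of_real (1 / r) * s" for s
      by (simp add: div_slope_def)
    moreover have "real i - real p \<le> 1 / r * (Re x - Re lam)"
      if "p < i" "i \<le> m" "gs_coeff (a i) x \<noteq> 0" for i x
    proof -
      have "i \<in> J" using that by (auto simp: J_def zero_gen_series.rep_eq)
      then have "r * (real i - real p) \<le> Re x - Re lam"
        using rle re_val_le[OF that(3)] v(1)[of i] by force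
      then show ?thesis using r0 by (simp add: field_simps)
    qed
    ultimately show ?thesis using r0 by (intro exI[of _ "1 / r"]) auto
  qed
qed

section \<open>Weighted norms\<close>

text \<open>
  The denominator plays the role of \<open>Gamma (1 + \<kappa> y)\<close>. Using \<open>1 + y\<close> in place of \<open>y\<close> as the base makes it increasing and
  at least 1 for all \<open>y \<ge> 0\<close>.
\<close>

definition maj_wt :: "real \<Rightarrow> real \<Rightarrow> real \<Rightarrow> real"
  where "maj_wt \<kappa> r y = r powr y / (1 + y) powr (\<kappa> * y)"

lemma maj_wt_nonneg: "0 \<le> maj_wt \<kappa> r y"
  by (simp add: maj_wt_def)

text \<open>
  The reason for the factorial-like weight: an increase of \<open>y\<close> by \<open>\<tau>\<close> pays for \<open>\<kappa> \<tau>\<close> powers of the new value of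
  \<open>1 + y\<close>.
\<close>

lemma maj_wt_add_gain:
  assumes "0 \<le> \<kappa>" "0 < r" "0 \<le> y" "0 \<le> \<tau>"
  shows "maj_wt \<kappa> r (y + \<tau>) * (1 + (y + \<tau>)) powr (\<kappa> * \<tau>) \<le> r powr \<tau> * maj_wt \<kappa> r y"
proof -
  let ?x = "1 + (y + \<tau>)"
  have x: "0 < ?x" using assms by simp
  have "(1 + y) powr (\<kappa> * y) \<le> ?x powr (\<kappa> * y)"
    using assms by (intro powr_mono2) auto
  then have "r powr (y + \<tau>) / ?x powr (\<kappa> * y) \<le> r powr (y + \<tau>) / (1 + y) powr (\<kappa> * y)"
    using assms by (intro divide_left_mono mult_pos_pos) auto
  moreover have "?x powr (\<kappa> * (y + \<tau>)) = ?x powr (\<kappa> * y) * ?x powr (\<kappa> * \<tau>)"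
    by (simp add: distrib_left powr_add)
  ultimately show ?thesis
    using x by (simp add: maj_wt_def powr_add mult.commute)
qed

lemma maj_wt_add_le:
  assumes "0 \<le> \<kappa>" "0 < r" "0 \<le> y" "0 \<le> \<tau>"
  shows "maj_wt \<kappa> r (y + \<tau>) \<le> r powr \<tau> * maj_wt \<kappa> r y"
proof -
  have "maj_wt \<kappa> r (y + \<tau>) * 1 \<le> maj_wt \<kappa> r (y + \<tau>) * (1 + (y + \<tau>)) powr (\<kappa> * \<tau>)"
    using assms by (intro mult_left_mono maj_wt_nonneg ge_one_powr_ge_zero) auto
  then show ?thesis using maj_wt_add_gain[OF assms] by simp
qed

lemma maj_wt_add_mono:
  assumes "0 \<le> \<kappa>" "0 < r" "r \<le> 1" "0 \<le> y" "0 \<le> \<tau>"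
  shows "maj_wt \<kappa> r (y + \<tau>) \<le> maj_wt \<kappa> r y"
proof -
  have "r powr \<tau> \<le> 1" using assms by (simp add: powr_le1)
  then have "r powr \<tau> * maj_wt \<kappa> r y \<le> 1 * maj_wt \<kappa> r y"
    by (intro mult_right_mono maj_wt_nonneg)
  then show ?thesis using maj_wt_add_le[OF assms(1,2,4,5)] by simp
qed

lemma maj_wt_le_powr:
  assumes "0 \<le> \<kappa>" "0 < r" "r \<le> 1" "0 \<le> \<epsilon>" "\<epsilon> \<le> y"
  shows "maj_wt \<kappa> r y \<le> r powr \<epsilon>"
proof -
  have "maj_wt \<kappa> r y \<le> r powr y"
    using maj_wt_add_le[of \<kappa> r 0 y] assms by (simp add: maj_wt_def)
  also have "\<dots> \<le> r powr \<epsilon>" using assms by (intro powr_mono') auto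
  finally show ?thesis .
qed

lemma maj_wt_mult:
  assumes "0 \<le> \<kappa>" "0 < r" "0 \<le> y1" "0 \<le> y2"
  shows "maj_wt \<kappa> r (y1 + y2) \<le> maj_wt \<kappa> r y1 * maj_wt \<kappa> r y2"
proof -
  let ?x = "1 + (y1 + y2)"
  have "(1 + y1) powr (\<kappa> * y1) * (1 + y2) powr (\<kappa> * y2) \<le> ?x powr (\<kappa> * y1) * ?x powr (\<kappa> * y2)"
    using assms by (intro mult_mono powr_mono2) auto
  also have "\<dots> = ?x powr (\<kappa> * (y1 + y2))"
    by (simp add: distrib_left powr_add)
  finally have "r powr (y1 + y2) / ?x powr (\<kappa> * (y1 + y2))
      \<le> r powr (y1 + y2) / ((1 + y1) powr (\<kappa> * y1) * (1 + y2) powr (\<kappa> * y2))"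
    using assms by (intro divide_left_mono mult_pos_pos) auto
  then show ?thesis by (simp add: maj_wt_def powr_add)
qed

text \<open>
  Exponents are measured from a base point \<open>a\<close>, and only those up to the height \<open>Y\<close> above it count.
\<close>

definition gs_upto :: "real \<Rightarrow> real \<Rightarrow> gen_series \<Rightarrow> complex set"
  where "gs_upto a Y f = {x. gs_coeff f x \<noteq> 0 \<and> Re x - a \<le> Y}"

lemma finite_gs_upto: "finite (gs_upto a Y f)"
proof -
  have "gs_upto a Y f = {x. gs_coeff f x \<noteq> 0 \<and> Re x \<le> a + Y}"
    by (auto simp: gs_upto_def)
  then show ?thesis by (simp add: finite_gs_coeff)
qed

definition gs_wnorm :: "real \<Rightarrow> real \<Rightarrow> real \<Rightarrow> real \<Rightarrow> gen_series \<Rightarrow> real"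
  where "gs_wnorm \<kappa> r a Y f = (\<Sum>x\<in>gs_upto a Y f. cmod (gs_coeff f x) * maj_wt \<kappa> r (Re x - a))"

lemma gs_wnorm_nonneg: "0 \<le> gs_wnorm \<kappa> r a Y f"
  unfolding gs_wnorm_def by (intro sum_nonneg mult_nonneg_nonneg maj_wt_nonneg) auto

lemma gs_wnorm_mono: "Y \<le> Y' \<Longrightarrow> gs_wnorm \<kappa> r a Y f \<le> gs_wnorm \<kappa> r a Y' f"
  unfolding gs_wnorm_def
  by (rule sum_mono2[OF finite_gs_upto]) (auto simp: gs_upto_def intro!: mult_nonneg_nonneg maj_wt_nonneg)

lemma gs_wnorm_mult_le:
  assumes "0 \<le> \<kappa>" "0 < r"
    and f: "\<And>x. gs_coeff f x \<noteq> 0 \<Longrightarrow> a \<le> Re x" and g: "\<And>x. gs_coeff g x \<noteq> 0 \<Longrightarrow> b \<le> Re x"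
  shows "gs_wnorm \<kappa> r (a + b) Y (f * g) \<le> gs_wnorm \<kappa> r a Y f * gs_wnorm \<kappa> r b Y g"
proof -
  have "gs_wnorm \<kappa> r (a + b) Y (f * g) \<le> (\<Sum>x\<in>gs_upto a Y f. \<Sum>y\<in>gs_upto b Y g.
      cmod (gs_coeff f x) * cmod (gs_coeff g y) * maj_wt \<kappa> r (Re (x + y) - (a + b)))"
    unfolding gs_wnorm_def
  proof (rule sum_norm_coeff_times_le[OF finite_gs_upto finite_gs_upto finite_gs_upto maj_wt_nonneg])
    fix x y assume "gs_coeff f x \<noteq> 0" "gs_coeff g y \<noteq> 0" "x + y \<in> gs_upto (a + b) Y (f * g)"
    then show "x \<in> gs_upto a Y f \<and> y \<in> gs_upto b Y g"
      using f[of x] g[of y] by (auto simp: gs_upto_def)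
  qed
  also have "\<dots> \<le> (\<Sum>x\<in>gs_upto a Y f. \<Sum>y\<in>gs_upto b Y g.
      (cmod (gs_coeff f x) * maj_wt \<kappa> r (Re x - a)) * (cmod (gs_coeff g y) * maj_wt \<kappa> r (Re y - b)))"
  proof (intro sum_mono)
    fix x y assume "x \<in> gs_upto a Y f" "y \<in> gs_upto b Y g"
    then have "0 \<le> Re x - a" "0 \<le> Re y - b" using f g by (auto simp: gs_upto_def)
    from maj_wt_mult[OF assms(1,2) this]
    have "maj_wt \<kappa> r (Re (x + y) - (a + b)) \<le> maj_wt \<kappa> r (Re x - a) * maj_wt \<kappa> r (Re y - b)"
      by (simp add: algebra_simps)
    then have "(cmod (gs_coeff f x) * cmod (gs_coeff g y)) * maj_wt \<kappa> r (Re (x + y) - (a + b))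
      \<le> (cmod (gs_coeff f x) * cmod (gs_coeff g y)) * (maj_wt \<kappa> r (Re x - a) * maj_wt \<kappa> r (Re y - b))"
      by (rule mult_left_mono) simp
    then show "cmod (gs_coeff f x) * cmod (gs_coeff g y) * maj_wt \<kappa> r (Re (x + y) - (a + b))
      \<le> (cmod (gs_coeff f x) * maj_wt \<kappa> r (Re x - a)) * (cmod (gs_coeff g y) * maj_wt \<kappa> r (Re y - b))"
      by (simp only: mult_ac)
  qed
  also have "\<dots> = gs_wnorm \<kappa> r a Y f * gs_wnorm \<kappa> r b Y g"
    by (simp add: gs_wnorm_def sum_product)
  finally show ?thesis .
qed

lemma gs_wnorm_add_le:
  "gs_wnorm \<kappa> r a Y (f + g) \<le> gs_wnorm \<kappa> r a Y f + gs_wnorm \<kappa> r a Y g"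
proof -
  let ?S = "gs_upto a Y f \<union> gs_upto a Y g"
  let ?w = "\<lambda>x. maj_wt \<kappa> r (Re x - a)"
  have fin: "finite ?S" by (simp add: finite_gs_upto)
  have ext: "(\<Sum>x\<in>?S. cmod (gs_coeff h x) * ?w x) = gs_wnorm \<kappa> r a Y h" if "h = f \<or> h = g" for h
    unfolding gs_wnorm_def using that fin
    by (intro sum.mono_neutral_right) (auto simp: gs_upto_def)
  have "gs_wnorm \<kappa> r a Y (f + g) \<le> (\<Sum>x\<in>?S. cmod (gs_coeff (f + g) x) * ?w x)"
    unfolding gs_wnorm_def
    by (rule sum_mono2[OF fin])
      (auto simp: gs_upto_def plus_gen_series.rep_eq intro!: mult_nonneg_nonneg maj_wt_nonneg)
  also have "\<dots> \<le> (\<Sum>x\<in>?S. cmod (gs_coeff f x) * ?w x + cmod (gs_coeff g x) * ?w x)"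
    unfolding plus_gen_series.rep_eq distrib_right[symmetric]
    by (intro sum_mono mult_right_mono norm_triangle_ineq maj_wt_nonneg)
  also have "\<dots> = gs_wnorm \<kappa> r a Y f + gs_wnorm \<kappa> r a Y g"
    using ext by (simp add: sum.distrib)
  finally show ?thesis .
qed

lemma gs_wnorm_lower_shift:
  assumes "0 \<le> \<kappa>" "0 < r" "r \<le> 1" "b \<le> a" and f: "\<And>x. gs_coeff f x \<noteq> 0 \<Longrightarrow> a \<le> Re x"
  shows "gs_wnorm \<kappa> r b Y f \<le> gs_wnorm \<kappa> r a Y f"
proof -
  have "gs_wnorm \<kappa> r b Y f \<le> (\<Sum>x\<in>gs_upto b Y f. cmod (gs_coeff f x) * maj_wt \<kappa> r (Re x - a))"
    unfolding gs_wnorm_def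
  proof (intro sum_mono mult_left_mono norm_ge_zero)
    fix x assume "x \<in> gs_upto b Y f"
    then have "0 \<le> Re x - a" using f by (auto simp: gs_upto_def)
    from maj_wt_add_mono[OF assms(1-3) this, of "a - b"] assms(4)
    show "maj_wt \<kappa> r (Re x - b) \<le> maj_wt \<kappa> r (Re x - a)" by simp
  qed
  also have "\<dots> \<le> gs_wnorm \<kappa> r a Y f"
    unfolding gs_wnorm_def using assms(4)
    by (intro sum_mono2 finite_gs_upto)
      (auto simp: gs_upto_def intro!: mult_nonneg_nonneg maj_wt_nonneg)
  finally show ?thesis .
qed

section \<open>Series controlled by the tail of the solution\<close>

text \<open>
  In what follows \<open>\<psi>\<close> is the tail of the formal solution beyond the real part \<open>N\<close>.
\<close>

locale tail_majorant =
  fixes \<kappa> N :: real and m :: nat and \<psi> :: gen_series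
  assumes kappa: "0 \<le> \<kappa>" and N1: "1 \<le> N"
    and tail: "\<And>s. gs_coeff \<psi> s \<noteq> 0 \<Longrightarrow> N < Re s"
begin

definition in_cone :: "real \<Rightarrow> real \<Rightarrow> bool"
  where "in_cone K Y \<longleftrightarrow> (\<forall>s. gs_coeff \<psi> s \<noteq> 0 \<longrightarrow> Re s - N \<le> Y \<longrightarrow> \<bar>Im s\<bar> \<le> K * (Re s - N))"

definition tail_norm :: "real \<Rightarrow> real \<Rightarrow> real"
  where "tail_norm r Y = gs_wnorm \<kappa> r N Y ((gs_delta ^^ m) \<psi>)"

text \<open>
  Polynomial expressions of order at least \<open>a / N\<close> in the \<open>\<delta>\<^sup>i \<psi>\<close>, with coefficients of finite support in the half plane
  \<open>Re x \<ge> 0\<close>, have three properties, each stable under products when the base points are added. The constants \<open>M\<close> and \<open>C\<close> must not depend on \<open>K\<close>, \<open>r\<close> and \<open>Y\<close>, because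
  \<open>K\<close> and \<open>r\<close> are chosen afterwards and \<open>Y\<close> is the induction parameter.
\<close>

definition controlled :: "real \<Rightarrow> gen_series \<Rightarrow> bool"
  where "controlled a T \<longleftrightarrow> (\<forall>x. gs_coeff T x \<noteq> 0 \<longrightarrow> a \<le> Re x) \<and>
    (\<exists>M. \<forall>K\<ge>0. \<forall>Y. in_cone K Y \<longrightarrow>
      (\<forall>x. gs_coeff T x \<noteq> 0 \<longrightarrow> Re x - a \<le> Y \<longrightarrow> \<bar>Im x\<bar> \<le> M + K * (Re x - a))) \<and>
    (\<exists>C. \<forall>r Y. 0 < r \<longrightarrow> r \<le> 1 \<longrightarrow> tail_norm r Y \<le> 1 \<longrightarrow> gs_wnorm \<kappa> r a Y T \<le> C)"

lemma controlledI:
  assumes "\<And>x. gs_coeff T x \<noteq> 0 \<Longrightarrow> a \<le> Re x"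
    and "\<And>K Y x. 0 \<le> K \<Longrightarrow> in_cone K Y \<Longrightarrow> gs_coeff T x \<noteq> 0 \<Longrightarrow> Re x - a \<le> Y \<Longrightarrow>
      \<bar>Im x\<bar> \<le> M + K * (Re x - a)"
    and "\<And>r Y. 0 < r \<Longrightarrow> r \<le> 1 \<Longrightarrow> tail_norm r Y \<le> 1 \<Longrightarrow> gs_wnorm \<kappa> r a Y T \<le> C"
  shows "controlled a T"
  unfolding controlled_def using assms by blast

lemma controlledE:
  assumes "controlled a T"
  obtains M C where "\<And>x. gs_coeff T x \<noteq> 0 \<Longrightarrow> a \<le> Re x"
    and "\<And>K Y x. 0 \<le> K \<Longrightarrow> in_cone K Y \<Longrightarrow> gs_coeff T x \<noteq> 0 \<Longrightarrow> Re x - a \<le> Y \<Longrightarrow>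
      \<bar>Im x\<bar> \<le> M + K * (Re x - a)"
    and "\<And>r Y. 0 < r \<Longrightarrow> r \<le> 1 \<Longrightarrow> tail_norm r Y \<le> 1 \<Longrightarrow> gs_wnorm \<kappa> r a Y T \<le> C"
  using assms unfolding controlled_def by blast

lemma controlled_add:
  assumes "controlled a f" "controlled a g"
  shows "controlled a (f + g)"
proof -
  from assms(1) obtain M C where f: "\<And>x. gs_coeff f x \<noteq> 0 \<Longrightarrow> a \<le> Re x"
    "\<And>K Y x. 0 \<le> K \<Longrightarrow> in_cone K Y \<Longrightarrow> gs_coeff f x \<noteq> 0 \<Longrightarrow> Re x - a \<le> Y \<Longrightarrow> \<bar>Im x\<bar> \<le> M + K * (Re x - a)"
    "\<And>r Y. 0 < r \<Longrightarrow> r \<le> 1 \<Longrightarrow> tail_norm r Y \<le> 1 \<Longrightarrow> gs_wnorm \<kappa> r a Y f \<le> C"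
    by (rule controlledE) blast
  from assms(2) obtain M' C' where g: "\<And>x. gs_coeff g x \<noteq> 0 \<Longrightarrow> a \<le> Re x"
    "\<And>K Y x. 0 \<le> K \<Longrightarrow> in_cone K Y \<Longrightarrow> gs_coeff g x \<noteq> 0 \<Longrightarrow> Re x - a \<le> Y \<Longrightarrow> \<bar>Im x\<bar> \<le> M' + K * (Re x - a)"
    "\<And>r Y. 0 < r \<Longrightarrow> r \<le> 1 \<Longrightarrow> tail_norm r Y \<le> 1 \<Longrightarrow> gs_wnorm \<kappa> r a Y g \<le> C'"
    by (rule controlledE) blast
  have nz: "gs_coeff f x \<noteq> 0 \<or> gs_coeff g x \<noteq> 0" if "gs_coeff (f + g) x \<noteq> 0" for x
    using that by (auto simp: plus_gen_series.rep_eq)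
  show ?thesis
  proof (rule controlledI)
    show "a \<le> Re x" if "gs_coeff (f + g) x \<noteq> 0" for x
      using nz[OF that] f(1) g(1) by blast
    show "\<bar>Im x\<bar> \<le> max M M' + K * (Re x - a)"
      if "0 \<le> K" "in_cone K Y" "gs_coeff (f + g) x \<noteq> 0" "Re x - a \<le> Y" for K Y x
      using nz[OF that(3)] f(2)[OF that(1,2) _ that(4)] g(2)[OF that(1,2) _ that(4)] by fastforce
    show "gs_wnorm \<kappa> r a Y (f + g) \<le> C + C'" if "0 < r" "r \<le> 1" "tail_norm r Y \<le> 1" for r Y
      using gs_wnorm_add_le[of \<kappa> r a Y f g] f(3)[OF that] g(3)[OF that] by simp
  qed
qed

lemma controlled_mult:
  assumes "controlled a f" "controlled b g"
  shows "controlled (a + b) (f * g)"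
proof -
  from assms(1) obtain M C where f: "\<And>x. gs_coeff f x \<noteq> 0 \<Longrightarrow> a \<le> Re x"
    "\<And>K Y x. 0 \<le> K \<Longrightarrow> in_cone K Y \<Longrightarrow> gs_coeff f x \<noteq> 0 \<Longrightarrow> Re x - a \<le> Y \<Longrightarrow> \<bar>Im x\<bar> \<le> M + K * (Re x - a)"
    "\<And>r Y. 0 < r \<Longrightarrow> r \<le> 1 \<Longrightarrow> tail_norm r Y \<le> 1 \<Longrightarrow> gs_wnorm \<kappa> r a Y f \<le> C"
    by (rule controlledE) blast
  from assms(2) obtain M' C' where g: "\<And>x. gs_coeff g x \<noteq> 0 \<Longrightarrow> b \<le> Re x"
    "\<And>K Y x. 0 \<le> K \<Longrightarrow> in_cone K Y \<Longrightarrow> gs_coeff g x \<noteq> 0 \<Longrightarrow> Re x - b \<le> Y \<Longrightarrow> \<bar>Im x\<bar> \<le> M' + K * (Re x - b)"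
    "\<And>r Y. 0 < r \<Longrightarrow> r \<le> 1 \<Longrightarrow> tail_norm r Y \<le> 1 \<Longrightarrow> gs_wnorm \<kappa> r b Y g \<le> C'"
    by (rule controlledE) blast
  show ?thesis
  proof (rule controlledI)
    show "a + b \<le> Re x" if nz: "gs_coeff (f * g) x \<noteq> 0" for x
    proof -
      obtain u v where "gs_coeff f u \<noteq> 0" "gs_coeff g v \<noteq> 0" "x = u + v"
        using gs_coeff_times_nonzeroE[OF nz] .
      then show ?thesis using f(1)[of u] g(1)[of v] by simp
    qed
    show "\<bar>Im x\<bar> \<le> (M + M') + K * (Re x - (a + b))"
      if K: "0 \<le> K" "in_cone K Y" and x: "gs_coeff (f * g) x \<noteq> 0" "Re x - (a + b) \<le> Y" for K Y x
    proof -
      obtain u v where uv: "gs_coeff f u \<noteq> 0" "gs_coeff g v \<noteq> 0" "x = u + v"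
        using gs_coeff_times_nonzeroE[OF x(1)] .
      have "Re u - a \<le> Y" "Re v - b \<le> Y" using f(1)[of u] g(1)[of v] uv x(2) by auto
      then have "\<bar>Im u\<bar> + \<bar>Im v\<bar> \<le> (M + K * (Re u - a)) + (M' + K * (Re v - b))"
        using f(2)[OF K uv(1)] g(2)[OF K uv(2)] by simp
      also have "\<dots> = (M + M') + K * (Re x - (a + b))"
        by (simp add: uv(3) algebra_simps)
      finally show ?thesis by (simp add: uv(3))
    qed
    show "gs_wnorm \<kappa> r (a + b) Y (f * g) \<le> C * C'" if "0 < r" "r \<le> 1" "tail_norm r Y \<le> 1" for r Y
    proof -
      have "gs_wnorm \<kappa> r (a + b) Y (f * g) \<le> gs_wnorm \<kappa> r a Y f * gs_wnorm \<kappa> r b Y g"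
        by (rule gs_wnorm_mult_le[OF kappa that(1) f(1) g(1)])
      also have "\<dots> \<le> C * C'"
        using f(3)[OF that] g(3)[OF that] gs_wnorm_nonneg[of \<kappa> r a Y f]
        by (intro mult_mono gs_wnorm_nonneg) auto
      finally show ?thesis .
    qed
  qed
qed

lemma controlled_mono:
  assumes "controlled a f" "b \<le> a"
  shows "controlled b f"
proof -
  from assms(1) obtain M C where f: "\<And>x. gs_coeff f x \<noteq> 0 \<Longrightarrow> a \<le> Re x"
    "\<And>K Y x. 0 \<le> K \<Longrightarrow> in_cone K Y \<Longrightarrow> gs_coeff f x \<noteq> 0 \<Longrightarrow> Re x - a \<le> Y \<Longrightarrow> \<bar>Im x\<bar> \<le> M + K * (Re x - a)"
    "\<And>r Y. 0 < r \<Longrightarrow> r \<le> 1 \<Longrightarrow> tail_norm r Y \<le> 1 \<Longrightarrow> gs_wnorm \<kappa> r a Y f \<le> C"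
    by (rule controlledE) blast
  show ?thesis
  proof (rule controlledI)
    show "b \<le> Re x" if "gs_coeff f x \<noteq> 0" for x using f(1)[OF that] assms(2) by simp
    show "\<bar>Im x\<bar> \<le> M + K * (Re x - b)"
      if "0 \<le> K" "in_cone K Y" "gs_coeff f x \<noteq> 0" "Re x - b \<le> Y" for K Y x
    proof -
      have "\<bar>Im x\<bar> \<le> M + K * (Re x - a)" using f(2)[OF that(1-3)] that(4) assms(2) by simp
      also have "\<dots> \<le> M + K * (Re x - b)" using that(1) assms(2) by (simp add: mult_left_mono)
      finally show ?thesis .
    qed
    show "gs_wnorm \<kappa> r b Y f \<le> C" if "0 < r" "r \<le> 1" "tail_norm r Y \<le> 1" for r Y
      using gs_wnorm_lower_shift[of \<kappa> r b a f Y, OF kappa that(1,2) assms(2) f(1)] f(3)[OF that] by simp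
  qed
qed

lemma controlled_finite:
  assumes fin: "finite {x. gs_coeff f x \<noteq> 0}" and low: "\<And>x. gs_coeff f x \<noteq> 0 \<Longrightarrow> 0 \<le> Re x"
  shows "controlled 0 f"
proof (rule controlledI)
  let ?S = "{x. gs_coeff f x \<noteq> 0}"
  show "\<bar>Im x\<bar> \<le> (\<Sum>x\<in>?S. \<bar>Im x\<bar>) + K * (Re x - 0)"
    if "0 \<le> K" "gs_coeff f x \<noteq> 0" for K x
  proof -
    have "\<bar>Im x\<bar> \<le> (\<Sum>x\<in>?S. \<bar>Im x\<bar>)"
      using that fin by (intro member_le_sum) auto
    then show ?thesis using that(1) low[OF that(2)] by (simp add: add_increasing2)
  qed
  show "gs_wnorm \<kappa> r 0 Y f \<le> (\<Sum>x\<in>?S. cmod (gs_coeff f x))" if "0 < r" "r \<le> 1" for r Y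
  proof -
    have "gs_wnorm \<kappa> r 0 Y f \<le> (\<Sum>x\<in>gs_upto 0 Y f. cmod (gs_coeff f x) * 1)"
      unfolding gs_wnorm_def
    proof (intro sum_mono mult_left_mono norm_ge_zero)
      fix x assume "x \<in> gs_upto 0 Y f"
      then show "maj_wt \<kappa> r (Re x - 0) \<le> 1"
        using maj_wt_le_powr[OF kappa that, of 0 "Re x"] low that by (auto simp: gs_upto_def)
    qed
    also have "\<dots> \<le> (\<Sum>x\<in>?S. cmod (gs_coeff f x))"
      using fin by (simp, intro sum_mono2) (auto simp: gs_upto_def)
    finally show ?thesis .
  qed
qed (use low in auto)

lemma norm_ge_1:
  assumes "gs_coeff \<psi> s \<noteq> 0"
  shows "1 \<le> cmod s"
  using tail[OF assms] N1 abs_Re_le_cmod[of s] by linarith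

lemma gs_coeff_delta_tail: "gs_coeff ((gs_delta ^^ i) \<psi>) s \<noteq> 0 \<longleftrightarrow> gs_coeff \<psi> s \<noteq> 0"
  using norm_ge_1[of s] by (auto simp: gs_coeff_delta_funpow)

lemma gs_upto_delta_tail: "gs_upto a Y ((gs_delta ^^ i) \<psi>) = gs_upto a Y \<psi>"
  by (simp add: gs_upto_def gs_coeff_delta_tail)

lemma tail_norm_eq: "tail_norm r Y
    = (\<Sum>s\<in>gs_upto N Y \<psi>. cmod s ^ m * cmod (gs_coeff \<psi> s) * maj_wt \<kappa> r (Re s - N))"
  by (simp add: tail_norm_def gs_wnorm_def gs_upto_delta_tail gs_coeff_delta_funpow norm_mult norm_power)

lemma controlled_delta:
  assumes "i \<le> m"
  shows "controlled N ((gs_delta ^^ i) \<psi>)"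
proof (rule controlledI)
  show "N \<le> Re x" if "gs_coeff ((gs_delta ^^ i) \<psi>) x \<noteq> 0" for x
    using that tail[of x] by (simp add: gs_coeff_delta_tail)
  show "\<bar>Im x\<bar> \<le> 0 + K * (Re x - N)"
    if "in_cone K Y" "gs_coeff ((gs_delta ^^ i) \<psi>) x \<noteq> 0" "Re x - N \<le> Y" for K Y x
    using that by (simp add: gs_coeff_delta_tail in_cone_def)
  show "gs_wnorm \<kappa> r N Y ((gs_delta ^^ i) \<psi>) \<le> 1" if "tail_norm r Y \<le> 1" for r Y
  proof -
    have "gs_wnorm \<kappa> r N Y ((gs_delta ^^ i) \<psi>) \<le> tail_norm r Y"
      unfolding tail_norm_eq gs_wnorm_def gs_upto_delta_tail gs_coeff_delta_funpow norm_mult norm_power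
      using norm_ge_1 assms
      by (intro sum_mono mult_right_mono maj_wt_nonneg power_increasing) (auto simp: gs_upto_def)
    then show ?thesis using that by simp
  qed
qed

text \<open>
  Thus the Taylor remainder at \<open>P\<close> is controlled from \<open>N + N\<close>.
\<close>

lemma ring_filtration_controlled:
  "ring_filtration {T. controlled 0 T} {T. controlled N T} {T. controlled (N + N) T}"
proof
  have "controlled 0 1"
    by (rule controlled_finite)
      (auto simp: one_gen_series_def gs_monom.rep_eq intro: finite_subset[of _ "{0}"] split: if_splits)
  then show "1 \<in> {T. controlled 0 T}" by simp
  have "controlled (N + N) 0"
    by (rule controlledI[of _ _ 0 0]) (auto simp: zero_gen_series.rep_eq gs_wnorm_def)
  then show "0 \<in> {T. controlled (N + N) T}" by simp
  show "{T. controlled N T} \<subseteq> {T. controlled 0 T}" "{T. controlled (N + N) T} \<subseteq> {T. controlled N T}"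
    using N1 by (auto elim!: controlled_mono)
qed (use controlled_mult[of 0 _ 0] controlled_mult[of 0 _ N] controlled_mult[of 0 _ "N + N"]
    controlled_mult[of N _ N] in \<open>auto intro: controlled_add\<close>)

end

section \<open>The recurrence and the bootstrap\<close>

lemma linear_domination_exists:
  fixes u v :: "'a \<Rightarrow> real"
  assumes "finite S" "\<And>x. x \<in> S \<Longrightarrow> 0 < u x"
  shows "\<exists>K\<ge>0. \<forall>x\<in>S. \<bar>v x\<bar> \<le> K * u x"
proof (intro exI[of _ "\<Sum>x\<in>S. \<bar>v x\<bar> / u x"] conjI ballI)
  show "0 \<le> (\<Sum>x\<in>S. \<bar>v x\<bar> / u x)"
    using assms(2) by (intro sum_nonneg) (simp add: less_imp_le)
  fix x assume x: "x \<in> S"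
  have "\<bar>v x\<bar> / u x \<le> (\<Sum>x\<in>S. \<bar>v x\<bar> / u x)"
    using assms x by (intro member_le_sum) (auto simp: less_imp_le)
  then show "\<bar>v x\<bar> \<le> (\<Sum>x\<in>S. \<bar>v x\<bar> / u x) * u x"
    using assms(2)[OF x] by (simp add: pos_divide_le_eq)
qed

lemma step_induct:
  fixes P :: "real \<Rightarrow> bool"
  assumes "0 < \<epsilon>" "P 0" and step: "\<And>Y. P Y \<Longrightarrow> P (Y + \<epsilon>)"
    and anti: "\<And>Y Y'. P Y \<Longrightarrow> Y' \<le> Y \<Longrightarrow> P Y'"
  shows "P Y"
proof -
  have "P (real n * \<epsilon>)" for n
  proof (induction n)
    case (Suc n)
    from step[OF this] show ?case by (simp add: algebra_simps)
  qed (use assms(2) in simp)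
  moreover obtain n where "Y < real n * \<epsilon>"
    using reals_Archimedean3[OF assms(1)] by blast
  ultimately show ?thesis using anti by (meson less_imp_le)
qed

text \<open>
  The recurrence for the coefficients of \<open>\<psi>\<close>, with sources \<open>D\<close> (free of \<open>\<psi>\<close>), \<open>B i\<close> (linear) and \<open>T\<close> (of second order).
  The number \<open>\<epsilon>\<close> bounds all the shifts from below, while \<open>gainB\<close> and \<open>gainN\<close> say that the shifts pay for
  the powers that are lost because \<open>L\<close> has degree \<open>p\<close> only.
\<close>

locale tail_recurrence = tail_majorant +
  fixes p :: nat and lam :: complex and L :: "complex \<Rightarrow> complex" and d \<epsilon> :: real
    and D T :: gen_series and B :: "nat \<Rightarrow> gen_series"
  assumes p: "p \<le> m" and d: "0 < d" and eps: "0 < \<epsilon>"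
    and L: "\<And>s. N < Re s \<Longrightarrow> d * cmod s ^ p \<le> cmod (L s)"
    and recurrence: "\<And>s. L s * gs_coeff \<psi> s = - (gs_coeff D (s + lam)
      + (\<Sum>i\<le>m. gs_coeff (B i * (gs_delta ^^ i) \<psi>) (s + lam)) + gs_coeff T (s + lam))"
    and finD: "finite {x. gs_coeff D x \<noteq> 0}"
    and finB: "\<And>i. i \<le> m \<Longrightarrow> finite {x. gs_coeff (B i) x \<noteq> 0}"
    and epsD: "\<And>x. gs_coeff D x \<noteq> 0 \<Longrightarrow> N < Re x - Re lam \<Longrightarrow> \<epsilon> \<le> Re x - Re lam - N"
    and epsB: "\<And>i t. i \<le> m \<Longrightarrow> gs_coeff (B i) t \<noteq> 0 \<Longrightarrow> \<epsilon> \<le> Re t - Re lam"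
    and gainB: "\<And>i t. i \<le> m \<Longrightarrow> gs_coeff (B i) t \<noteq> 0 \<Longrightarrow> real i - real p \<le> \<kappa> * (Re t - Re lam)"
    and T: "controlled (N + N) T"
    and epsN: "\<epsilon> \<le> N - Re lam"
    and gainN: "real m - real p \<le> \<kappa> * (N - Re lam)"
begin

lemma L_nonzero: "N < Re s \<Longrightarrow> L s \<noteq> 0"
proof
  assume s: "N < Re s" and "L s = 0"
  then have "d * cmod s ^ p \<le> 0" using L[OF s] by simp
  moreover have "s \<noteq> 0" using s N1 by auto
  then have "0 < d * cmod s ^ p" using d by simp
  ultimately show False by simp
qed

lemma source_cases:
  assumes "gs_coeff \<psi> s \<noteq> 0"
  obtains "gs_coeff D (s + lam) \<noteq> 0"
    | i t b where "i \<le> m" "gs_coeff (B i) t \<noteq> 0" "gs_coeff \<psi> b \<noteq> 0" "s + lam = t + b"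
    | "gs_coeff T (s + lam) \<noteq> 0"
proof -
  have "L s * gs_coeff \<psi> s \<noteq> 0" using assms L_nonzero[OF tail[OF assms]] by simp
  then have "gs_coeff D (s + lam) \<noteq> 0 \<or> (\<exists>i\<le>m. gs_coeff (B i * (gs_delta ^^ i) \<psi>) (s + lam) \<noteq> 0)
      \<or> gs_coeff T (s + lam) \<noteq> 0"
    unfolding recurrence by (metis (no_types, lifting) add.right_neutral atMost_iff neg_equal_0_iff_equal sum.neutral)
  then show ?thesis
    using that by (metis gs_coeff_delta_tail gs_coeff_times_nonzeroE)
qed

text \<open>
  Sources with a positive shift \<open>\<tau>\<close> in real part move the imaginary part by at most \<open>K \<tau>\<close> for large \<open>K\<close>: for \<open>D\<close> and \<open>B i\<close> there are
  finitely many shifts, and for \<open>T\<close> the shift \<open>N - Re lam\<close> has to pay for the constant \<open>M\<close>, which is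
  independent of \<open>K\<close>.
\<close>

lemma cone_exists: "\<exists>K\<ge>0. \<forall>Y. in_cone K Y"
proof -
  obtain K1 where K1: "0 \<le> K1"
    "\<forall>x\<in>{x. gs_coeff D x \<noteq> 0 \<and> N < Re x - Re lam}. \<bar>Im x - Im lam\<bar> \<le> K1 * (Re x - Re lam - N)"
    using linear_domination_exists[of "{x. gs_coeff D x \<noteq> 0 \<and> N < Re x - Re lam}"
        "\<lambda>x. Re x - Re lam - N" "\<lambda>x. Im x - Im lam"] finD by auto
  obtain K2 where K2: "0 \<le> K2"
    "\<forall>t\<in>(\<Union>i\<le>m. {t. gs_coeff (B i) t \<noteq> 0}). \<bar>Im t - Im lam\<bar> \<le> K2 * (Re t - Re lam)"
    using linear_domination_exists[of "\<Union>i\<le>m. {t. gs_coeff (B i) t \<noteq> 0}"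
        "\<lambda>t. Re t - Re lam" "\<lambda>t. Im t - Im lam"] finB epsB eps by fastforce
  from T obtain M where M: "\<And>x. gs_coeff T x \<noteq> 0 \<Longrightarrow> N + N \<le> Re x"
    "\<And>K Y x. 0 \<le> K \<Longrightarrow> in_cone K Y \<Longrightarrow> gs_coeff T x \<noteq> 0 \<Longrightarrow> Re x - (N + N) \<le> Y \<Longrightarrow>
      \<bar>Im x\<bar> \<le> M + K * (Re x - (N + N))"
    by (rule controlledE) blast
  define K3 where "K3 = (\<bar>M\<bar> + \<bar>Im lam\<bar>) / (N - Re lam)"
  have NL: "0 < N - Re lam" using epsN eps by simp
  have K3: "0 \<le> K3" "M + \<bar>Im lam\<bar> \<le> K3 * (N - Re lam)" using NL by (auto simp: K3_def)
  define K where "K = K1 + K2 + K3"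
  have K: "0 \<le> K" "K1 \<le> K" "K2 \<le> K" "K3 \<le> K" using K1(1) K2(1) K3(1) by (auto simp: K_def)
  have "in_cone K (Y + \<epsilon>)" if Y: "in_cone K Y" for Y
    unfolding in_cone_def
  proof (intro allI impI)
    fix s assume s: "gs_coeff \<psi> s \<noteq> 0" "Re s - N \<le> Y + \<epsilon>"
    from s(1) show "\<bar>Im s\<bar> \<le> K * (Re s - N)"
    proof (cases rule: source_cases)
      case 1
      then have "\<bar>Im s\<bar> \<le> K1 * (Re s - N)"
        using K1(2)[rule_format, of "s + lam"] tail[OF s(1)] by simp
      also have "\<dots> \<le> K * (Re s - N)" using K tail[OF s(1)] by (intro mult_right_mono) auto
      finally show ?thesis .
    next
      case (2 i t b)
      have t: "\<epsilon> \<le> Re t - Re lam" using epsB 2 by blast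
      have sb: "s = (t - lam) + b" using 2(4) by (simp add: algebra_simps)
      have "\<bar>Im t - Im lam\<bar> \<le> K2 * (Re t - Re lam)" using K2(2) 2 by blast
      also have "\<dots> \<le> K * (Re t - Re lam)" using K t eps by (intro mult_right_mono) auto
      finally have "\<bar>Im t - Im lam\<bar> \<le> K * (Re t - Re lam)" .
      moreover have "\<bar>Im b\<bar> \<le> K * (Re b - N)"
        using Y 2(3) s(2) t sb by (auto simp: in_cone_def)
      ultimately have "\<bar>Im s\<bar> \<le> K * (Re t - Re lam) + K * (Re b - N)" by (simp add: sb)
      then show ?thesis by (simp add: sb algebra_simps)
    next
      case 3
      have "\<bar>Im (s + lam)\<bar> \<le> M + K * (Re (s + lam) - (N + N))"
        using M(2)[OF K(1) Y 3] s(2) epsN by simp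
      then have "\<bar>Im s\<bar> \<le> (M + \<bar>Im lam\<bar>) + K * (Re (s + lam) - (N + N))" by simp
      also have "\<dots> \<le> K * (N - Re lam) + K * (Re (s + lam) - (N + N))"
        using order.trans[OF K3(2) mult_right_mono[OF K(4), of "N - Re lam"]] NL by simp
      also have "\<dots> = K * (Re s - N)" by (simp add: algebra_simps)
      finally show ?thesis .
    qed
  qed
  moreover have "in_cone K 0" using tail by (fastforce simp: in_cone_def)
  moreover have "in_cone K Y'" if "in_cone K Y" "Y' \<le> Y" for Y Y'
    using that by (auto simp: in_cone_def)
  ultimately have "in_cone K Y" for Y using step_induct[OF eps, of "in_cone K" Y] by blast
  then show ?thesis using K(1) by blast
qed

lemma real_power_le_powr:
  fixes x a :: real
  assumes "1 \<le> x" "real n \<le> a"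
  shows "x ^ n \<le> x powr a"
  using assms powr_mono[of "real n" a x] by (simp add: powr_realpow)

lemma source_D:
  "\<exists>C. \<forall>r Y. 0 < r \<longrightarrow> r \<le> 1 \<longrightarrow> (\<Sum>s\<in>gs_upto N Y \<psi>. cmod s ^ (m - p)
    * cmod (gs_coeff D (s + lam)) * maj_wt \<kappa> r (Re s - N)) \<le> C * r powr \<epsilon>"
proof (intro exI allI impI)
  let ?g = "\<lambda>x. cmod (x - lam) ^ (m - p) * cmod (gs_coeff D x)"
  fix r Y :: real assume r: "0 < r" "r \<le> 1"
  let ?S = "gs_upto N Y \<psi>" and ?S' = "{s \<in> gs_upto N Y \<psi>. gs_coeff D (s + lam) \<noteq> 0}"
  have "(\<Sum>s\<in>?S. cmod s ^ (m - p) * cmod (gs_coeff D (s + lam)) * maj_wt \<kappa> r (Re s - N))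
      = (\<Sum>s\<in>?S'. cmod s ^ (m - p) * cmod (gs_coeff D (s + lam)) * maj_wt \<kappa> r (Re s - N))"
    by (rule sum.mono_neutral_right) (auto simp: finite_gs_upto)
  also have "\<dots> \<le> (\<Sum>s\<in>?S'. ?g (s + lam) * r powr \<epsilon>)"
  proof (rule sum_mono)
    fix s assume s: "s \<in> ?S'"
    then have "\<epsilon> \<le> Re s - N"
      using epsD[of "s + lam"] tail[of s] by (auto simp: gs_upto_def)
    then have "maj_wt \<kappa> r (Re s - N) \<le> r powr \<epsilon>"
      using maj_wt_le_powr kappa r eps by simp
    then show "cmod s ^ (m - p) * cmod (gs_coeff D (s + lam)) * maj_wt \<kappa> r (Re s - N)
        \<le> ?g (s + lam) * r powr \<epsilon>"
      by (simp add: mult_left_mono)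
  qed
  also have "\<dots> = (\<Sum>x\<in>(\<lambda>s. s + lam) ` ?S'. ?g x) * r powr \<epsilon>"
    by (simp add: sum.reindex inj_on_def sum_distrib_right)
  also have "\<dots> \<le> (\<Sum>x | gs_coeff D x \<noteq> 0. ?g x) * r powr \<epsilon>"
    by (intro mult_right_mono sum_mono2 finD) auto
  finally show "(\<Sum>s\<in>?S. cmod s ^ (m - p) * cmod (gs_coeff D (s + lam)) * maj_wt \<kappa> r (Re s - N))
      \<le> (\<Sum>x | gs_coeff D x \<noteq> 0. ?g x) * r powr \<epsilon>" .
qed

text \<open>
  The factor \<open>cmod s ^ (m - p)\<close> is what remains of \<open>cmod s ^ m\<close>, the weight of the norm, after division by \<open>L s\<close>.
  The exponent \<open>s + lam\<close> has height \<open>y - (N - Re lam)\<close> above \<open>N + N\<close>, if \<open>s\<close> has height \<open>y\<close> above \<open>N\<close>; this difference pays for the factor.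
\<close>

lemma source_T:
  assumes K: "\<And>s. gs_coeff \<psi> s \<noteq> 0 \<Longrightarrow> cmod s \<le> K * (1 + (Re s - N))"
  shows "\<exists>C. \<forall>r Y. 0 < r \<longrightarrow> r \<le> 1 \<longrightarrow> tail_norm r Y \<le> 1 \<longrightarrow>
    (\<Sum>s\<in>gs_upto N (Y + \<epsilon>) \<psi>. cmod s ^ (m - p)
      * cmod (gs_coeff T (s + lam)) * maj_wt \<kappa> r (Re s - N)) \<le> C * r powr \<epsilon>"
proof -
  define \<tau> where "\<tau> = N - Re lam"
  have tau: "0 \<le> \<tau>" "\<epsilon> \<le> \<tau>" using eps epsN by (auto simp: \<tau>_def)
  from T obtain C where T': "\<And>x. gs_coeff T x \<noteq> 0 \<Longrightarrow> N + N \<le> Re x"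
    "\<And>r Y. 0 < r \<Longrightarrow> r \<le> 1 \<Longrightarrow> tail_norm r Y \<le> 1 \<Longrightarrow> gs_wnorm \<kappa> r (N + N) Y T \<le> C"
    by (rule controlledE) blast
  show ?thesis
  proof (intro exI allI impI)
    fix r Y assume r: "0 < r" "r \<le> 1" and Y: "tail_norm r Y \<le> 1"
    let ?S = "gs_upto N (Y + \<epsilon>) \<psi>"
    let ?S' = "{s \<in> ?S. gs_coeff T (s + lam) \<noteq> 0}"
    let ?h = "\<lambda>x. cmod (gs_coeff T x) * maj_wt \<kappa> r (Re x - (N + N))"
    have rpow: "r powr \<tau> \<le> r powr \<epsilon>" using r tau by (intro powr_mono') auto
    have "(\<Sum>s\<in>?S. cmod s ^ (m - p) * cmod (gs_coeff T (s + lam)) * maj_wt \<kappa> r (Re s - N))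
        = (\<Sum>s\<in>?S'. cmod s ^ (m - p) * cmod (gs_coeff T (s + lam)) * maj_wt \<kappa> r (Re s - N))"
      by (rule sum.mono_neutral_right) (auto simp: finite_gs_upto)
    also have "\<dots> \<le> (\<Sum>s\<in>?S'. \<bar>K\<bar> ^ (m - p) * r powr \<epsilon> * ?h (s + lam))"
    proof (rule sum_mono)
      fix s assume s: "s \<in> ?S'"
      define y where "y = Re (s + lam) - (N + N)"
      have y: "0 \<le> y" "Re s - N = y + \<tau>" using T'(1)[of "s + lam"] s by (auto simp: y_def \<tau>_def)
      have "cmod s \<le> \<bar>K\<bar> * (1 + (y + \<tau>))"
      proof -
        have "cmod s \<le> K * (1 + (y + \<tau>))" using K[of s] s y(2) by (simp add: gs_upto_def)
        also have "\<dots> \<le> \<bar>K\<bar> * (1 + (y + \<tau>))" using y tau by (intro mult_right_mono) auto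
        finally show ?thesis .
      qed
      then have "cmod s ^ (m - p) \<le> \<bar>K\<bar> ^ (m - p) * (1 + (y + \<tau>)) ^ (m - p)"
        using power_mono[of "cmod s" "\<bar>K\<bar> * (1 + (y + \<tau>))"] by (simp add: power_mult_distrib)
      also have "\<dots> \<le> \<bar>K\<bar> ^ (m - p) * (1 + (y + \<tau>)) powr (\<kappa> * \<tau>)"
        using y tau p gainN by (intro mult_left_mono real_power_le_powr) (auto simp: \<tau>_def of_nat_diff)
      finally have "cmod s ^ (m - p) * maj_wt \<kappa> r (y + \<tau>)
          \<le> \<bar>K\<bar> ^ (m - p) * (1 + (y + \<tau>)) powr (\<kappa> * \<tau>) * maj_wt \<kappa> r (y + \<tau>)"
        by (intro mult_right_mono maj_wt_nonneg)
      also have "\<dots> = \<bar>K\<bar> ^ (m - p) * (maj_wt \<kappa> r (y + \<tau>) * (1 + (y + \<tau>)) powr (\<kappa> * \<tau>))"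
        by (simp only: mult_ac)
      also have "\<dots> \<le> \<bar>K\<bar> ^ (m - p) * (r powr \<tau> * maj_wt \<kappa> r y)"
        using maj_wt_add_gain[OF kappa r(1) y(1) tau(1)] by (intro mult_left_mono) auto
      also have "\<dots> \<le> \<bar>K\<bar> ^ (m - p) * (r powr \<epsilon> * maj_wt \<kappa> r y)"
        using rpow by (intro mult_left_mono mult_right_mono maj_wt_nonneg) auto
      finally have "cmod (gs_coeff T (s + lam)) * (cmod s ^ (m - p) * maj_wt \<kappa> r (y + \<tau>))
          \<le> cmod (gs_coeff T (s + lam)) * (\<bar>K\<bar> ^ (m - p) * (r powr \<epsilon> * maj_wt \<kappa> r y))"
        by (intro mult_left_mono) auto
      then show "cmod s ^ (m - p) * cmod (gs_coeff T (s + lam)) * maj_wt \<kappa> r (Re s - N)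
          \<le> \<bar>K\<bar> ^ (m - p) * r powr \<epsilon> * ?h (s + lam)"
        unfolding y(2) y_def[symmetric] by (simp only: mult_ac)
    qed
    also have "\<dots> = \<bar>K\<bar> ^ (m - p) * r powr \<epsilon> * (\<Sum>x\<in>(\<lambda>s. s + lam) ` ?S'. ?h x)"
      by (simp add: sum.reindex inj_on_def sum_distrib_left)
    also have "\<dots> \<le> \<bar>K\<bar> ^ (m - p) * r powr \<epsilon> * gs_wnorm \<kappa> r (N + N) Y T"
      unfolding gs_wnorm_def using epsN
      by (intro mult_left_mono sum_mono2 finite_gs_upto mult_nonneg_nonneg maj_wt_nonneg)
        (auto simp: gs_upto_def)
    also have "\<dots> \<le> \<bar>K\<bar> ^ (m - p) * r powr \<epsilon> * C"
      using T'(2)[OF r Y] by (intro mult_left_mono) auto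
    finally show "(\<Sum>s\<in>?S. cmod s ^ (m - p) * cmod (gs_coeff T (s + lam)) * maj_wt \<kappa> r (Re s - N))
        \<le> \<bar>K\<bar> ^ (m - p) * C * r powr \<epsilon>"
      by (simp only: mult_ac)
  qed
qed

text \<open>
  For \<open>i \<le> p\<close> there is no loss of powers, and for \<open>i > p\<close> the loss of \<open>i - p\<close> powers is compensated by the
  shift, by \<open>gainB\<close>.
\<close>

lemma shifted_term_le:
  assumes K: "\<And>s. gs_coeff \<psi> s \<noteq> 0 \<Longrightarrow> cmod s \<le> K * (1 + (Re s - N))"
    and i: "i \<le> m" and t: "gs_coeff (B i) t \<noteq> 0" and b: "gs_coeff \<psi> b \<noteq> 0" and r: "0 < r" "r \<le> 1"
  shows "cmod b ^ i * (cmod (t + b - lam) ^ (m - p) * maj_wt \<kappa> r (Re (t + b) - Re lam - N))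
    \<le> (1 + cmod (t - lam)) ^ (m - p) * (1 + \<bar>K\<bar>) ^ m * r powr \<epsilon> * (cmod b ^ m * maj_wt \<kappa> r (Re b - N))"
proof -
  define \<tau> where "\<tau> = Re t - Re lam"
  define y where "y = Re b - N"
  have tau: "0 \<le> \<tau>" "\<epsilon> \<le> \<tau>" using epsB[OF i t] eps by (auto simp: \<tau>_def)
  have y: "0 \<le> y" "Re (t + b) - Re lam - N = y + \<tau>" using tail[OF b] by (auto simp: y_def \<tau>_def)
  have b1: "1 \<le> cmod b" by (rule norm_ge_1[OF b])
  have "cmod (t + b - lam) \<le> cmod (t - lam) + cmod b"
    using norm_triangle_ineq[of "t - lam" b] by (simp add: algebra_simps)
  also have "\<dots> \<le> (1 + cmod (t - lam)) * cmod b"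
    using b1 mult_left_mono[OF b1, of "cmod (t - lam)"] by (simp add: algebra_simps)
  finally have "cmod (t + b - lam) ^ (m - p) \<le> ((1 + cmod (t - lam)) * cmod b) ^ (m - p)"
    by (intro power_mono) auto
  then have shift: "cmod (t + b - lam) ^ (m - p) \<le> (1 + cmod (t - lam)) ^ (m - p) * cmod b ^ (m - p)"
    by (simp add: power_mult_distrib)
  have core: "cmod b ^ (i + (m - p)) * maj_wt \<kappa> r (y + \<tau>)
      \<le> (1 + \<bar>K\<bar>) ^ m * (cmod b ^ m * (r powr \<tau> * maj_wt \<kappa> r y))"
  proof (cases "i \<le> p")
    case True
    have "cmod b ^ (i + (m - p)) \<le> cmod b ^ m"
      using b1 True p by (intro power_increasing) auto
    then have "cmod b ^ (i + (m - p)) * maj_wt \<kappa> r (y + \<tau>) \<le> cmod b ^ m * (r powr \<tau> * maj_wt \<kappa> r y)"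
      using maj_wt_add_le[OF kappa r(1) y(1) tau(1)] by (intro mult_mono maj_wt_nonneg) auto
    also have "\<dots> \<le> (1 + \<bar>K\<bar>) ^ m * (cmod b ^ m * (r powr \<tau> * maj_wt \<kappa> r y))"
    proof -
      have "1 \<le> (1 + \<bar>K\<bar>) ^ m" by (rule one_le_power) simp
      moreover have "0 \<le> cmod b ^ m * (r powr \<tau> * maj_wt \<kappa> r y)"
        by (intro mult_nonneg_nonneg maj_wt_nonneg) auto
      ultimately have "1 * (cmod b ^ m * (r powr \<tau> * maj_wt \<kappa> r y))
          \<le> (1 + \<bar>K\<bar>) ^ m * (cmod b ^ m * (r powr \<tau> * maj_wt \<kappa> r y))"
        by (rule mult_right_mono)
      then show ?thesis by (simp only: mult_1_left)
    qed
    finally show ?thesis .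
  next
    case False
    have "cmod b \<le> (1 + \<bar>K\<bar>) * (1 + (y + \<tau>))"
    proof -
      have "cmod b \<le> K * (1 + y)" using K[OF b] by (simp add: y_def)
      also have "\<dots> \<le> (1 + \<bar>K\<bar>) * (1 + (y + \<tau>))" using y tau by (intro mult_mono) auto
      finally show ?thesis .
    qed
    then have "cmod b ^ (i - p) \<le> (1 + \<bar>K\<bar>) ^ (i - p) * (1 + (y + \<tau>)) ^ (i - p)"
      using power_mono[of "cmod b" "(1 + \<bar>K\<bar>) * (1 + (y + \<tau>))"] by (simp add: power_mult_distrib)
    also have "\<dots> \<le> (1 + \<bar>K\<bar>) ^ m * (1 + (y + \<tau>)) powr (\<kappa> * \<tau>)"
      using y tau i False gainB[OF i t]
      by (intro mult_mono power_increasing real_power_le_powr) (auto simp: \<tau>_def of_nat_diff)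
    finally have "cmod b ^ (i - p) * maj_wt \<kappa> r (y + \<tau>)
        \<le> (1 + \<bar>K\<bar>) ^ m * (1 + (y + \<tau>)) powr (\<kappa> * \<tau>) * maj_wt \<kappa> r (y + \<tau>)"
      by (intro mult_right_mono maj_wt_nonneg)
    also have "\<dots> = (1 + \<bar>K\<bar>) ^ m * (maj_wt \<kappa> r (y + \<tau>) * (1 + (y + \<tau>)) powr (\<kappa> * \<tau>))"
      by (simp only: mult_ac)
    also have "\<dots> \<le> (1 + \<bar>K\<bar>) ^ m * (r powr \<tau> * maj_wt \<kappa> r y)"
      using maj_wt_add_gain[OF kappa r(1) y(1) tau(1)] by (intro mult_left_mono) auto
    finally have "cmod b ^ m * (cmod b ^ (i - p) * maj_wt \<kappa> r (y + \<tau>))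
        \<le> cmod b ^ m * ((1 + \<bar>K\<bar>) ^ m * (r powr \<tau> * maj_wt \<kappa> r y))"
      by (intro mult_left_mono) auto
    moreover have "i + (m - p) = m + (i - p)" using False p by simp
    ultimately show ?thesis by (simp only: power_add mult_ac)
  qed
  have "cmod b ^ i * (cmod (t + b - lam) ^ (m - p) * maj_wt \<kappa> r (y + \<tau>))
      \<le> cmod b ^ i * (((1 + cmod (t - lam)) ^ (m - p) * cmod b ^ (m - p)) * maj_wt \<kappa> r (y + \<tau>))"
    using shift by (intro mult_left_mono mult_right_mono maj_wt_nonneg) auto
  also have "\<dots> = (1 + cmod (t - lam)) ^ (m - p) * (cmod b ^ (i + (m - p)) * maj_wt \<kappa> r (y + \<tau>))"
    by (simp only: power_add mult_ac)
  also have "\<dots> \<le> (1 + cmod (t - lam)) ^ (m - p) * ((1 + \<bar>K\<bar>) ^ m * (cmod b ^ m * (r powr \<tau> * maj_wt \<kappa> r y)))"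
    using core by (intro mult_left_mono) auto
  also have "\<dots> \<le> (1 + cmod (t - lam)) ^ (m - p) * ((1 + \<bar>K\<bar>) ^ m * (cmod b ^ m * (r powr \<epsilon> * maj_wt \<kappa> r y)))"
    using r tau by (intro mult_left_mono mult_right_mono maj_wt_nonneg powr_mono') auto
  finally show ?thesis
    unfolding y(2) y_def[symmetric] by (simp only: mult_ac)
qed

lemma source_B:
  assumes K: "\<And>s. gs_coeff \<psi> s \<noteq> 0 \<Longrightarrow> cmod s \<le> K * (1 + (Re s - N))" and i: "i \<le> m"
  shows "\<exists>C. \<forall>r Y. 0 < r \<longrightarrow> r \<le> 1 \<longrightarrow> tail_norm r Y \<le> 1 \<longrightarrow>
    (\<Sum>s\<in>gs_upto N (Y + \<epsilon>) \<psi>. cmod s ^ (m - p)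
      * cmod (gs_coeff (B i * (gs_delta ^^ i) \<psi>) (s + lam)) * maj_wt \<kappa> r (Re s - N)) \<le> C * r powr \<epsilon>"
proof (intro exI allI impI)
  fix r Y assume r: "0 < r" "r \<le> 1" and Y: "tail_norm r Y \<le> 1"
  let ?S = "gs_upto N (Y + \<epsilon>) \<psi>" and ?A = "{t. gs_coeff (B i) t \<noteq> 0}" and ?f = "(gs_delta ^^ i) \<psi>"
  let ?u = "\<lambda>x. cmod (x - lam) ^ (m - p) * maj_wt \<kappa> r (Re x - Re lam - N)"
  let ?q = "\<lambda>t. cmod (gs_coeff (B i) t) * ((1 + cmod (t - lam)) ^ (m - p) * (1 + \<bar>K\<bar>) ^ m)"
  let ?z = "\<lambda>b. cmod b ^ m * cmod (gs_coeff \<psi> b) * maj_wt \<kappa> r (Re b - N)"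
  have "(\<Sum>s\<in>?S. cmod s ^ (m - p) * cmod (gs_coeff (B i * ?f) (s + lam)) * maj_wt \<kappa> r (Re s - N))
      = (\<Sum>x\<in>(\<lambda>s. s + lam) ` ?S. cmod (gs_coeff (B i * ?f) x) * ?u x)"
    by (simp add: sum.reindex inj_on_def mult_ac)
  also have "\<dots> \<le> (\<Sum>t\<in>?A. \<Sum>b\<in>gs_upto N Y \<psi>. cmod (gs_coeff (B i) t) * cmod (gs_coeff ?f b) * ?u (t + b))"
  proof (rule sum_norm_coeff_times_le)
    show "finite ((\<lambda>s. s + lam) ` ?S)" "finite (gs_upto N Y \<psi>)" by (simp_all add: finite_gs_upto)
    show "finite ?A" by (rule finB[OF i])
    show "0 \<le> ?u x" for x by (intro mult_nonneg_nonneg maj_wt_nonneg) auto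
    fix t b assume tb: "gs_coeff (B i) t \<noteq> 0" "gs_coeff ?f b \<noteq> 0" "t + b \<in> (\<lambda>s. s + lam) ` ?S"
    from tb(3) obtain x where x: "t + b = x + lam" "x \<in> ?S" by auto
    have "Re (t + b) - Re lam - N \<le> Y + \<epsilon>" unfolding x(1) using x(2) by (simp add: gs_upto_def)
    then show "t \<in> ?A \<and> b \<in> gs_upto N Y \<psi>"
      using tb epsB[OF i tb(1)] by (auto simp: gs_upto_def gs_coeff_delta_tail)
  qed
  also have "\<dots> \<le> (\<Sum>t\<in>?A. \<Sum>b\<in>gs_upto N Y \<psi>. ?q t * r powr \<epsilon> * ?z b)"
  proof (intro sum_mono)
    fix t b assume "t \<in> ?A" "b \<in> gs_upto N Y \<psi>"
    then have tb: "gs_coeff (B i) t \<noteq> 0" "gs_coeff \<psi> b \<noteq> 0" by (auto simp: gs_upto_def)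
    have "cmod (gs_coeff (B i) t) * cmod (gs_coeff \<psi> b) * (cmod b ^ i * ?u (t + b))
        \<le> cmod (gs_coeff (B i) t) * cmod (gs_coeff \<psi> b) * ((1 + cmod (t - lam)) ^ (m - p) * (1 + \<bar>K\<bar>) ^ m
          * r powr \<epsilon> * (cmod b ^ m * maj_wt \<kappa> r (Re b - N)))"
      by (intro mult_left_mono shifted_term_le K i tb r) auto
    then show "cmod (gs_coeff (B i) t) * cmod (gs_coeff ?f b) * ?u (t + b) \<le> ?q t * r powr \<epsilon> * ?z b"
      unfolding gs_coeff_delta_funpow norm_mult norm_power by (simp only: mult_ac)
  qed
  also have "\<dots> = (\<Sum>t\<in>?A. ?q t) * r powr \<epsilon> * tail_norm r Y"
    unfolding tail_norm_eq by (simp only: sum_distrib_right sum_distrib_left mult_ac)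
  also have "\<dots> \<le> (\<Sum>t\<in>?A. ?q t) * r powr \<epsilon> * 1"
    using Y by (intro mult_left_mono mult_nonneg_nonneg sum_nonneg) auto
  finally show "(\<Sum>s\<in>?S. cmod s ^ (m - p) * cmod (gs_coeff (B i * ?f) (s + lam)) * maj_wt \<kappa> r (Re s - N))
      \<le> (\<Sum>t\<in>?A. ?q t) * r powr \<epsilon>" by simp
qed

text \<open>
  The decisive step: a bound for the norm up to the height \<open>Y\<close> is improved to a small bound up to the height
  \<open>Y + \<epsilon>\<close>, with a constant that depends on neither \<open>Y\<close> nor \<open>r\<close>.
\<close>

lemma tail_norm_step:
  assumes K: "\<And>s. gs_coeff \<psi> s \<noteq> 0 \<Longrightarrow> cmod s \<le> K * (1 + (Re s - N))"
  shows "\<exists>C. \<forall>r Y. 0 < r \<longrightarrow> r \<le> 1 \<longrightarrow> tail_norm r Y \<le> 1 \<longrightarrow> tail_norm r (Y + \<epsilon>) \<le> C * r powr \<epsilon>"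
proof -
  obtain C1 where C1: "\<And>r Y. 0 < r \<Longrightarrow> r \<le> 1 \<Longrightarrow> (\<Sum>s\<in>gs_upto N Y \<psi>. cmod s ^ (m - p)
      * cmod (gs_coeff D (s + lam)) * maj_wt \<kappa> r (Re s - N)) \<le> C1 * r powr \<epsilon>"
    using source_D by blast
  have "\<forall>i\<in>{..m}. \<exists>C. \<forall>r Y. 0 < r \<longrightarrow> r \<le> 1 \<longrightarrow> tail_norm r Y \<le> 1 \<longrightarrow>
    (\<Sum>s\<in>gs_upto N (Y + \<epsilon>) \<psi>. cmod s ^ (m - p)
      * cmod (gs_coeff (B i * (gs_delta ^^ i) \<psi>) (s + lam)) * maj_wt \<kappa> r (Re s - N)) \<le> C * r powr \<epsilon>"
    using source_B[OF K] by blast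
  from bchoice[OF this] obtain C2 where C2: "\<And>i r Y. i \<le> m \<Longrightarrow> 0 < r \<Longrightarrow> r \<le> 1 \<Longrightarrow> tail_norm r Y \<le> 1 \<Longrightarrow>
    (\<Sum>s\<in>gs_upto N (Y + \<epsilon>) \<psi>. cmod s ^ (m - p)
      * cmod (gs_coeff (B i * (gs_delta ^^ i) \<psi>) (s + lam)) * maj_wt \<kappa> r (Re s - N)) \<le> C2 i * r powr \<epsilon>"
    by auto
  obtain C3 where C3: "\<And>r Y. 0 < r \<Longrightarrow> r \<le> 1 \<Longrightarrow> tail_norm r Y \<le> 1 \<Longrightarrow>
    (\<Sum>s\<in>gs_upto N (Y + \<epsilon>) \<psi>. cmod s ^ (m - p)
      * cmod (gs_coeff T (s + lam)) * maj_wt \<kappa> r (Re s - N)) \<le> C3 * r powr \<epsilon>"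
    using source_T[OF K] by blast
  show ?thesis
  proof (intro exI allI impI)
    fix r Y assume r: "0 < r" "r \<le> 1" and Y: "tail_norm r Y \<le> 1"
    let ?S = "gs_upto N (Y + \<epsilon>) \<psi>" and ?w = "\<lambda>s. maj_wt \<kappa> r (Re s - N)"
    let ?b = "\<lambda>i s. cmod (gs_coeff (B i * (gs_delta ^^ i) \<psi>) (s + lam))"
    let ?D = "\<lambda>s. cmod (gs_coeff D (s + lam))" and ?T = "\<lambda>s. cmod (gs_coeff T (s + lam))"
    have "tail_norm r (Y + \<epsilon>) \<le> (\<Sum>s\<in>?S. 1 / d * (cmod s ^ (m - p) * (?D s + (\<Sum>i\<le>m. ?b i s) + ?T s) * ?w s))"
      unfolding tail_norm_eq
    proof (rule sum_mono)
      fix s assume "s \<in> ?S"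
      then have s: "N < Re s" using tail by (simp add: gs_upto_def)
      have "d * cmod s ^ p * cmod (gs_coeff \<psi> s) \<le> cmod (L s) * cmod (gs_coeff \<psi> s)"
        using L[OF s] by (intro mult_right_mono) auto
      also have "\<dots> = cmod (gs_coeff D (s + lam)
          + (\<Sum>i\<le>m. gs_coeff (B i * (gs_delta ^^ i) \<psi>) (s + lam)) + gs_coeff T (s + lam))"
        using recurrence[of s] by (metis norm_minus_cancel norm_mult)
      also have "\<dots> \<le> ?D s + (\<Sum>i\<le>m. ?b i s) + ?T s"
        by (intro norm_triangle_le add_mono norm_sum order_refl order.trans[OF norm_triangle_ineq])
      finally have "d * cmod s ^ p * cmod (gs_coeff \<psi> s) \<le> ?D s + (\<Sum>i\<le>m. ?b i s) + ?T s" .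
      then have "cmod s ^ (m - p) * (d * cmod s ^ p * cmod (gs_coeff \<psi> s)) * ?w s
          \<le> cmod s ^ (m - p) * (?D s + (\<Sum>i\<le>m. ?b i s) + ?T s) * ?w s"
        by (intro mult_right_mono mult_left_mono maj_wt_nonneg) auto
      then have "1 / d * (cmod s ^ (m - p) * (d * cmod s ^ p * cmod (gs_coeff \<psi> s)) * ?w s)
          \<le> 1 / d * (cmod s ^ (m - p) * (?D s + (\<Sum>i\<le>m. ?b i s) + ?T s) * ?w s)"
        using d by (intro mult_left_mono) auto
      moreover have "cmod s ^ m = cmod s ^ (m - p) * cmod s ^ p"
        using p by (simp flip: power_add)
      then have "cmod s ^ m * cmod (gs_coeff \<psi> s) * ?w s
          = 1 / d * (cmod s ^ (m - p) * (d * cmod s ^ p * cmod (gs_coeff \<psi> s)) * ?w s)"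
        using d by simp
      ultimately show "cmod s ^ m * cmod (gs_coeff \<psi> s) * ?w s
          \<le> 1 / d * (cmod s ^ (m - p) * (?D s + (\<Sum>i\<le>m. ?b i s) + ?T s) * ?w s)"
        by (simp only:)
    qed
    also have "\<dots> = (\<Sum>s\<in>?S. 1 / d * (cmod s ^ (m - p) * ?D s * ?w s
        + (\<Sum>i\<le>m. cmod s ^ (m - p) * ?b i s * ?w s) + cmod s ^ (m - p) * ?T s * ?w s))"
      by (intro sum.cong refl arg_cong[where f = "(*) (1 / d)"])
        (simp only: distrib_left distrib_right sum_distrib_left sum_distrib_right)
    also have "\<dots> = 1 / d * ((\<Sum>s\<in>?S. cmod s ^ (m - p) * ?D s * ?w s)
        + (\<Sum>s\<in>?S. \<Sum>i\<le>m. cmod s ^ (m - p) * ?b i s * ?w s) + (\<Sum>s\<in>?S. cmod s ^ (m - p) * ?T s * ?w s))"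
      unfolding sum_distrib_left[symmetric] sum.distrib ..
    also have "(\<Sum>s\<in>?S. \<Sum>i\<le>m. cmod s ^ (m - p) * ?b i s * ?w s)
        = (\<Sum>i\<le>m. \<Sum>s\<in>?S. cmod s ^ (m - p) * ?b i s * ?w s)"
      by (rule sum.swap)
    also have "1 / d * ((\<Sum>s\<in>?S. cmod s ^ (m - p) * ?D s * ?w s)
        + (\<Sum>i\<le>m. \<Sum>s\<in>?S. cmod s ^ (m - p) * ?b i s * ?w s) + (\<Sum>s\<in>?S. cmod s ^ (m - p) * ?T s * ?w s))
      \<le> 1 / d * (C1 * r powr \<epsilon> + (\<Sum>i\<le>m. C2 i * r powr \<epsilon>) + C3 * r powr \<epsilon>)"
      using d by (intro mult_left_mono add_mono sum_mono C1 C2 C3 r Y) auto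
    also have "\<dots> = (1 / d * (C1 + (\<Sum>i\<le>m. C2 i) + C3)) * r powr \<epsilon>"
      by (simp only: sum_distrib_right[symmetric] distrib_right mult.assoc)
    finally show "tail_norm r (Y + \<epsilon>) \<le> (1 / d * (C1 + (\<Sum>i\<le>m. C2 i) + C3)) * r powr \<epsilon>" .
  qed
qed

lemma tail_norm_bounded:
  assumes K: "\<And>s. gs_coeff \<psi> s \<noteq> 0 \<Longrightarrow> cmod s \<le> K * (1 + (Re s - N))"
  shows "\<exists>r>0. r \<le> 1 \<and> (\<forall>Y. tail_norm r Y \<le> 1)"
proof -
  obtain C where C: "\<And>r Y. 0 < r \<Longrightarrow> r \<le> 1 \<Longrightarrow> tail_norm r Y \<le> 1 \<Longrightarrow> tail_norm r (Y + \<epsilon>) \<le> C * r powr \<epsilon>"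
    using tail_norm_step[OF K] by blast
  \<comment> \<open>chosen such that \<open>C * r powr \<epsilon> \<le> 1\<close>\<close>
  define r where "r = (1 / (1 + \<bar>C\<bar>)) powr (1 / \<epsilon>)"
  have r: "0 < r" "r \<le> 1" using eps by (auto simp: r_def powr_le1)
  have "r powr \<epsilon> = 1 / (1 + \<bar>C\<bar>)" using eps by (simp add: r_def powr_powr)
  then have "C * r powr \<epsilon> \<le> 1" by simp
  then have "tail_norm r (Y + \<epsilon>) \<le> 1" if "tail_norm r Y \<le> 1" for Y
    using C[OF r that] by simp
  moreover have "gs_upto N 0 \<psi> = {}" using tail by (fastforce simp: gs_upto_def)
  then have "tail_norm r 0 \<le> 1" by (simp add: tail_norm_eq)
  moreover have "tail_norm r Y' \<le> 1" if "tail_norm r Y \<le> 1" "Y' \<le> Y" for Y Y'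
    using gs_wnorm_mono[OF that(2)] that(1) unfolding tail_norm_def by (rule order.trans)
  ultimately have "tail_norm r Y \<le> 1" for Y
    using step_induct[OF eps, of "\<lambda>Y. tail_norm r Y \<le> 1" Y] by blast
  then show ?thesis using r by blast
qed

theorem cone_and_norm_bounds:
  "\<exists>K\<ge>0. \<exists>r>0. r \<le> 1 \<and> (\<forall>Y. in_cone K Y) \<and> (\<forall>Y. tail_norm r Y \<le> 1)"
proof -
  obtain K where K: "0 \<le> K" "\<And>Y. in_cone K Y" using cone_exists by blast
  have "cmod s \<le> (N + K + 1) * (1 + (Re s - N))" if s: "gs_coeff \<psi> s \<noteq> 0" for s
  proof -
    define y where "y = Re s - N"
    have y: "0 < y" using tail[OF s] by (simp add: y_def)
    have "\<bar>Im s\<bar> \<le> K * y" using K(2)[of y] s by (simp add: in_cone_def y_def)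
    then have "cmod s \<le> (N + y) + K * y"
      using cmod_le[of s] y N1 by (simp add: y_def)
    also have "\<dots> \<le> (N + K + 1) * (1 + y)"
      using y N1 K(1) by (simp add: algebra_simps)
    finally show ?thesis by (simp add: y_def)
  qed
  from tail_norm_bounded[OF this] show ?thesis using K by blast
qed

end

section \<open>Bounds for a formal solution\<close>

lemma polynomial_lower_bound:
  fixes A :: "nat \<Rightarrow> complex"
  assumes "p \<le> m" "A p \<noteq> 0" "\<And>i. p < i \<Longrightarrow> i \<le> m \<Longrightarrow> A i = 0"
  shows "\<exists>d>0. \<exists>M. \<forall>s. M \<le> cmod s \<longrightarrow> d * cmod s ^ p \<le> cmod (\<Sum>i\<le>m. A i * s ^ i)"
proof -
  have sum: "(\<Sum>i\<le>m. A i * s ^ i) = (\<Sum>i<p. A i * s ^ i) + A p * s ^ p" for s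
  proof -
    have "(\<Sum>i\<le>m. A i * s ^ i) = (\<Sum>i\<le>p. A i * s ^ i)"
      using assms(1,3) by (intro sum.mono_neutral_right) (auto simp: not_le)
    then show ?thesis by (simp flip: lessThan_Suc_atMost)
  qed
  obtain M where M: "\<And>s. M \<le> cmod s \<Longrightarrow> cmod (\<Sum>i<p. A i * s ^ i) \<le> cmod (A p) / 2 * cmod s ^ p"
  proof (cases p)
    case 0
    then show ?thesis using that[of 0] by simp
  next
    case (Suc n)
    then show ?thesis
      using polyfun_extremal_lemma[of "cmod (A p) / 2" A n] assms(2) that
      by (auto simp: lessThan_Suc_atMost)
  qed
  have "cmod (A p) / 2 * cmod s ^ p \<le> cmod (\<Sum>i\<le>m. A i * s ^ i)" if "M \<le> cmod s" for s
  proof -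
    have "cmod (A p * s ^ p) - cmod (\<Sum>i<p. A i * s ^ i) \<le> cmod (\<Sum>i\<le>m. A i * s ^ i)"
      unfolding sum by (metis add.commute norm_diff_ineq)
    then show ?thesis using M[OF that] by (simp add: norm_mult norm_power)
  qed
  then show ?thesis using assms(2) by (intro exI[of _ "cmod (A p) / 2"]) auto
qed

text \<open>
  The bootstrap bounds the norm of \<open>\<delta>\<^sup>m \<psi>\<close>, in order to absorb the derivatives in the nonlinear terms. Its factor
  \<open>cmod s ^ m\<close> is at least 1 on the tail, so it can be dropped at the end.
\<close>

theorem formal_solution_bounds:
  fixes F :: diff_poly and \<phi> :: gen_series and A :: "nat \<Rightarrow> complex" and m :: nat
  defines "G \<equiv> \<lambda>i. dp_subst (dp_deriv (U i) F) \<phi>"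
  assumes vars: "dp_vars F \<subseteq> insert Z (U ` {..m})"
    and low: "\<And>x. gs_coeff \<phi> x \<noteq> 0 \<Longrightarrow> 0 \<le> Re x"
    and sol: "dp_subst F \<phi> = 0"
    and top: "G m \<noteq> 0"
    and A: "\<exists>i\<le>m. A i \<noteq> 0"
    and lead: "\<And>i x. i \<le> m \<Longrightarrow> gs_coeff (G i - gs_monom (A i) lam) x \<noteq> 0 \<Longrightarrow> Re lam < Re x"
  shows "\<exists>\<kappa>\<ge>0. \<exists>N\<ge>1. \<exists>K\<ge>0. \<exists>r>0. r \<le> 1 \<and>
    (\<forall>s. div_slope s (least_positive_slope m G) = of_real \<kappa> * s) \<and>
    (\<forall>s. gs_coeff \<phi> s \<noteq> 0 \<longrightarrow> N < Re s \<longrightarrow> \<bar>Im s\<bar> \<le> K * (Re s - N)) \<and>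
    (\<forall>S. finite S \<longrightarrow> (\<forall>s\<in>S. N < Re s) \<longrightarrow>
      (\<Sum>s\<in>S. cmod (gs_coeff \<phi> s) * maj_wt \<kappa> r (Re s - N)) \<le> 1)"
proof -
  define p where "p = Max {i. i \<le> m \<and> A i \<noteq> 0}"
  have fin: "finite {i. i \<le> m \<and> A i \<noteq> 0}" by simp
  have "p \<in> {i. i \<le> m \<and> A i \<noteq> 0}" unfolding p_def using A by (intro Max_in fin) auto
  then have p: "p \<le> m" "A p \<noteq> 0" by auto
  have p_max: "A i = 0" if "p < i" "i \<le> m" for i
    using Max_ge[OF fin, of i] that unfolding p_def[symmetric] by (auto simp: not_le)
  have Gcoeff: "gs_coeff (G i) x = (if x = lam then A i else 0) + gs_coeff (G i - gs_monom (A i) lam) x" for i x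
    by (simp add: gs_coeff_minus gs_monom.rep_eq)
  have lead0: "gs_coeff (G i - gs_monom (A i) lam) lam = 0" if "i \<le> m" for i
    using lead[OF that, of lam] by blast
  have Gp: "gs_coeff (G p) lam \<noteq> 0" using Gcoeff[of p lam] lead0[OF p(1)] p(2) by simp
  have Glow: "Re lam \<le> Re x" if "i \<le> m" "gs_coeff (G i) x \<noteq> 0" for i x
    using that Gcoeff[of i x] lead[OF that(1), of x] by (auto split: if_splits)
  have Gright: "Re lam < Re x" if "p < i" "i \<le> m" "gs_coeff (G i) x \<noteq> 0" for i x
    using that Gcoeff[of i x] lead[OF that(2), of x] p_max[OF that(1,2)] by (auto split: if_splits)
  have "\<exists>\<kappa>\<ge>0. (\<forall>s. div_slope s (least_positive_slope m G) = of_real \<kappa> * s) \<and>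
      (\<forall>i x. p < i \<longrightarrow> i \<le> m \<longrightarrow> gs_coeff (G i) x \<noteq> 0 \<longrightarrow> real i - real p \<le> \<kappa> * (Re x - Re lam))"
    by (rule least_positive_slope_bound[OF p(1) top Gp]) (fact Glow Gright)+
  then obtain \<kappa> where "0 \<le> \<kappa> \<and> (\<forall>s. div_slope s (least_positive_slope m G) = of_real \<kappa> * s) \<and>
      (\<forall>i x. p < i \<longrightarrow> i \<le> m \<longrightarrow> gs_coeff (G i) x \<noteq> 0 \<longrightarrow> real i - real p \<le> \<kappa> * (Re x - Re lam))" ..
  then have \<kappa>: "0 \<le> \<kappa>" "\<And>s. div_slope s (least_positive_slope m G) = of_real \<kappa> * s"
    "\<And>i x. p < i \<Longrightarrow> i \<le> m \<Longrightarrow> gs_coeff (G i) x \<noteq> 0 \<Longrightarrow> real i - real p \<le> \<kappa> * (Re x - Re lam)"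
    by simp_all
  obtain d M where L: "0 < d" "\<And>s. M \<le> cmod s \<Longrightarrow> d * cmod s ^ p \<le> cmod (\<Sum>i\<le>m. A i * s ^ i)"
    using polynomial_lower_bound[of p m A, OF p p_max] by blast
  have kp: "p = m" if "\<kappa> = 0"
  proof (rule ccontr)
    assume "p \<noteq> m"
    then have "p < m" using p(1) by simp
    moreover obtain x where "gs_coeff (G m) x \<noteq> 0"
      using top gs_eqI[of "G m" 0] by (auto simp: zero_gen_series.rep_eq)
    ultimately show False using \<kappa>(3)[of m x] that by simp
  qed
  \<comment> \<open>the last two entries give \<open>N > Re lam\<close> and a gain of \<open>m - p\<close> powers in the remainder; the quotient is 0 if \<open>\<kappa> = 0\<close>, when \<open>p = m\<close>\<close>
  define N where "N = Max {1, M, Re lam + 1, Re lam + (real m - real p) / \<kappa>}"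
  have N: "1 \<le> N" "M \<le> N" "Re lam + 1 \<le> N" "Re lam + (real m - real p) / \<kappa> \<le> N"
    unfolding N_def by (intro Max_ge; simp)+
  have gainN: "real m - real p \<le> \<kappa> * (N - Re lam)"
  proof (cases "\<kappa> = 0")
    case False
    then have "0 < \<kappa>" using \<kappa>(1) by simp
    moreover have "(real m - real p) / \<kappa> \<le> N - Re lam" using N(4) by simp
    ultimately show ?thesis by (simp add: pos_divide_le_eq mult.commute)
  qed (use kp in simp)

  define P where "P = gs_trunc N \<phi>"
  define \<psi> where "\<psi> = \<phi> - P"
  have \<phi>: "\<phi> = P + \<psi>" by (simp add: \<psi>_def)
  have \<psi>: "gs_coeff \<psi> x = (if N < Re x then gs_coeff \<phi> x else 0)" for x
    by (simp add: \<psi>_def P_def gs_coeff_minus gs_trunc.rep_eq)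
  have "{x. gs_coeff P x \<noteq> 0} \<subseteq> {x. gs_coeff \<phi> x \<noteq> 0 \<and> Re x \<le> N}"
    by (auto simp: P_def gs_trunc.rep_eq)
  then have finP: "finite {x. gs_coeff P x \<noteq> 0}" using finite_gs_coeff by (rule finite_subset)
  interpret tail_majorant \<kappa> N m \<psi>
    by unfold_locales (use \<kappa>(1) N(1) in \<open>auto simp: \<psi> split: if_splits\<close>)
  have monom0: "gs_monom a 0 \<in> {T. controlled 0 T}" for a
    using controlled_finite[of "gs_monom a 0"]
    by (auto simp: gs_monom.rep_eq intro: finite_subset[of _ "{0}"] split: if_splits)
  have val0: "var_value P v \<in> {T. controlled 0 T}" for v
  proof (cases v)
    case Z
    have "controlled 0 (gs_monom 1 1)"
      by (rule controlled_finite)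
        (auto simp: gs_monom.rep_eq intro: finite_subset[of _ "{1}"] split: if_splits)
    then show ?thesis using Z by simp
  next
    case (U i)
    have "controlled 0 ((gs_delta ^^ i) P)"
      by (rule controlled_finite)
        (use finP low in \<open>auto simp: gs_coeff_delta_funpow P_def gs_trunc.rep_eq
          elim: rev_finite_subset split: if_splits\<close>)
    then show ?thesis using U by simp
  qed
  have delta: "(gs_delta ^^ i) \<psi> \<in> {T. controlled N T}" if "i \<le> m" for i
    using controlled_delta[OF that] by simp
  interpret I: ring_filtration "{T. controlled 0 T}" "{T. controlled N T}" "{T. controlled (N + N) T}"
    by (rule ring_filtration_controlled)
  have taylor: "\<exists>T\<in>{T. controlled (N + N) T}. dp_subst H \<phi> = dp_subst H P
      + (\<Sum>i\<le>m. dp_subst (dp_deriv (U i) H) P * (gs_delta ^^ i) \<psi>) + T"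
    if "dp_vars H \<subseteq> insert Z (U ` {..m})" for H
    unfolding \<phi> by (rule dp_subst_taylor[OF ring_filtration_controlled that monom0 val0 delta])

  define g where "g i = dp_subst (dp_deriv (U i) F) P" for i
  define B where "B i = g i - gs_monom (A i) lam" for i
  \<comment> \<open>the derivatives at \<open>\<phi>\<close> and at \<open>P\<close> agree below \<open>N\<close>, so those at \<open>P\<close> inherit the Newton polygon\<close>
  have close: "gs_coeff (G i) x = gs_coeff (g i) x" if "i \<le> m" "Re x < N" for i x
  proof -
    obtain T where T: "T \<in> {T. controlled (N + N) T}" "G i = g i
      + ((\<Sum>j\<le>m. dp_subst (dp_deriv (U j) (dp_deriv (U i) F)) P * (gs_delta ^^ j) \<psi>) + T)"
      using taylor[of "dp_deriv (U i) F"] dp_vars_deriv[of "U i" F] vars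
      by (auto simp: G_def g_def add.assoc)
    have "(\<Sum>j\<le>m. dp_subst (dp_deriv (U j) (dp_deriv (U i) F)) P * (gs_delta ^^ j) \<psi>) + T
        \<in> {T. controlled N T}"
      by (intro I.add1 I.sum_mem1 I.mult01 delta subsetD[OF I.sub2 T(1)]
          dp_subst_closed[OF I.add0 I.mult0 monom0 val0]) auto
    then have "gs_coeff ((\<Sum>j\<le>m. dp_subst (dp_deriv (U j) (dp_deriv (U i) F)) P * (gs_delta ^^ j) \<psi>) + T) x = 0"
      using that(2) by (fastforce elim: controlledE)
    then show ?thesis by (simp add: T(2) plus_gen_series.rep_eq)
  qed
  have B: "Re lam < Re t" "real i - real p \<le> \<kappa> * (Re t - Re lam)"
    if i: "i \<le> m" and t: "gs_coeff (B i) t \<noteq> 0" for i t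
  proof -
    have "Re lam < Re t \<and> real i - real p \<le> \<kappa> * (Re t - Re lam)"
    proof (cases "Re t < N")
      case True
      then have nz: "gs_coeff (G i - gs_monom (A i) lam) t \<noteq> 0"
        using t close[OF i True] by (simp add: B_def gs_coeff_minus)
      then have gt: "Re lam < Re t" by (rule lead[OF i])
      show ?thesis
      proof (cases "p < i")
        case True
        then have "gs_coeff (G i) t \<noteq> 0"
          using nz gt by (auto simp: gs_coeff_minus gs_monom.rep_eq split: if_splits)
        then show ?thesis using \<kappa>(3)[OF True i] gt by blast
      next
        case False
        then have "real i - real p \<le> 0" by simp
        also have "0 \<le> \<kappa> * (Re t - Re lam)" using \<kappa>(1) gt by simp
        finally show ?thesis using gt by simp
      qed
    next
      case False
      have "real i - real p \<le> real m - real p" using i by simp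
      also have "\<dots> \<le> \<kappa> * (N - Re lam)" by (rule gainN)
      also have "\<dots> \<le> \<kappa> * (Re t - Re lam)" using \<kappa>(1) False by (intro mult_left_mono) auto
      finally show ?thesis using False N(3) by simp
    qed
    then show "Re lam < Re t" "real i - real p \<le> \<kappa> * (Re t - Re lam)" by auto
  qed
  obtain T where T: "controlled (N + N) T"
    "0 = dp_subst F P + (\<Sum>i\<le>m. g i * (gs_delta ^^ i) \<psi>) + T"
    using taylor[OF vars] unfolding sol g_def by blast
  have recurrence: "(\<Sum>i\<le>m. A i * s ^ i) * gs_coeff \<psi> s = - (gs_coeff (dp_subst F P) (s + lam)
      + (\<Sum>i\<le>m. gs_coeff (B i * (gs_delta ^^ i) \<psi>) (s + lam)) + gs_coeff T (s + lam))" for s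
  proof -
    have "gs_coeff (g i * (gs_delta ^^ i) \<psi>) (s + lam)
        = A i * s ^ i * gs_coeff \<psi> s + gs_coeff (B i * (gs_delta ^^ i) \<psi>) (s + lam)" for i
    proof -
      have "g i * (gs_delta ^^ i) \<psi>
          = gs_monom (A i) lam * (gs_delta ^^ i) \<psi> + B i * (gs_delta ^^ i) \<psi>"
        by (simp add: B_def algebra_simps)
      then show ?thesis
        by (simp add: plus_gen_series.rep_eq gs_coeff_monom_times gs_coeff_delta_funpow)
    qed
    then have "0 = gs_coeff (dp_subst F P) (s + lam) + ((\<Sum>i\<le>m. A i * s ^ i) * gs_coeff \<psi> s
        + (\<Sum>i\<le>m. gs_coeff (B i * (gs_delta ^^ i) \<psi>) (s + lam))) + gs_coeff T (s + lam)"
      using arg_cong[OF T(2), of "\<lambda>f. gs_coeff f (s + lam)"]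
      by (simp add: plus_gen_series.rep_eq zero_gen_series.rep_eq gs_coeff_sum sum.distrib sum_distrib_right)
    then show ?thesis by (simp add: eq_neg_iff_add_eq_0 algebra_simps)
  qed
  have finD: "finite {x. gs_coeff (dp_subst F P) x \<noteq> 0}"
    by (rule finite_support_dp_subst[OF finP])
  have finB: "finite {x. gs_coeff (B i) x \<noteq> 0}" for i
  proof (rule finite_subset)
    show "{x. gs_coeff (B i) x \<noteq> 0} \<subseteq> insert lam {x. gs_coeff (g i) x \<noteq> 0}"
      by (auto simp: B_def gs_coeff_minus gs_monom.rep_eq)
    show "finite (insert lam {x. gs_coeff (g i) x \<noteq> 0})"
      using finite_support_dp_subst[OF finP] by (simp add: g_def)
  qed
  \<comment> \<open>all the positive shifts that occur in the recurrence\<close>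
  define E where "E = insert (N - Re lam) ((\<lambda>x. Re x - Re lam) ` (\<Union>i\<le>m. {x. gs_coeff (B i) x \<noteq> 0})
    \<union> (\<lambda>x. Re x - Re lam - N) ` {x. gs_coeff (dp_subst F P) x \<noteq> 0 \<and> N < Re x - Re lam})"
  have finE: "finite E" using finB finD by (auto simp: E_def)
  have posE: "0 < e" if "e \<in> E" for e using that B(1) N(3) by (auto simp: E_def)
  have E0: "E \<noteq> {}" by (simp add: E_def)
  interpret tail_recurrence \<kappa> N m \<psi> p lam "\<lambda>s. \<Sum>i\<le>m. A i * s ^ i" d "Min E" "dp_subst F P" T B
  proof unfold_locales
    show "0 < Min E" using posE Min_in[OF finE E0] by blast
    show "d * cmod s ^ p \<le> cmod (\<Sum>i\<le>m. A i * s ^ i)" if "N < Re s" for s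
      using L(2)[of s] N(2) that abs_Re_le_cmod[of s] by linarith
    show "Min E \<le> N - Re lam" by (rule Min_le[OF finE]) (simp add: E_def)
    show "Min E \<le> Re x - Re lam - N" if "gs_coeff (dp_subst F P) x \<noteq> 0" "N < Re x - Re lam" for x
      using that by (intro Min_le finE) (auto simp: E_def)
    show "Min E \<le> Re t - Re lam" if "i \<le> m" "gs_coeff (B i) t \<noteq> 0" for i t
      using that by (intro Min_le finE) (auto simp: E_def)
  qed (rule p(1) L(1) recurrence finD finB B(2) T(1) gainN; assumption)+
  obtain K r where K: "0 \<le> K" "0 < r" "r \<le> 1" "\<And>Y. in_cone K Y" "\<And>Y. tail_norm r Y \<le> 1"
    using cone_and_norm_bounds by blast
  have cone: "\<bar>Im s\<bar> \<le> K * (Re s - N)" if "gs_coeff \<phi> s \<noteq> 0" "N < Re s" for s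
    using K(4)[of "Re s - N"] that by (simp add: in_cone_def \<psi>)
  have "(\<Sum>s\<in>S. cmod (gs_coeff \<phi> s) * maj_wt \<kappa> r (Re s - N)) \<le> 1"
    if S: "finite S" "\<forall>s\<in>S. N < Re s" for S
  proof -
    define Y where "Y = (\<Sum>s\<in>S. \<bar>Re s - N\<bar>)"
    let ?S = "{s \<in> S. gs_coeff \<psi> s \<noteq> 0}"
    have Y: "Re s - N \<le> Y" if "s \<in> S" for s
      unfolding Y_def using member_le_sum[of s S "\<lambda>s. \<bar>Re s - N\<bar>"] S(1) that by simp
    have "(\<Sum>s\<in>S. cmod (gs_coeff \<phi> s) * maj_wt \<kappa> r (Re s - N))
        = (\<Sum>s\<in>?S. cmod (gs_coeff \<psi> s) * maj_wt \<kappa> r (Re s - N))"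
      using S by (intro sum.mono_neutral_cong_right) (auto simp: \<psi>)
    also have "\<dots> \<le> (\<Sum>s\<in>?S. cmod s ^ m * cmod (gs_coeff \<psi> s) * maj_wt \<kappa> r (Re s - N))"
    proof (intro sum_mono mult_right_mono maj_wt_nonneg)
      fix s assume "s \<in> ?S"
      then have "1 \<le> cmod s ^ m" using norm_ge_1 by (simp add: one_le_power)
      from mult_right_mono[OF this, of "cmod (gs_coeff \<psi> s)"]
      show "cmod (gs_coeff \<psi> s) \<le> cmod s ^ m * cmod (gs_coeff \<psi> s)" by simp
    qed
    also have "\<dots> \<le> tail_norm r Y"
      unfolding tail_norm_eq using Y
      by (intro sum_mono2 finite_gs_upto mult_nonneg_nonneg maj_wt_nonneg) (auto simp: gs_upto_def)
    finally show ?thesis using K(5)[of Y] by simp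
  qed
  then show ?thesis using \<kappa>(1,2) N(1) K(1-3) cone by blast
qed

section \<open>Convergence in a sector\<close>

lemma norm_sector_power:
  assumes "\<beta> - \<alpha> < 2 * pi" "z \<in> sector \<alpha> \<beta> R"
  shows "cmod (sector_power \<alpha> \<beta> z s) \<le> exp (Re s * ln (cmod z) + \<bar>Im s\<bar> * max \<bar>\<alpha>\<bar> \<bar>\<beta>\<bar>)"
proof -
  define \<theta> where "\<theta> = (THE \<theta>. \<alpha> < \<theta> \<and> \<theta> < \<beta> \<and> is_Arg z \<theta>)"
  obtain t where t: "\<alpha> < t \<and> t < \<beta> \<and> is_Arg z t" and z: "z \<noteq> 0"
    using assms(2) by (auto simp: sector_def)
  have "\<theta> = t" unfolding \<theta>_def
  proof (rule the_equality)
    fix u assume "\<alpha> < u \<and> u < \<beta> \<and> is_Arg z u"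
    then show "u = t" using t assms(1) z by (intro is_Arg_eqI[of z]) auto
  qed (rule t)
  then have "\<bar>\<theta>\<bar> \<le> max \<bar>\<alpha>\<bar> \<bar>\<beta>\<bar>" using t by auto
  then have "\<bar>Im s\<bar> * \<bar>\<theta>\<bar> \<le> \<bar>Im s\<bar> * max \<bar>\<alpha>\<bar> \<bar>\<beta>\<bar>" by (intro mult_left_mono) auto
  then have "- (Im s * \<theta>) \<le> \<bar>Im s\<bar> * max \<bar>\<alpha>\<bar> \<bar>\<beta>\<bar>"
    using abs_ge_minus_self[of "Im s * \<theta>"] by (simp add: abs_mult)
  then show ?thesis
    by (simp add: sector_power_def sector_ln_def \<theta>_def[symmetric])
qed

text \<open>
  The losses are all exponential in \<open>Re s\<close>: by \<open>C\<close> from the Gamma function, and by \<open>K * b\<close> from the argument, which is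
  bounded by \<open>b\<close>. A smaller radius \<open>exp l\<close> compensates both.
\<close>

lemma borel_term_le:
  assumes "0 \<le> \<kappa>" "1 \<le> N" "0 \<le> K" "0 < r" "r \<le> 1"
    and C: "cmod (rGamma (1 + of_real \<kappa> * s)) * Re s powr (\<kappa> * Re s) \<le> exp (C * Re s)"
    and s: "N < Re s" "\<bar>Im s\<bar> \<le> K * (Re s - N)" and b: "0 \<le> b"
    and l: "l \<le> ln r - (C + K * b)"
  shows "cmod (rGamma (1 + of_real \<kappa> * s)) * exp (Re s * l + \<bar>Im s\<bar> * b) \<le> maj_wt \<kappa> r (Re s - N)"
proof -
  define x where "x = Re s"
  define y where "y = Re s - N"
  have xy: "0 \<le> y" "1 + y \<le> x" "y \<le> x" "0 < x" using assms(2) s(1) by (auto simp: x_def y_def)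
  have "(1 + y) powr (\<kappa> * y) \<le> x powr (\<kappa> * y)" using xy assms(1) by (intro powr_mono2) auto
  also have "\<dots> \<le> x powr (\<kappa> * x)" using xy assms(1) by (intro powr_mono mult_left_mono) auto
  finally have "cmod (rGamma (1 + of_real \<kappa> * s)) * (1 + y) powr (\<kappa> * y)
      \<le> cmod (rGamma (1 + of_real \<kappa> * s)) * x powr (\<kappa> * x)" by (intro mult_left_mono) auto
  also have "\<dots> \<le> exp (C * x)" using C by (simp add: x_def)
  finally have 1: "cmod (rGamma (1 + of_real \<kappa> * s)) \<le> exp (C * x) / (1 + y) powr (\<kappa> * y)"
    using xy by (simp add: pos_le_divide_eq)
  have "\<bar>Im s\<bar> * b \<le> K * x * b"
  proof (rule mult_right_mono[OF _ b])
    have "\<bar>Im s\<bar> \<le> K * y" using s(2) by (simp add: y_def)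
    also have "\<dots> \<le> K * x" using xy assms(3) by (intro mult_left_mono) auto
    finally show "\<bar>Im s\<bar> \<le> K * x" .
  qed
  moreover have "x * l \<le> x * (ln r - (C + K * b))" using l xy by (intro mult_left_mono) auto
  ultimately have "C * x + (x * l + \<bar>Im s\<bar> * b) \<le> x * ln r" by (simp add: algebra_simps)
  then have "exp (C * x) * exp (x * l + \<bar>Im s\<bar> * b) \<le> r powr x"
    using assms(4) by (simp add: powr_def flip: exp_add)
  also have "\<dots> \<le> r powr y" using assms(4,5) xy by (intro powr_mono') auto
  finally have 2: "exp (C * x) * exp (x * l + \<bar>Im s\<bar> * b) \<le> r powr y" .
  have "cmod (rGamma (1 + of_real \<kappa> * s)) * exp (x * l + \<bar>Im s\<bar> * b)
      \<le> exp (C * x) / (1 + y) powr (\<kappa> * y) * exp (x * l + \<bar>Im s\<bar> * b)"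
    using 1 by (intro mult_right_mono) auto
  also have "\<dots> = exp (C * x) * exp (x * l + \<bar>Im s\<bar> * b) / (1 + y) powr (\<kappa> * y)" by simp
  also have "\<dots> \<le> r powr y / (1 + y) powr (\<kappa> * y)" using 2 by (intro divide_right_mono) auto
  finally show ?thesis by (simp add: maj_wt_def x_def y_def)
qed

theorem theorem2:
  fixes m :: nat
    and F :: diff_poly
    and c s A :: "nat \<Rightarrow> complex"
    and lam :: complex
    and \<phi> :: gen_series
    and G :: "nat \<Rightarrow> gen_series"
    and k :: ereal
  defines "\<phi> \<equiv> gs_of_terms c s"
    and "G \<equiv> \<lambda>i. dp_subst (dp_deriv (U i) F) \<phi>"
    and "k \<equiv> least_positive_slope m G"
  assumes "F \<noteq> 0"
    and "dp_vars F \<subseteq> insert Z (U ` {..m})"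
    and "inj s"
    and "0 \<le> Re (s 0)"
    and "mono (\<lambda>n. Re (s n))"
    and "filterlim (\<lambda>n. Re (s n)) at_top sequentially"
    and "dp_subst F \<phi> = 0"
    and "G m \<noteq> 0"
    and "\<exists>i\<le>m. A i \<noteq> 0"
    and "\<And>i x. i \<le> m \<Longrightarrow> gs_coeff (G i - gs_monom (A i) lam) x \<noteq> 0 \<Longrightarrow> Re x > Re lam"
  shows "\<forall>\<alpha> \<beta>. \<alpha> < \<beta> \<and> \<beta> - \<alpha> < 2 * pi \<longrightarrow>
    (\<exists>R>0. uniformly_convergent_on (sector \<alpha> \<beta> R)
      (\<lambda>N z. \<Sum>n<N. c n / Gamma (1 + div_slope (s n) k) * sector_power \<alpha> \<beta> z (s n)))"
proof -
  have coeff: "gs_coeff \<phi> x = (\<Sum>n | s n = x. c n)" for x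
    unfolding \<phi>_def by (rule gs_coeff_of_terms[OF assms(9)])
  have coeff_s: "gs_coeff \<phi> (s n) = c n" for n
  proof -
    have "{j. s j = s n} = {n}" using \<open>inj s\<close> by (auto simp: inj_def)
    then show ?thesis by (simp add: coeff)
  qed
  have low: "0 \<le> Re x" if "gs_coeff \<phi> x \<noteq> 0" for x
  proof -
    from that have "\<exists>n. s n = x" unfolding coeff by (rule sum_Collect_nonzero)
    then obtain n where "s n = x" ..
    then show ?thesis
      using monoD[OF assms(8), of 0 n] assms(7) by simp
  qed
  have "\<exists>\<kappa>\<ge>0. \<exists>N\<ge>1. \<exists>K\<ge>0. \<exists>r>0. r \<le> 1 \<and>
    (\<forall>s. div_slope s k = of_real \<kappa> * s) \<and>
    (\<forall>s. gs_coeff \<phi> s \<noteq> 0 \<longrightarrow> N < Re s \<longrightarrow> \<bar>Im s\<bar> \<le> K * (Re s - N)) \<and>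
    (\<forall>S. finite S \<longrightarrow> (\<forall>s\<in>S. N < Re s) \<longrightarrow>
      (\<Sum>s\<in>S. cmod (gs_coeff \<phi> s) * maj_wt \<kappa> r (Re s - N)) \<le> 1)"
    unfolding k_def G_def
    by (rule formal_solution_bounds[OF assms(5) low assms(10) assms(11)[unfolded G_def] assms(12)
          assms(13)[unfolded G_def]])
  then obtain \<kappa> N K r where bounds: "0 \<le> \<kappa>" "1 \<le> N" "0 \<le> K" "0 < r" "r \<le> 1"
    and slope: "\<forall>s. div_slope s k = of_real \<kappa> * s"
    and cone: "\<forall>s. gs_coeff \<phi> s \<noteq> 0 \<longrightarrow> N < Re s \<longrightarrow> \<bar>Im s\<bar> \<le> K * (Re s - N)"
    and sums: "\<forall>S. finite S \<longrightarrow> (\<forall>s\<in>S. N < Re s) \<longrightarrow>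
      (\<Sum>s\<in>S. cmod (gs_coeff \<phi> s) * maj_wt \<kappa> r (Re s - N)) \<le> 1"
    by (elim exE conjE) (rule that; assumption)
  obtain C where C: "0 \<le> C" "\<And>s. 1 \<le> Re s \<Longrightarrow> \<bar>Im s\<bar> \<le> K * Re s \<Longrightarrow>
      cmod (rGamma (1 + of_real \<kappa> * s)) * Re s powr (\<kappa> * Re s) \<le> exp (C * Re s)"
    using rGamma_cone_bound[OF bounds(1), of K] by blast
  define M where "M n = (if N < Re (s n) then cmod (c n) * maj_wt \<kappa> r (Re (s n) - N) else 0)" for n
  have "summable M"
  proof (rule summableI_nonneg_bounded)
    show "0 \<le> M n" for n by (simp add: M_def maj_wt_nonneg)
    show "(\<Sum>n<j. M n) \<le> 1" for j
    proof -
      let ?J = "{n \<in> {..<j}. N < Re (s n)}"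
      have "(\<Sum>n<j. M n) = (\<Sum>n\<in>?J. cmod (gs_coeff \<phi> (s n)) * maj_wt \<kappa> r (Re (s n) - N))"
        by (rule sum.mono_neutral_cong_right) (auto simp: M_def coeff_s)
      also have "\<dots> = (\<Sum>x\<in>s ` ?J. cmod (gs_coeff \<phi> x) * maj_wt \<kappa> r (Re x - N))"
        using \<open>inj s\<close> by (subst sum.reindex) (auto intro: inj_on_subset)
      also have "\<dots> \<le> 1" by (rule sums[rule_format]) auto
      finally show ?thesis .
    qed
  qed
  show ?thesis
  proof (intro allI impI)
    fix \<alpha> \<beta> :: real assume ab: "\<alpha> < \<beta> \<and> \<beta> - \<alpha> < 2 * pi"
    define b where "b = max \<bar>\<alpha>\<bar> \<bar>\<beta>\<bar>"
    \<comment> \<open>this radius absorbs the exponential losses in \<open>borel_term_le\<close>\<close>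
    define R where "R = r * exp (- (C + K * b))"
    have R: "0 < R" using bounds by (simp add: R_def)
    have lnR: "ln R = ln r - (C + K * b)" using bounds by (simp add: R_def ln_mult)
    have "uniformly_convergent_on (sector \<alpha> \<beta> R)
      (\<lambda>N z. \<Sum>n<N. c n / Gamma (1 + div_slope (s n) k) * sector_power \<alpha> \<beta> z (s n))"
    proof (rule Weierstrass_m_test'_ev[OF _ \<open>summable M\<close>])
      have "\<forall>\<^sub>F n in sequentially. N < Re (s n)"
        using assms(9) by (simp add: filterlim_at_top_dense)
      then show "\<forall>\<^sub>F n in sequentially. \<forall>z\<in>sector \<alpha> \<beta> R.
          cmod (c n / Gamma (1 + div_slope (s n) k) * sector_power \<alpha> \<beta> z (s n)) \<le> M n"
      proof (eventually_elim, intro ballI)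
        fix n z assume n: "N < Re (s n)" and z: "z \<in> sector \<alpha> \<beta> R"
        show "cmod (c n / Gamma (1 + div_slope (s n) k) * sector_power \<alpha> \<beta> z (s n)) \<le> M n"
        proof (cases "c n = 0")
          case False
          have im: "\<bar>Im (s n)\<bar> \<le> K * (Re (s n) - N)"
            using cone[rule_format, of "s n"] False n by (simp add: coeff_s)
          also have "\<dots> \<le> K * Re (s n)" using bounds by (intro mult_left_mono) auto
          finally have im': "\<bar>Im (s n)\<bar> \<le> K * Re (s n)" .
          have "0 < cmod z" "cmod z < R" using z by (auto simp: sector_def)
          then have l: "ln (cmod z) \<le> ln r - (C + K * b)" using R by (simp flip: lnR)
          have "cmod (c n / Gamma (1 + div_slope (s n) k) * sector_power \<alpha> \<beta> z (s n))
              = cmod (c n) * (cmod (rGamma (1 + of_real \<kappa> * s n)) * cmod (sector_power \<alpha> \<beta> z (s n)))"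
            by (simp add: slope rGamma_inverse_Gamma norm_mult divide_inverse)
          also have "\<dots> \<le> cmod (c n) * (cmod (rGamma (1 + of_real \<kappa> * s n))
              * exp (Re (s n) * ln (cmod z) + \<bar>Im (s n)\<bar> * b))"
            unfolding b_def using ab z by (intro mult_left_mono norm_sector_power) auto
          also have "\<dots> \<le> cmod (c n) * maj_wt \<kappa> r (Re (s n) - N)"
            using bounds n im im' l C(2)[of "s n"] unfolding b_def
            by (intro mult_left_mono borel_term_le) auto
          finally show ?thesis using n by (simp add: M_def)
        qed (simp add: M_def maj_wt_nonneg)
      qed
    qed
    then show "\<exists>R>0. uniformly_convergent_on (sector \<alpha> \<beta> R)
      (\<lambda>N z. \<Sum>n<N. c n / Gamma (1 + div_slope (s n) k) * sector_power \<alpha> \<beta> z (s n))"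
      using R by blast
  qed
qed

end
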